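(* Let $k\geq 2$ be a fixed integer and $q$ a fixed prime power. Then, uniformly for integers $n\geq 1$ and real $u_1,\ldots,u_{k-1}\geq 0$ satisfying $u_1+\cdots+u_{k-1}\leq 1$, \[ \frac{1}{q^n}\sum_{F\in\mathcal{M}_q(n)}\frac{1}{\tau_k(F)}\ \sum_{\substack{D_1,\ldots,D_{k-1}\in\mathcal{M}_q\\ \deg D_i\leq nu_i\ (1\leq i\leq k-1)\\ D_1\cdots D_{k-1}\mid F}}1 \;=\; F(u_1,\ldots,u_{k-1})+O\!\left(n^{-1/k}\right), \] where the implied constant depends only on $k$ and $q$.
   Context: $\mathcal{M}_q$ is the set of monic polynomials in $\mathbb{F}_q[x]$ and $\mathcal{M}_q(n)$ those of degree $n$. For $F\in\mathcal{M}_q$, $\tau_k(F)$ is the number of $k$-tuples $(D_1,\ldots,D_k)\in\mathcal{M}_q^k$ with $F=D_1\cdots D_k$. The function $F(u_1,\ldots,u_{k-1})$ (not to be confused with the polynomial $F$) is \[F(u_1,\ldots,u_{k-1})=\frac{1}{\Gamma(1/k)^k}\int_0^{u_1}\cdots\int_0^{u_{k-1}} t_1^{\frac1k-1}\cdots t_{k-1}^{\frac1k-1}(1-t_1-\cdots-t_{k-1})^{\frac1k-1}\,dt_1\cdots dt_{k-1},\] the distribution function of $\mathrm{Dir}(\frac1k,\ldots,\frac1k)$. *)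

theory Defs
  imports "HOL-Analysis.Analysis" "HOL-Computational_Algebra.Polynomial"
begin

definition monic_polys :: "'a::field poly set" where
  "monic_polys = {F. lead_coeff F = 1}"

definition monic_polys_deg :: "nat \<Rightarrow> 'a::field poly set" where
  "monic_polys_deg n = {F \<in> monic_polys. degree F = n}"

text \<open>Tuples are extensional functions on their index set, so that cardinalities of
  sets of tuples count each tuple once.\<close>

definition tau :: "nat \<Rightarrow> 'a::field poly \<Rightarrow> nat" where
  "tau k F = card {D \<in> {1..k} \<rightarrow>\<^sub>E monic_polys. F = (\<Prod>i\<in>{1..k}. D i)}"

definition dirichlet_cdf :: "nat \<Rightarrow> (nat \<Rightarrow> real) \<Rightarrow> real" where
  "dirichlet_cdf k u =
     1 / Gamma (1 / real k) ^ k *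
     (LINT t : (\<Pi>\<^sub>E i\<in>{1..k-1}. {0..u i}) | (\<Pi>\<^sub>M i\<in>{1..k-1}. lborel).
        (\<Prod>i\<in>{1..k-1}. t i powr (1 / real k - 1)) *
        (1 - (\<Sum>i\<in>{1..k-1}. t i)) powr (1 / real k - 1))"

end

theory Submission
  imports Defs "HOL-Computational_Algebra.Polynomial_Factorial"
begin

text \<open>
  Choosing \<open>F\<close> uniformly and then a factorisation \<open>F = D\<^sub>1 \<cdots> D\<^sub>k\<close> uniformly, the left-hand side is
  the distribution function of the vector of degrees. Replace the second choice by the one in which
  a factorisation has probability \<open>\<tau>\<^sub>1\<^sub>/\<^sub>k(D\<^sub>1) \<cdots> \<tau>\<^sub>1\<^sub>/\<^sub>k(D\<^sub>k)\<close>, where \<open>\<tau>\<^sub>r\<close> is the generalised divisor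
  function with Dirichlet series \<open>\<zeta>\<^sup>r\<close>. The two laws agree on the squarefree part of \<open>F\<close>, so they can
  only lead to different answers when some degree is within the degree of the squarefull part of \<open>F\<close>
  of its threshold; as squarefull polynomials are sparse, this costs \<open>O(n\<^sup>-\<^sup>1\<^sup>/\<^sup>k)\<close>.

  For the second law the degree vector has exactly the Dirichlet-multinomial distribution: its
  weights are products of coefficients of \<open>(1 - x)\<^sup>-\<^sup>1\<^sup>/\<^sup>k\<close>, because the \<open>k\<close>-th power of the generating
  function of \<open>\<tau>\<^sub>1\<^sub>/\<^sub>k\<close> is that of all monic polynomials. What remains is a Riemann sum with mesh \<open>1/n\<close>
  for the Dirichlet density, whose error is again \<open>O(n\<^sup>-\<^sup>1\<^sup>/\<^sup>k)\<close> despite the singularities on the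
  boundary of the simplex.
\<close>

section \<open>Coefficients of negative binomial series\<close>

text \<open>The uniform weight 1/tau_k(F) is not a product of one function of each D_i, so the sum
  over F cannot be separated into coordinates; the weight \<open>gen_tau\<close> is such a product.
  Once F is summed over as well, every tuple of the right total degree is allowed, and one
  generating function per coordinate remains. The parameter 1/k is forced: the k-fold convolution
  must be 1 for the weights on each F to have total mass 1.

  The exponent 1/k in both errors comes from a single coordinate. Its limiting density is
  proportional to y^(1/k-1) (1-y)^(-1/k), so an interval of length 1/n has mass at most of order
  n^(-1/k), an order reached at the end 0. Thresholds may be blurred or rounded at that price.

  The obstacle in the Riemann sum is that the density is unbounded and has no modulus of continuity.
  The error is therefore bounded pointwise by an integrable function, whose integral is again
  reduced to one coordinate.\<close>

text \<open>The coefficient of \<open>x\<^sup>n\<close> in \<open>(1 - x) powr - a\<close>.\<close>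

definition nb_coeff :: "real \<Rightarrow> nat \<Rightarrow> real" where
  "nb_coeff a n = pochhammer a n / fact n"

lemma nb_coeff_0 [simp]: "nb_coeff a 0 = 1"
  by (simp add: nb_coeff_def)

lemma nb_coeff_Suc_0 [simp]: "nb_coeff a (Suc 0) = a"
  by (simp add: nb_coeff_def)

lemma nb_coeff_one [simp]: "nb_coeff 1 n = 1"
  by (simp add: nb_coeff_def flip: pochhammer_fact)

lemma nb_coeff_nonneg: "a \<ge> 0 \<Longrightarrow> nb_coeff a n \<ge> 0"
  by (auto simp: nb_coeff_def pochhammer_prod intro!: prod_nonneg divide_nonneg_pos)

text \<open>Vandermonde's identity for rising factorials, that is, (1-x)^(-a) (1-x)^(-c) =
  (1-x)^(-(a+c)).\<close>

lemma nb_coeff_convolution: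
  "(\<Sum>i\<le>n. nb_coeff a i * nb_coeff c (n - i)) = nb_coeff (a + c) n"
proof -
  have "nb_coeff (a + c) n =
      (\<Sum>i\<le>n. of_nat (n choose i) * pochhammer a i * pochhammer c (n - i) / fact n)"
    by (simp add: nb_coeff_def pochhammer_binomial_sum sum_divide_distrib)
  also have "\<dots> = (\<Sum>i\<le>n. nb_coeff a i * nb_coeff c (n - i))"
    by (intro sum.cong refl) (simp add: nb_coeff_def binomial_fact)
  finally show ?thesis ..
qed

lemma nb_coeff_convolution_pairs:
  "(\<Sum>(i,j)\<in>{(i,j). i + j = n}. nb_coeff a i * nb_coeff c j) = nb_coeff (a + c) n"
  unfolding nb_coeff_convolution[symmetric]
  by (rule sum.reindex_bij_witness[of _ "\<lambda>i. (i, n - i)" fst]) auto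

lemma nb_coeff_zero: "nb_coeff 0 n = of_bool (n = 0)"
  by (cases n) (auto simp: nb_coeff_def pochhammer_0_left)

lemma nb_coeff_Gamma:
  assumes "a > 0"
  shows "nb_coeff a n = Gamma (real n + a) / (Gamma a * Gamma (real n + 1))"
proof -
  have "a \<notin> \<int>\<^sub>\<le>\<^sub>0" using assms by auto
  then show ?thesis
    by (simp add: nb_coeff_def pochhammer_Gamma Gamma_fact add_ac)
qed

section \<open>Log-convexity of Gamma and the size of the coefficients\<close>

lemma Gamma_real_log_convex:
  fixes x y s :: real
  assumes "x > 0" "y > 0" "0 \<le> s" "s \<le> 1"
  shows "Gamma ((1 - s) * x + s * y) \<le> Gamma x powr (1 - s) * Gamma y powr s"
proof -
  have pos: "(1 - s) * x + s * y > 0"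
    using assms by (cases "s = 0") (auto intro!: add_nonneg_pos)
  have "(ln \<circ> Gamma) ((1 - s) *\<^sub>R x + s *\<^sub>R y) \<le> (1 - s) * (ln \<circ> Gamma) x + s * (ln \<circ> Gamma) y"
    by (rule convex_onD[OF log_convex_Gamma_real]) (use assms in auto)
  then have "ln (Gamma ((1 - s) * x + s * y)) \<le> (1 - s) * ln (Gamma x) + s * ln (Gamma y)"
    by simp
  then have "exp (ln (Gamma ((1 - s) * x + s * y))) \<le> exp ((1 - s) * ln (Gamma x) + s * ln (Gamma y))"
    by simp
  then show ?thesis
    using pos assms by (simp add: exp_add powr_def Gamma_real_pos less_imp_neq[OF Gamma_real_pos, symmetric])
qed

text \<open>The two halves of Gautschi's inequality, from the log-convexity of \<open>Gamma\<close>.\<close>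

lemma Gamma_ratio_upper:
  fixes a :: real
  assumes "0 < a" "a \<le> 1" "n \<ge> 1"
  shows "Gamma (real n + a) / Gamma (real n + 1) \<le> real n powr (a - 1)"
proof -
  let ?G = "Gamma (real n)"
  have G: "?G > 0" using assms by (intro Gamma_real_pos) auto
  have rec: "Gamma (real n + 1) = real n * ?G"
    using assms by (intro Gamma_plus1) (auto elim!: nonpos_Ints_cases)
  have "Gamma (real n + a) = Gamma ((1 - a) * real n + a * (real n + 1))"
    by (simp add: algebra_simps)
  also have "\<dots> \<le> ?G powr (1 - a) * (real n * ?G) powr a"
    unfolding rec[symmetric] by (rule Gamma_real_log_convex) (use assms in auto)
  also have "\<dots> = real n powr a * ?G"
    using G by (simp add: powr_mult powr_diff)
  finally have "Gamma (real n + a) / Gamma (real n + 1) \<le> real n powr a * ?G / (real n * ?G)"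
    unfolding rec using G by (intro divide_right_mono) auto
  also have "\<dots> = real n powr (a - 1)"
    using less_imp_neq[OF G, symmetric] assms by (simp add: powr_diff)
  finally show ?thesis .
qed

lemma Gamma_ratio_lower:
  fixes a :: real
  assumes "0 < a" "a \<le> 1"
  shows "(real n + 1) powr (a - 1) \<le> Gamma (real n + a) / Gamma (real n + 1)"
proof -
  let ?x = "real n + a" and ?G = "Gamma (real n + a)"
  have x: "?x > 0" using assms by simp
  have G: "?G > 0" using x by (rule Gamma_real_pos)
  have rec: "Gamma (?x + 1) = ?x * ?G"
    using x by (intro Gamma_plus1) auto
  \<comment> \<open>Log-convexity is used on [n + a, n + a + 1] instead of [n, n + 1]: this interval
    contains n + 1, and its left end stays positive for n = 0.\<close>
  have "Gamma (real n + 1) = Gamma ((1 - (1 - a)) * ?x + (1 - a) * (?x + 1))"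
    by (simp add: algebra_simps)
  also have "\<dots> \<le> ?G powr (1 - (1 - a)) * (?x * ?G) powr (1 - a)"
    unfolding rec[symmetric] by (rule Gamma_real_log_convex) (use assms x in auto)
  also have "\<dots> = ?x powr (1 - a) * ?G"
    using G x by (simp add: powr_mult powr_diff)
  also have "\<dots> \<le> (real n + 1) powr (1 - a) * ?G"
    using G x assms by (intro mult_right_mono powr_mono2) auto
  finally have "Gamma (real n + 1) \<le> (real n + 1) powr (1 - a) * ?G" .
  moreover have "Gamma (real n + 1) > 0" by (rule Gamma_real_pos) simp
  ultimately have "1 / (real n + 1) powr (1 - a) \<le> ?G / Gamma (real n + 1)"
    by (simp add: divide_simps mult.commute)
  then show ?thesis
    using powr_minus_divide[of "real n + 1" "1 - a"] by simp
qed

text \<open>Mean value theorem; the derivative of z^p is largest in absolute value at the left end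
  \<open>x\<close>.\<close>

lemma powr_neg_exp_diff:
  fixes x y p :: real
  assumes "0 < x" "x \<le> y" "p \<le> 0"
  shows "x powr p - y powr p \<le> - p * x powr (p - 1) * (y - x)"
proof (cases "x = y")
  case False
  then have "x < y" using assms by simp
  moreover have "((\<lambda>z. z powr p) has_real_derivative p * z powr (p - 1)) (at z)" if "x \<le> z" "z \<le> y" for z
    using that assms by (auto intro!: derivative_eq_intros)
  ultimately obtain z where z: "x < z" "z < y" "y powr p - x powr p = (y - x) * (p * z powr (p - 1))"
    using MVT2[of x y "\<lambda>z. z powr p" "\<lambda>z. p * z powr (p - 1)"] by blast
  have "z powr (p - 1) \<le> x powr (p - 1)"
    using z assms by (intro powr_mono2') auto
  then have "(- p * (y - x)) * z powr (p - 1) \<le> (- p * (y - x)) * x powr (p - 1)"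
    using assms by (intro mult_left_mono mult_nonneg_nonneg) auto
  then show ?thesis using z(3) by (simp add: algebra_simps)
qed auto

text \<open>Gautschi's bounds squeeze Gamma(n+a)/Gamma(n+1) between (n+1)^(a-1) and n^(a-1), which
  differ by a power lower by one. The base n + 1 keeps the statement meaningful at n = 0.\<close>

lemma nb_coeff_asymp:
  fixes a :: real
  assumes a: "0 < a" "a \<le> 1"
  obtains C where "C > 0"
    "\<And>n. \<bar>nb_coeff a n - (real n + 1) powr (a - 1) / Gamma a\<bar> \<le> C * (real n + 1) powr (a - 2)"
proof
  \<comment> \<open>The part 1 + 1 / Gamma a serves n = 0. The 4 bounds 2^(2-a), the cost of passing
    from base n to base n + 1.\<close>
  define C where "C = 1 + 1 / Gamma a + 4 / Gamma a"
  have G: "Gamma a > 0" using a by (intro Gamma_real_pos)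
  show "C > 0" using G by (simp add: C_def add_pos_pos)
  fix n
  show "\<bar>nb_coeff a n - (real n + 1) powr (a - 1) / Gamma a\<bar> \<le> C * (real n + 1) powr (a - 2)"
  proof (cases "n = 0")
    case True
    have "\<bar>1 - 1 / Gamma a\<bar> \<le> 1 + 1 / Gamma a"
      using abs_triangle_ineq4[of 1 "1 / Gamma a"] G by simp
    also have "\<dots> \<le> C" using G by (simp add: C_def divide_simps)
    finally show ?thesis using True by simp
  next
    case False
    then have n: "real n \<ge> 1" by simp
    let ?r = "Gamma (real n + a) / Gamma (real n + 1)"
    have r: "nb_coeff a n = ?r / Gamma a"
      using a by (simp add: nb_coeff_Gamma)
    have lo: "(real n + 1) powr (a - 1) \<le> ?r" by (rule Gamma_ratio_lower) (use a in auto)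
    have up: "?r \<le> real n powr (a - 1)" by (rule Gamma_ratio_upper) (use a False in auto)
    have "real n powr (a - 1) - (real n + 1) powr (a - 1) \<le> (1 - a) * real n powr (a - 2)"
      using powr_neg_exp_diff[of "real n" "real n + 1" "a - 1"] n a by simp
    also have "\<dots> \<le> 1 * real n powr (a - 2)"
      using a by (intro mult_right_mono) auto
    also have "real n powr (a - 2) \<le> ((real n + 1) / 2) powr (a - 2)"
      using n a by (intro powr_mono2') auto
    also have "\<dots> = (real n + 1) powr (a - 2) * 2 powr (2 - a)"
      by (simp add: powr_divide powr_diff)
    also have "\<dots> \<le> (real n + 1) powr (a - 2) * 2 powr 2"
      using a by (intro mult_left_mono powr_mono) auto
    finally have "?r - (real n + 1) powr (a - 1) \<le> 4 * (real n + 1) powr (a - 2)"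
      using up by simp
    with lo have "\<bar>?r - (real n + 1) powr (a - 1)\<bar> / Gamma a \<le> 4 * (real n + 1) powr (a - 2) / Gamma a"
      using G by (intro divide_right_mono) auto
    also have "\<dots> \<le> C * (real n + 1) powr (a - 2)"
      unfolding C_def using G by (simp add: field_simps)
    finally show ?thesis
      using G unfolding r diff_divide_distrib[symmetric] by (simp add: abs_divide)
  qed
qed

lemma nb_coeff_le:
  fixes a :: real
  assumes a: "0 < a" "a \<le> 1"
  obtains C where "C > 0" "\<And>n. nb_coeff a n \<le> C * (real n + 1) powr (a - 1)"
proof -
  obtain C where C: "C > 0"
    "\<And>n. \<bar>nb_coeff a n - (real n + 1) powr (a - 1) / Gamma a\<bar> \<le> C * (real n + 1) powr (a - 2)"
    using nb_coeff_asymp[OF a] by blast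
  show ?thesis
  proof
    have G: "Gamma a > 0" using a by (intro Gamma_real_pos)
    then show "C + 1 / Gamma a > 0" using C by (simp add: add_pos_pos)
    fix n
    have "(real n + 1) powr (a - 2) \<le> (real n + 1) powr (a - 1)"
      by (intro powr_mono) auto
    then have "C * (real n + 1) powr (a - 2) \<le> C * (real n + 1) powr (a - 1)"
      using C by simp
    then show "nb_coeff a n \<le> (C + 1 / Gamma a) * (real n + 1) powr (a - 1)"
      using C(2)[of n] by (simp add: algebra_simps abs_le_iff)
  qed
qed

text \<open>One of j + 1 and N - j + 1 is at least (N + 1) / 2. If it is the second, its power -a
  gives the bound; if the first, a - 1 \<le> -a does, because a \<le> 1/2. For a = 1/k the product
  is the law of one coordinate, and j = 0 shows that the order N^(-a) is sharp.\<close>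

lemma nb_coeff_marginal_le:
  fixes a :: real
  assumes a: "0 < a" "a \<le> 1 / 2"
  obtains C where "C > 0"
    "\<And>j N. j \<le> N \<Longrightarrow> nb_coeff a j * nb_coeff (1 - a) (N - j) \<le> C * (real N + 1) powr - a"
proof -
  obtain C where C: "C > 0" "\<And>n. nb_coeff a n \<le> C * (real n + 1) powr (a - 1)"
    using nb_coeff_le[of a] a by auto
  obtain D where D: "D > 0" "\<And>n. nb_coeff (1 - a) n \<le> D * (real n + 1) powr - a"
    using nb_coeff_le[of "1 - a"] a by auto
  have half: "y powr - a \<le> 2 * (real N + 1) powr - a" if "y \<ge> (real N + 1) / 2" for y N
  proof -
    have "y powr - a \<le> ((real N + 1) / 2) powr - a"
      using that a by (intro powr_mono2') auto
    also have "\<dots> = 2 powr a * (real N + 1) powr - a"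
      by (simp add: powr_divide powr_minus field_simps)
    also have "\<dots> \<le> 2 powr 1 * (real N + 1) powr - a"
      using a by (intro mult_right_mono powr_mono) auto
    finally show ?thesis by simp
  qed
  show ?thesis
  proof
    show "C * D * 2 > 0" using C D by simp
    fix j N :: nat assume jN: "j \<le> N"
    have "(real j + 1) powr (a - 1) * (real (N - j) + 1) powr - a \<le> 2 * (real N + 1) powr - a"
    proof (cases "real j \<le> real N / 2")
      case True
      have "(real j + 1) powr (a - 1) \<le> (real j + 1) powr 0"
        using a by (intro powr_mono) auto
      then have "(real j + 1) powr (a - 1) * (real (N - j) + 1) powr - a \<le> 1 * (2 * (real N + 1) powr - a)"
        using True jN by (intro mult_mono half) (auto simp: of_nat_diff)
      then show ?thesis by simp
    next
      case False
      have "(real j + 1) powr (a - 1) \<le> (real j + 1) powr - a"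
        using a by (intro powr_mono) auto
      also have "\<dots> \<le> 2 * (real N + 1) powr - a"
        using False by (intro half) auto
      finally have 1: "(real j + 1) powr (a - 1) \<le> 2 * (real N + 1) powr - a" .
      have "(real (N - j) + 1) powr - a \<le> (real (N - j) + 1) powr 0"
        using a by (intro powr_mono) auto
      with 1 have "(real j + 1) powr (a - 1) * (real (N - j) + 1) powr - a \<le> (2 * (real N + 1) powr - a) * 1"
        by (intro mult_mono) auto
      then show ?thesis by simp
    qed
    then have "(C * D) * ((real j + 1) powr (a - 1) * (real (N - j) + 1) powr - a) \<le> (C * D) * (2 * (real N + 1) powr - a)"
      using C D by (intro mult_left_mono) auto
    moreover have "nb_coeff a j * nb_coeff (1 - a) (N - j) \<le>
      (C * (real j + 1) powr (a - 1)) * (D * (real (N - j) + 1) powr - a)"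
      using C D a by (intro mult_mono nb_coeff_nonneg) auto
    ultimately show "nb_coeff a j * nb_coeff (1 - a) (N - j) \<le> C * D * 2 * (real N + 1) powr - a"
      by (simp add: mult_ac)
  qed
qed

section \<open>Decompositions into sums\<close>

text \<open>Used both for degree vectors (in \<open>nat\<close>) and for factorisations (in multisets of primes).\<close>

definition decomps :: "'i set \<Rightarrow> 'b::comm_monoid_add \<Rightarrow> ('i \<Rightarrow> 'b) set" where
  "decomps J x = {D \<in> J \<rightarrow>\<^sub>E UNIV. (\<Sum>i\<in>J. D i) = x}"

lemma decomps_empty: "decomps {} x = (if x = 0 then {\<lambda>_. undefined} else {})"
  by (auto simp: decomps_def)

text \<open>A commutative monoid has no subtraction, so the entry at \<open>j\<close> and the total
  of the rest are carried as a pair with sum \<open>x\<close>. The inverse map resets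
  \<open>j\<close> to \<open>undefined\<close> because tuples are extensional.\<close>

lemma bij_betw_decomps_insert:
  assumes "finite J" "j \<notin> J"
  shows "bij_betw (\<lambda>((a, b), D). D(j := a))
           (SIGMA p:{(a, b). a + b = x}. decomps J (snd p)) (decomps (insert j J) x)"
proof (rule bij_betw_byWitness[where f' = "\<lambda>D. ((D j, \<Sum>i\<in>J. D i), D(j := undefined))"])
  show "\<forall>y\<in>SIGMA p:{(a, b). a + b = x}. decomps J (snd p).
      (\<lambda>D. ((D j, \<Sum>i\<in>J. D i), D(j := undefined))) ((\<lambda>((a, b), D). D(j := a)) y) = y"
    using assms by (auto simp: decomps_def fun_eq_iff PiE_iff extensional_def intro!: sum.cong)
  show "\<forall>D\<in>decomps (insert j J) x. (\<lambda>((a, b), D). D(j := a)) ((D j, \<Sum>i\<in>J. D i), D(j := undefined)) = D"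
    by auto
  have *: "(\<Sum>i\<in>J. (D(j := a)) i) = (\<Sum>i\<in>J. D i)" for D :: "'a \<Rightarrow> 'b" and a
    using assms by (intro sum.cong) auto
  show "(\<lambda>((a, b), D). D(j := a)) ` (SIGMA p:{(a, b). a + b = x}. decomps J (snd p)) \<subseteq> decomps (insert j J) x"
    using assms * by (auto simp: decomps_def PiE_iff extensional_def)
  show "(\<lambda>D. ((D j, \<Sum>i\<in>J. D i), D(j := undefined))) ` decomps (insert j J) x
      \<subseteq> (SIGMA p:{(a, b). a + b = x}. decomps J (snd p))"
    using assms * by (auto simp: decomps_def PiE_iff extensional_def)
qed

lemma finite_decomps:
  assumes "finite J" and fin: "\<And>y :: 'b::comm_monoid_add. finite {(a, b). a + b = y}"
  shows "finite (decomps J (x :: 'b))"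
  using assms(1)
proof (induction J arbitrary: x rule: finite_induct)
  case (insert j J)
  have "finite (SIGMA p:{(a, b). a + b = x}. decomps J (snd p))"
    using insert fin by (intro finite_SigmaI) auto
  then show ?case
    using bij_betw_finite[OF bij_betw_decomps_insert[OF insert(1,2)]] by blast
qed (simp add: decomps_empty)

lemma sum_decomps_insert:
  assumes "finite J" "j \<notin> J" and fin: "\<And>y :: 'b::comm_monoid_add. finite {(a, b). a + b = y}"
  shows "(\<Sum>D\<in>decomps (insert j J) (x :: 'b). h D) =
    (\<Sum>(a, b)\<in>{(a, b). a + b = x}. \<Sum>D\<in>decomps J b. h (D(j := a)))"
proof -
  have "(\<Sum>D\<in>decomps (insert j J) x. h D) =
      (\<Sum>((a, b), D)\<in>(SIGMA p:{(a, b). a + b = x}. decomps J (snd p)). h (D(j := a)))"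
    by (subst sum.reindex_bij_betw[OF bij_betw_decomps_insert[OF assms(1,2)], symmetric])
      (simp add: case_prod_beta)
  also have "\<dots> = (\<Sum>p\<in>{(a, b). a + b = x}. \<Sum>D\<in>decomps J (snd p). h (D(j := fst p)))"
    by (subst sum.Sigma) (auto simp: fin finite_decomps[OF assms(1) fin] case_prod_beta)
  finally show ?thesis by (simp add: case_prod_beta)
qed

text \<open>The extra weight \<open>g\<close> on one coordinate lets the same expansion give total
  masses (with \<open>g\<close> constant 1) and the law of a single coordinate.\<close>

lemma sum_decomps_insert_prod:
  fixes f :: "'b::comm_monoid_add \<Rightarrow> real"
  assumes "finite J" "j \<notin> J" and fin: "\<And>y :: 'b. finite {(a, b). a + b = y}"
  shows "(\<Sum>D\<in>decomps (insert j J) x. (\<Prod>i\<in>insert j J. f (D i)) * g (D j)) =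
    (\<Sum>(a, b)\<in>{(a, b). a + b = x}. f a * g a * (\<Sum>D\<in>decomps J b. \<Prod>i\<in>J. f (D i)))"
proof -
  have "(\<Prod>i\<in>insert j J. f ((D(j := a)) i)) = f a * (\<Prod>i\<in>J. f (D i))" for D a
    using assms by (auto intro!: arg_cong2[of _ _ _ _ "(*)"] prod.cong)
  then show ?thesis
    unfolding sum_decomps_insert[OF assms]
    by (auto intro!: sum.cong simp: sum_distrib_left mult_ac)
qed

text \<open>In a convolution semigroup with parameter r and its unit at r = 0, a convolution of
  \<open>card J\<close> copies multiplies the parameter by \<open>card J\<close>. Both
  \<open>nb_coeff\<close> on degrees and \<open>gen_tau\<close> on multisets are of this kind, and
  at r = 1 / card J both get total mass 1.\<close>

lemma sum_decomps_prod:
  fixes f :: "real \<Rightarrow> 'b::comm_monoid_add \<Rightarrow> real"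
  assumes "finite J" and fin: "\<And>y :: 'b. finite {(a, b). a + b = y}"
    and zero: "\<And>x. f 0 x = of_bool (x = 0)"
    and conv: "\<And>r s x. (\<Sum>(a, b)\<in>{(a, b). a + b = x}. f r a * f s b) = f (r + s) x"
  shows "(\<Sum>D\<in>decomps J x. \<Prod>i\<in>J. f r (D i)) = f (real (card J) * r) x"
  using assms(1)
proof (induction J arbitrary: x rule: finite_induct)
  case (insert j J)
  show ?case
    using sum_decomps_insert_prod[OF insert(1,2) fin, of "f r" "\<lambda>_. 1"] insert conv
    by (simp add: algebra_simps)
qed (simp add: decomps_empty zero)

lemma finite_add_eq_nat: "finite {(a, b). a + b = (n :: nat)}"
  by (rule finite_subset[of _ "{..n} \<times> {..n}"]) auto

lemma finite_decomps_nat [intro]: "finite J \<Longrightarrow> finite (decomps J (n :: nat))"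
  by (rule finite_decomps[OF _ finite_add_eq_nat])

lemma sum_decomps_nb_coeff:
  "finite J \<Longrightarrow> (\<Sum>d\<in>decomps J n. \<Prod>i\<in>J. nb_coeff a (d i)) = nb_coeff (real (card J) * a) n"
  by (rule sum_decomps_prod) (auto simp: finite_add_eq_nat nb_coeff_zero nb_coeff_convolution_pairs)

lemma sum_decomps_fps:
  fixes c :: "nat \<Rightarrow> real"
  assumes "finite J"
  shows "(\<Sum>d\<in>decomps J n. \<Prod>i\<in>J. c (d i)) = fps_nth (Abs_fps c ^ card J) n"
  using assms
proof (induction J arbitrary: n rule: finite_induct)
  case (insert j J)
  have "(\<Sum>d\<in>decomps (insert j J) n. \<Prod>i\<in>insert j J. c (d i)) =
      (\<Sum>(a, b)\<in>{(a, b). a + b = n}. c a * fps_nth (Abs_fps c ^ card J) b)"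
    using sum_decomps_insert_prod[OF insert(1,2) finite_add_eq_nat, of c "\<lambda>_. 1"] insert by simp
  also have "\<dots> = (\<Sum>i=0..n. c i * fps_nth (Abs_fps c ^ card J) (n - i))"
    by (rule sum.reindex_bij_witness[of _ "\<lambda>i. (i, n - i)" fst]) auto
  finally show ?case using insert by (simp add: fps_mult_nth)
qed (simp add: decomps_empty)

text \<open>In f^k - g^k = (f - g) S the cofactor S has constant term k, so it is nonzero, and real
  power series form a domain. This recovers a series from its k-th power.\<close>

lemma fps_power_inject:
  fixes f g :: "real fps"
  assumes "f ^ k = g ^ k" "k > 0" "fps_nth f 0 = 1" "fps_nth g 0 = 1"
  shows "f = g"
proof -
  have "f ^ k - g ^ k = (f - g) * (\<Sum>i<k. g ^ (k - Suc i) * f ^ i)"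
    by (rule power_diff_sumr2)
  moreover have "fps_nth (\<Sum>i<k. g ^ (k - Suc i) * f ^ i) 0 = real k"
    using assms by (simp add: fps_sum_nth fps_nth_power_0)
  then have "(\<Sum>i<k. g ^ (k - Suc i) * f ^ i) \<noteq> 0" using assms(2) by auto
  ultimately show ?thesis using assms(1) by auto
qed

lemma finite_add_eq_mset: "finite {(A, B). A + B = (M :: 'p multiset)}"
proof -
  have "finite {A. A \<subseteq># M}"
  proof (induction M)
    case (add x M)
    have "A \<subseteq># M \<or> (\<exists>B. B \<subseteq># M \<and> A = add_mset x B)" if "A \<subseteq># add_mset x M" for A
    proof (cases "x \<in># A")
      case True
      then obtain B where "A = add_mset x B" by (auto dest: mset_add)
      with that show ?thesis by auto
    next
      case False
      then show ?thesis
        using that by (metis diff_empty diff_single_trivial add_mset_add_single subset_eq_diff_conv)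
    qed
    then have "{A. A \<subseteq># add_mset x M} \<subseteq> {A. A \<subseteq># M} \<union> add_mset x ` {A. A \<subseteq># M}" by auto
    then show ?case using add finite_subset by blast
  qed simp
  moreover have "{(A, B). A + B = M} \<subseteq> {A. A \<subseteq># M} \<times> {A. A \<subseteq># M}" by auto
  ultimately show ?thesis using finite_subset by blast
qed

lemma finite_decomps_mset [intro]: "finite J \<Longrightarrow> finite (decomps J (M :: 'p multiset))"
  by (rule finite_decomps[OF _ finite_add_eq_mset])

text \<open>The generalised divisor function \<open>\<tau>\<^sub>r\<close>, on multisets of primes.\<close>

definition gen_tau :: "real \<Rightarrow> 'p multiset \<Rightarrow> real" where
  "gen_tau r M = (\<Prod>p\<in>set_mset M. nb_coeff r (count M p))"

lemma gen_tau_superset: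
  "finite S \<Longrightarrow> set_mset M \<subseteq> S \<Longrightarrow> gen_tau r M = (\<Prod>p\<in>S. nb_coeff r (count M p))"
  unfolding gen_tau_def by (rule prod.mono_neutral_left) (auto simp: not_in_iff)

lemma gen_tau_one [simp]: "gen_tau 1 M = 1"
  by (simp add: gen_tau_def)

lemma gen_tau_nonneg: "r \<ge> 0 \<Longrightarrow> gen_tau r M \<ge> 0"
  by (auto simp: gen_tau_def intro!: prod_nonneg nb_coeff_nonneg)

lemma gen_tau_add:
  assumes "set_mset A \<inter> set_mset B = {}"
  shows "gen_tau r (A + B) = gen_tau r A * gen_tau r B"
proof -
  have "gen_tau r (A + B) = (\<Prod>p\<in>set_mset A. nb_coeff r (count (A + B) p)) *
      (\<Prod>p\<in>set_mset B. nb_coeff r (count (A + B) p))"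
    using assms by (simp add: gen_tau_def prod.union_disjoint)
  also have "(\<Prod>p\<in>set_mset A. nb_coeff r (count (A + B) p)) = gen_tau r A"
    unfolding gen_tau_def using assms by (intro prod.cong) (auto simp: not_in_iff disjoint_iff)
  also have "(\<Prod>p\<in>set_mset B. nb_coeff r (count (A + B) p)) = gen_tau r B"
    unfolding gen_tau_def
  proof (intro prod.cong refl)
    fix p assume "p \<in># B"
    then have "p \<notin># A" using assms by auto
    then show "nb_coeff r (count (A + B) p) = nb_coeff r (count B p)"
      by (simp add: not_in_iff)
  qed
  finally show ?thesis .
qed

lemma gen_tau_squarefree:
  assumes "\<And>p. count A p \<le> 1"
  shows "gen_tau r A = r ^ size A"
proof -
  have 1: "count A p = 1" if "p \<in># A" for p
    using assms[of p] that by (metis count_greater_eq_one_iff le_antisym)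
  then have "gen_tau r A = (\<Prod>p\<in>set_mset A. r)"
    unfolding gen_tau_def by (intro prod.cong) auto
  moreover have "size A = card (set_mset A)"
    using 1 by (simp add: size_multiset_overloaded_eq)
  ultimately show ?thesis by simp
qed

text \<open>Splitting M as A + B means splitting every multiplicity independently, so the sum is the
  expansion of a product over primes of \<open>nb_coeff_convolution\<close>.\<close>

lemma gen_tau_convolution:
  "(\<Sum>(A, B)\<in>{(A, B). A + B = M}. gen_tau r A * gen_tau s B) = gen_tau (r + s) M"
proof -
  let ?S = "set_mset M"
  let ?A = "\<lambda>g. \<Sum>p\<in>?S. replicate_mset (g p) p"
  have "gen_tau (r + s) M =
      (\<Prod>p\<in>?S. \<Sum>i\<le>count M p. nb_coeff r i * nb_coeff s (count M p - i))"
    by (simp add: gen_tau_def nb_coeff_convolution)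
  also have "\<dots> = (\<Sum>g\<in>(\<Pi>\<^sub>E p\<in>?S. {..count M p}).
      \<Prod>p\<in>?S. nb_coeff r (g p) * nb_coeff s (count M p - g p))"
    by (rule prod_sum_PiE) auto
  also have "\<dots> = (\<Sum>(A, B)\<in>{(A, B). A + B = M}. gen_tau r A * gen_tau s B)"
  proof (rule sum.reindex_bij_witness[where j = "\<lambda>g. (?A g, M - ?A g)"
        and i = "\<lambda>(A, B). restrict (count A) ?S"])
    have cnt: "count (?A g) x = (if x \<in># M then g x else 0)" for g :: "'a \<Rightarrow> nat" and x
      by (simp add: count_sum if_distrib sum.delta cong: if_cong)
    fix g assume g: "g \<in> (\<Pi>\<^sub>E p\<in>?S. {..count M p})"
    then have sub: "?A g \<subseteq># M"
      by (intro mset_subset_eqI) (auto simp: cnt PiE_iff)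
    show "(\<lambda>(A, B). restrict (count A) ?S) (?A g, M - ?A g) = g"
      using g by (auto simp: fun_eq_iff cnt restrict_def PiE_iff extensional_def)
    show "(?A g, M - ?A g) \<in> {(A, B). A + B = M}"
      using sub by simp
    have "set_mset (?A g) \<subseteq> ?S" using sub by (rule set_mset_mono)
    moreover have "set_mset (M - ?A g) \<subseteq> ?S"
      by (auto dest: in_diffD)
    ultimately show "(\<lambda>(A, B). gen_tau r A * gen_tau s B)
        (?A g, M - ?A g) =
        (\<Prod>p\<in>?S. nb_coeff r (g p) * nb_coeff s (count M p - g p))"
      by (simp add: gen_tau_superset[of ?S] cnt prod.distrib)
  next
    fix x assume "x \<in> {(A, B). A + B = M}"
    then obtain A B where x: "x = (A, B)" and M: "M = A + B" by auto
    have "(\<Sum>p\<in>?S. replicate_mset (restrict (count A) ?S p) p) = A"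
      by (rule multiset_eqI) (simp add: count_sum M if_distrib sum.delta not_in_iff cong: if_cong)
    then show "(\<lambda>g. (?A g, M - ?A g))
        ((\<lambda>(A, B). restrict (count A) ?S) x) = x"
      using x M by simp
    show "(\<lambda>(A, B). restrict (count A) ?S) x \<in> (\<Pi>\<^sub>E p\<in>?S. {..count M p})"
      using x M by auto
  qed
  finally show ?thesis ..
qed

lemma gen_tau_zero: "gen_tau 0 M = of_bool (M = {#})"
  by (auto simp: gen_tau_def nb_coeff_zero)

lemma sum_decomps_gen_tau:
  "finite J \<Longrightarrow> (\<Sum>D\<in>decomps J M. \<Prod>i\<in>J. gen_tau r (D i)) = gen_tau (real (card J) * r) M"
  by (rule sum_decomps_prod) (auto simp: finite_add_eq_mset gen_tau_zero gen_tau_convolution)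

section \<open>The two weights on the factorisations of one element\<close>

text \<open>Coprime parts factor independently; the two tuples are recovered by keeping the primes
  of \<open>M1\<close> and the primes of \<open>M2\<close> in each entry.\<close>

lemma bij_betw_decomps_add:
  fixes J :: "'i set" and M1 M2 :: "'p multiset"
  assumes J: "finite J" and disj: "set_mset M1 \<inter> set_mset M2 = {}"
  shows "bij_betw (\<lambda>(D1, D2). \<lambda>i\<in>J. D1 i + D2 i) (decomps J M1 \<times> decomps J M2) (decomps J (M1 + M2))"
proof -
  let ?F = "\<lambda>S D. \<lambda>i\<in>J. filter_mset (\<lambda>p. p \<in> S) (D i)"
  have sub: "set_mset (D i) \<subseteq> set_mset M" if "D \<in> decomps J M" "i \<in> J" for D i and M :: "'p multiset"
    using that J by (auto simp: decomps_def set_mset_sum)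
  have filter_sum: "(\<Sum>i\<in>J. filter_mset R (D i)) = filter_mset R (\<Sum>i\<in>J. D i)" for R and D :: "'i \<Rightarrow> 'p multiset"
    by (rule multiset_eqI) (simp add: count_sum)
  have filter_id: "filter_mset (\<lambda>p. p \<in> S) A = A" if "set_mset A \<subseteq> S" for S and A :: "'p multiset"
    using that by (auto simp: filter_mset_eq_conv)
  have filter_empty: "filter_mset (\<lambda>p. p \<in> S) A = {#}" if "set_mset A \<inter> S = {}" for S and A :: "'p multiset"
    using that by auto
  show ?thesis
  proof (rule bij_betw_byWitness[where f' = "\<lambda>D. (?F (set_mset M1) D, ?F (set_mset M2) D)"])
    show "\<forall>a\<in>decomps J M1 \<times> decomps J M2.
        (\<lambda>D. (?F (set_mset M1) D, ?F (set_mset M2) D)) ((\<lambda>(D1, D2). \<lambda>i\<in>J. D1 i + D2 i) a) = a"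
    proof
      fix a assume "a \<in> decomps J M1 \<times> decomps J M2"
      then obtain D1 D2 where a: "a = (D1, D2)" and D: "D1 \<in> decomps J M1" "D2 \<in> decomps J M2"
        by auto
      have "filter_mset (\<lambda>p. p \<in># M1) (D1 i + D2 i) = D1 i" "filter_mset (\<lambda>p. p \<in># M2) (D1 i + D2 i) = D2 i"
        if "i \<in> J" for i
        using sub[OF D(1) that] sub[OF D(2) that] disj
        by (auto simp: filter_id filter_empty disjoint_iff subset_iff)
      moreover have "D1 i = undefined" "D2 i = undefined" if "i \<notin> J" for i
        using D that by (auto simp: decomps_def PiE_iff extensional_def)
      ultimately show "(\<lambda>D. (?F (set_mset M1) D, ?F (set_mset M2) D)) ((\<lambda>(D1, D2). \<lambda>i\<in>J. D1 i + D2 i) a) = a"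
        unfolding a by (auto simp: fun_eq_iff restrict_def)
    qed
    show "\<forall>D\<in>decomps J (M1 + M2). (\<lambda>(D1, D2). \<lambda>i\<in>J. D1 i + D2 i) (?F (set_mset M1) D, ?F (set_mset M2) D) = D"
    proof
      fix D assume D: "D \<in> decomps J (M1 + M2)"
      have "filter_mset (\<lambda>p. p \<in># M1) (D i) + filter_mset (\<lambda>p. p \<in># M2) (D i) = D i" if "i \<in> J" for i
      proof (rule multiset_eqI)
        fix x show "count (filter_mset (\<lambda>p. p \<in># M1) (D i) + filter_mset (\<lambda>p. p \<in># M2) (D i)) x = count (D i) x"
        proof (cases "x \<in># D i")
          case True
          then have "x \<in># M1 \<longleftrightarrow> x \<notin># M2" using sub[OF D that] disj by auto
          then show ?thesis by simp
        qed (simp add: not_in_iff)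
      qed
      then show "(\<lambda>(D1, D2). \<lambda>i\<in>J. D1 i + D2 i) (?F (set_mset M1) D, ?F (set_mset M2) D) = D"
        using D by (auto simp: fun_eq_iff restrict_def decomps_def PiE_iff extensional_def)
    qed
    show "(\<lambda>(D1, D2). \<lambda>i\<in>J. D1 i + D2 i) ` (decomps J M1 \<times> decomps J M2) \<subseteq> decomps J (M1 + M2)"
      by (auto simp: decomps_def sum.distrib)
    show "(\<lambda>D. (?F (set_mset M1) D, ?F (set_mset M2) D)) ` decomps J (M1 + M2) \<subseteq> decomps J M1 \<times> decomps J M2"
      using disj by (auto simp: decomps_def filter_sum filter_id filter_empty Int_commute)
  qed
qed

lemma mset_weight_sum:
  "finite J \<Longrightarrow> (\<Sum>p\<in>#(\<Sum>i\<in>J. D i). w p) = (\<Sum>i\<in>J. \<Sum>p\<in>#D i. w p)"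
  by (induction J rule: finite_induct) auto

lemma size_sum_mset:
  fixes D :: "'i \<Rightarrow> 'p multiset"
  shows "finite J \<Longrightarrow> size (\<Sum>i\<in>J. D i) = (\<Sum>i\<in>J. size (D i))"
  by (induction J rule: finite_induct) auto

text \<open>The weight is constant on the factorisations of a squarefree element and sums to 1, so it is the
  uniform weight; the value of \<open>\<tau>\<^sub>k\<close> is not needed.\<close>

lemma prod_gen_tau_squarefree:
  assumes J: "finite J" "J \<noteq> {}" and M: "\<And>p. count M p \<le> 1" and D: "D \<in> decomps J M"
  shows "(\<Prod>i\<in>J. gen_tau (1 / real (card J)) (D i)) = 1 / real (card (decomps J M))"
proof -
  let ?a = "1 / real (card J)"
  have const: "(\<Prod>i\<in>J. gen_tau ?a (E i)) = ?a ^ size M" if E: "E \<in> decomps J M" for E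
  proof -
    have sum: "(\<Sum>i\<in>J. E i) = M" using E by (simp add: decomps_def)
    have "count (E i) p \<le> 1" if "i \<in> J" for i p
    proof -
      have "count (E i) p \<le> (\<Sum>i\<in>J. count (E i) p)"
        using that J by (intro member_le_sum) auto
      also have "\<dots> = count M p" by (simp add: count_sum flip: sum)
      finally show ?thesis using M[of p] by simp
    qed
    then have "(\<Prod>i\<in>J. gen_tau ?a (E i)) = (\<Prod>i\<in>J. ?a ^ size (E i))"
      by (intro prod.cong gen_tau_squarefree) auto
    also have "\<dots> = ?a ^ size M"
      using J by (simp add: power_sum size_sum_mset flip: sum)
    finally show ?thesis .
  qed
  have "(\<Sum>E\<in>decomps J M. \<Prod>i\<in>J. gen_tau ?a (E i)) = 1"
    using J by (simp add: sum_decomps_gen_tau)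
  then have "real (card (decomps J M)) * ?a ^ size M = 1"
    by (simp add: const)
  then have "?a ^ size M = 1 / real (card (decomps J M))"
    by (metis eq_divide_imp mult.commute mult_zero_left zero_neq_one)
  then show ?thesis using const[OF D] by simp
qed

text \<open>Probabilities lie in [0, 1], and an event that is constant on \<open>X\<close> has the
  same probability under both weights. \<open>B\<close> stands for the circumstances in which
  constancy may fail.\<close>

lemma abs_sum_weights_diff_le:
  fixes w w' :: "'x \<Rightarrow> real"
  assumes "finite X" "\<And>x. x \<in> X \<Longrightarrow> w x \<ge> 0" "\<And>x. x \<in> X \<Longrightarrow> w' x \<ge> 0"
    and "sum w X = 1" "sum w' X = 1"
    and const: "\<not> B \<Longrightarrow> \<exists>c. \<forall>x\<in>X. Q x = c"
  shows "\<bar>\<Sum>x\<in>X. (w x - w' x) * of_bool (Q x)\<bar> \<le> of_bool B"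
proof (cases B)
  case True
  have "0 \<le> (\<Sum>x\<in>X. w x * of_bool (Q x))" "0 \<le> (\<Sum>x\<in>X. w' x * of_bool (Q x))"
    using assms by (intro sum_nonneg; simp)+
  moreover have "(\<Sum>x\<in>X. w x * of_bool (Q x)) \<le> sum w X" "(\<Sum>x\<in>X. w' x * of_bool (Q x)) \<le> sum w' X"
    using assms by (intro sum_mono; simp)+
  ultimately show ?thesis
    using True assms(4,5) unfolding left_diff_distrib sum_subtractf by (simp del: sum_mult_of_bool_eq)
next
  case False
  then obtain c where c: "\<And>x. x \<in> X \<Longrightarrow> Q x = c" using const by blast
  have "(\<Sum>x\<in>X. (w x - w' x) * of_bool (Q x)) = (\<Sum>x\<in>X. (w x - w' x) * of_bool c)"
    by (intro sum.cong) (auto simp: c)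
  also have "\<dots> = (sum w X - sum w' X) * of_bool c"
    by (simp add: sum_subtractf sum_distrib_right left_diff_distrib)
  finally show ?thesis using assms by simp
qed

text \<open>Conditionally on the part \<open>D1\<close> of the factorisation above \<open>M1\<close>, the event is decided
  unless some coordinate lies in a window of length \<open>wdeg M2\<close> below its threshold.\<close>

lemma uniform_vs_gen_tau:
  fixes J I :: "'i set" and M1 M2 :: "'p multiset" and deg :: "'p \<Rightarrow> nat" and v :: "'i \<Rightarrow> real"
  defines "wdeg \<equiv> \<lambda>M. \<Sum>p\<in>#M. deg p"
  assumes J: "finite J" "J \<noteq> {}" "I \<subseteq> J"
    and disj: "set_mset M1 \<inter> set_mset M2 = {}" and sqfree: "\<And>p. count M1 p \<le> 1"
  shows "\<bar>real (card {D \<in> decomps J (M1 + M2). \<forall>i\<in>I. real (wdeg (D i)) \<le> v i}) / real (card (decomps J (M1 + M2)))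
      - (\<Sum>D\<in>decomps J (M1 + M2). (\<Prod>i\<in>J. gen_tau (1 / real (card J)) (D i)) *
           of_bool (\<forall>i\<in>I. real (wdeg (D i)) \<le> v i))\<bar>
    \<le> (\<Sum>D\<in>decomps J M1. (\<Prod>i\<in>J. gen_tau (1 / real (card J)) (D i)) *
         (\<Sum>i\<in>I. of_bool (v i - real (wdeg M2) < real (wdeg (D i)) \<and> real (wdeg (D i)) \<le> v i)))"
proof -
  let ?win = "\<lambda>D i. v i - real (wdeg M2) < real (wdeg (D i)) \<and> real (wdeg (D i)) \<le> v i"
  let ?w = "\<lambda>D. \<Prod>i\<in>J. gen_tau (1 / real (card J)) (D i)"
  define Q where "Q D \<longleftrightarrow> (\<forall>i\<in>I. real (wdeg (D i)) \<le> v i)" for D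
  define S where "S D1 D2 = (\<lambda>i\<in>J. D1 i + D2 i)" for D1 D2 :: "'i \<Rightarrow> 'p multiset"
  let ?X1 = "decomps J M1" and ?X2 = "decomps J M2"
  note bij = bij_betw_decomps_add[OF J(1) disj]
  have fin: "finite (decomps J M)" for M :: "'p multiset" using J by auto
  have total: "sum ?w (decomps J M) = 1" for M :: "'p multiset"
    using J by (simp add: sum_decomps_gen_tau)
  have card_pos: "card (decomps J M) > 0" for M :: "'p multiset"
    using total[of M] fin[of M] by (auto simp: card_gt_0_iff)
  have card: "card (decomps J (M1 + M2)) = card ?X1 * card ?X2"
    using bij_betw_same_card[OF bij] by (simp add: card_cartesian_product)
  have w_nonneg: "?w D \<ge> 0" for D :: "'i \<Rightarrow> 'p multiset"
    by (intro prod_nonneg gen_tau_nonneg ballI) auto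
  have sub: "set_mset (D i) \<subseteq> set_mset M" if "D \<in> decomps J M" "i \<in> J" for D i and M :: "'p multiset"
    using that J by (auto simp: decomps_def set_mset_sum)
  have w_add: "?w (S D1 D2) = ?w D1 * ?w D2" if "D1 \<in> ?X1" "D2 \<in> ?X2" for D1 D2
    unfolding prod.distrib[symmetric]
  proof (intro prod.cong refl)
    fix i assume i: "i \<in> J"
    then have "set_mset (D1 i) \<inter> set_mset (D2 i) = {}"
      using sub[OF that(1) i] sub[OF that(2) i] disj by auto
    then show "gen_tau (1 / real (card J)) (S D1 D2 i) =
        gen_tau (1 / real (card J)) (D1 i) * gen_tau (1 / real (card J)) (D2 i)"
      using i by (simp add: gen_tau_add S_def)
  qed
  have split: "(\<Sum>D\<in>decomps J (M1 + M2). h D) = (\<Sum>D1\<in>?X1. \<Sum>D2\<in>?X2. h (S D1 D2))" for h :: "_ \<Rightarrow> real"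
    by (simp add: sum.reindex_bij_betw[OF bij, symmetric] sum.cartesian_product case_prod_beta S_def)
  have "real (card {D \<in> decomps J (M1 + M2). Q D}) / real (card (decomps J (M1 + M2))) =
      (\<Sum>D\<in>decomps J (M1 + M2). of_bool (Q D) / real (card (decomps J (M1 + M2))))"
    by (simp add: fin of_bool_def sum.If_cases sum_divide_distrib[symmetric] Int_def)
  \<comment> \<open>By \<open>card\<close> the uniform weight is 1 / card ?X1 times 1 / card ?X2,
    and the first factor equals \<open>?w D1\<close> because \<open>M1\<close> is squarefree. The
    two laws differ only in the choice of \<open>D2\<close>.\<close>
  also have "\<dots> = (\<Sum>D1\<in>?X1. \<Sum>D2\<in>?X2. ?w D1 * (1 / real (card ?X2)) * of_bool (Q (S D1 D2)))"
    unfolding split card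
    using prod_gen_tau_squarefree[OF J(1,2) sqfree] by (intro sum.cong refl) simp
  finally have "real (card {D \<in> decomps J (M1 + M2). Q D}) / real (card (decomps J (M1 + M2)))
      - (\<Sum>D\<in>decomps J (M1 + M2). ?w D * of_bool (Q D)) =
      (\<Sum>D1\<in>?X1. ?w D1 * (\<Sum>D2\<in>?X2. (1 / real (card ?X2) - ?w D2) * of_bool (Q (S D1 D2))))"
    unfolding split by (simp add: w_add sum_subtractf[symmetric] sum_distrib_left algebra_simps)
  also have "\<bar>\<dots>\<bar> \<le> (\<Sum>D1\<in>?X1. ?w D1 * (\<Sum>i\<in>I. of_bool (?win D1 i)))"
  proof (rule order_trans[OF sum_abs], rule sum_mono)
    fix D1 assume D1: "D1 \<in> ?X1"
    let ?B = "\<exists>i\<in>I. ?win D1 i"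
    have "\<bar>\<Sum>D2\<in>?X2. (1 / real (card ?X2) - ?w D2) * of_bool (Q (S D1 D2))\<bar> \<le> of_bool ?B"
    proof (rule abs_sum_weights_diff_le[OF fin _ w_nonneg _ total])
      show "(\<Sum>D2\<in>?X2. 1 / real (card ?X2)) = 1" using card_pos[of M2] by simp
      assume nB: "\<not> ?B"
      show "\<exists>c. \<forall>D2\<in>?X2. Q (S D1 D2) = c"
      proof (cases "Q D1")
        case True
        have "Q (S D1 D2)" if D2: "D2 \<in> ?X2" for D2
          unfolding Q_def
        proof
          fix i assume i: "i \<in> I"
          have "wdeg (D2 i) \<le> (\<Sum>i\<in>J. wdeg (D2 i))"
            using i J by (intro member_le_sum) auto
          also have "\<dots> = wdeg M2"
            using D2 J by (simp add: wdeg_def decomps_def flip: mset_weight_sum)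
          finally have le: "wdeg (D2 i) \<le> wdeg M2" .
          show "real (wdeg (S D1 D2 i)) \<le> v i"
          proof -
            \<comment> \<open>Below the threshold and outside the window: \<open>D2\<close> adds at
              most \<open>wdeg M2\<close>, which does not carry the degree across.\<close>
            have "real (wdeg (D1 i)) \<le> v i - real (wdeg M2)" using True nB i by (force simp: Q_def)
            moreover have "wdeg (S D1 D2 i) = wdeg (D1 i) + wdeg (D2 i)"
              using i J by (auto simp: wdeg_def S_def)
            ultimately show ?thesis using le by simp
          qed
        qed
        then show ?thesis by blast
      next
        case False
        then obtain i where i: "i \<in> I" "real (wdeg (D1 i)) > v i" by (auto simp: Q_def not_le)
        \<comment> \<open>Degrees only grow when \<open>D2\<close> is added, so a threshold already
          exceeded stays exceeded.\<close>
        have "\<not> Q (S D1 D2)" for D2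
        proof
          assume "Q (S D1 D2)"
          then have "real (wdeg (S D1 D2 i)) \<le> v i" using i by (simp add: Q_def)
          moreover have "wdeg (S D1 D2 i) = wdeg (D1 i) + wdeg (D2 i)"
            using i J by (auto simp: wdeg_def S_def)
          ultimately show False using i by simp
        qed
        then show ?thesis by blast
      qed
    qed simp
    also have "of_bool ?B \<le> (\<Sum>i\<in>I. of_bool (?win D1 i) :: real)"
    proof (cases ?B)
      case True
      then obtain i where i: "i \<in> I" "?win D1 i" by blast
      have "finite I" using J finite_subset by blast
      then have "of_bool (?win D1 i) \<le> 
         (\<Sum>i\<in>I. of_bool (?win D1 i) :: real)"
        using i(1) by (intro member_le_sum) auto
      then show ?thesis using True i by simp
    qed (auto intro!: sum_nonneg)
    finally show "\<bar>?w D1 * (\<Sum>D2\<in>?X2. (1 / real (card ?X2) - ?w D2) * of_bool (Q (S D1 D2)))\<bar> \<le>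
        ?w D1 * (\<Sum>i\<in>I. of_bool (?win D1 i))"
      using w_nonneg[of D1] by (simp add: abs_mult mult_left_mono)
  qed
  finally show ?thesis unfolding Q_def .
qed

section \<open>Windows and marginals of the degree vector\<close>

text \<open>The window is half-open, so it holds at most \<open>m\<close> integers and not
  \<open>m + 1\<close>; for \<open>m = 0\<close> it is empty.\<close>

lemma card_nat_window: "card {j::nat. v - real m < real j \<and> real j \<le> v} \<le> m"
proof -
  have "{j::nat. v - real m < real j \<and> real j \<le> v} \<subseteq> {Suc (nat \<lfloor>v\<rfloor>) - m..nat \<lfloor>v\<rfloor>}"
    by (auto; linarith)
  then have "card {j::nat. v - real m < real j \<and> real j \<le> v} \<le> card {Suc (nat \<lfloor>v\<rfloor>) - m..nat \<lfloor>v\<rfloor>}"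
    by (intro card_mono) auto
  then show ?thesis by simp
qed

lemma finite_nat_window [simp]: "finite {j::nat. v - real m < real j \<and> real j \<le> v}"
  by (rule finite_subset[of _ "{..nat \<lfloor>v\<rfloor>}"]) (auto; linarith)+

text \<open>The coordinates other than \<open>j\<close> are summed out; by
  \<open>sum_decomps_nb_coeff\<close> their parameters add up to (card J - 1) a = 1 - a.\<close>

lemma nb_coeff_coordinate:
  assumes J: "finite J" "j \<in> J" and a: "a = 1 / real (card J)"
  shows "(\<Sum>d\<in>decomps J N. (\<Prod>i\<in>J. nb_coeff a (d i)) * g (d j)) =
    (\<Sum>(l, l')\<in>{(l, l'). l + l' = N}. nb_coeff a l * g l * nb_coeff (1 - a) l')"
proof -
  have J': "J = insert j (J - {j})" "finite (J - {j})" "j \<notin> J - {j}" using J by auto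
  have "card J > 0" using J by (auto simp: card_gt_0_iff)
  then have "real (card (J - {j})) * a = 1 - a" 
    using J by (auto simp: a of_nat_diff diff_divide_distrib)
  moreover have "(\<Sum>d\<in>decomps (insert j (J - {j})) N. (\<Prod>i\<in>insert j (J - {j}). nb_coeff a (d i)) * g (d j)) =
    (\<Sum>(l, l')\<in>{(l, l'). l + l' = N}. nb_coeff a l * g l * (\<Sum>d\<in>decomps (J - {j}) l'. \<Prod>i\<in>J - {j}. nb_coeff a (d i)))"
    by (rule sum_decomps_insert_prod[OF J'(2,3) finite_add_eq_nat])
  ultimately show ?thesis
    using J by (simp add: sum_decomps_nb_coeff[OF J'(2)] insert_absorb)
qed

text \<open>Each single value of a coordinate has mass O(N^(-a)). This is applied to the windows
  produced by squarefull parts and to the singletons lost when thresholds are rounded.\<close>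

lemma nb_coeff_window_le:
  assumes J: "finite J" "card J \<ge> 2"
  obtains C where "C > 0"
    "\<And>N j (S :: nat set). j \<in> J \<Longrightarrow> finite S \<Longrightarrow>
       (\<Sum>d\<in>decomps J N. (\<Prod>i\<in>J. nb_coeff (1 / real (card J)) (d i)) * of_bool (d j \<in> S))
         \<le> C * real (card S) * (real N + 1) powr - (1 / real (card J))"
proof -
  let ?a = "1 / real (card J)"
  have a: "0 < ?a" "?a \<le> 1 / 2" using J by (auto simp: field_simps)
  obtain C where C: "C > 0"
    "\<And>j N. j \<le> N \<Longrightarrow> nb_coeff ?a j * nb_coeff (1 - ?a) (N - j) \<le> C * (real N + 1) powr - ?a"
    using nb_coeff_marginal_le[OF a] by blast
  show ?thesis
  proof
    show "C > 0" by fact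
    fix N :: nat and j and S :: "nat set" assume j: "j \<in> J" and S: "finite S"
    have "(\<Sum>d\<in>decomps J N. (\<Prod>i\<in>J. nb_coeff ?a (d i)) * of_bool (d j \<in> S)) =
        (\<Sum>(l, l')\<in>{(l, l'). l + l' = N}. nb_coeff ?a l * of_bool (l \<in> S) * nb_coeff (1 - ?a) l')"
      using nb_coeff_coordinate[OF J(1) j refl, where N = N and g = "\<lambda>l. of_bool (l \<in> S)"] by simp
    also have "\<dots> = (\<Sum>l\<le>N. if l \<in> S then nb_coeff ?a l * nb_coeff (1 - ?a) (N - l) else 0)"
      by (rule sum.reindex_bij_witness[of _ "\<lambda>i. (i, N - i)" fst]) auto
    also have "\<dots> = (\<Sum>l\<in>{..N} \<inter> S. nb_coeff ?a l * nb_coeff (1 - ?a) (N - l))"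
      by (simp add: sum.inter_restrict)
    also have "\<dots> \<le> (\<Sum>l\<in>{..N} \<inter> S. C * (real N + 1) powr - ?a)"
      by (intro sum_mono C) auto
    also have "\<dots> = real (card ({..N} \<inter> S)) * (C * (real N + 1) powr - ?a)"
      by simp
    also have "\<dots> \<le> real (card S) * (C * (real N + 1) powr - ?a)"
      using C S by (intro mult_right_mono) (auto intro!: card_mono)
    finally show "(\<Sum>d\<in>decomps J N. (\<Prod>i\<in>J. nb_coeff ?a (d i)) * of_bool (d j \<in> S))
        \<le> C * real (card S) * (real N + 1) powr - ?a"
      by (simp add: mult_ac)
  qed
qed

section \<open>Monoids with unique factorisation\<close>

lemma summable_cubic_geometric:
  fixes z :: real
  assumes "0 \<le> z" "z \<le> 18 / 25"
  shows "summable (\<lambda>m. (real m + 1) ^ 3 * z ^ m)"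
\<comment> \<open>For m \<ge> 10 the cubic factor grows per step by at most (11/10)^3 = 1.331 \<le>
  1.375, and 1.375 times 18/25 is 99/100. The bound 18/25 is slightly above 1 / sqrt 2, the largest
  value of 1 / sqrt q.\<close>
proof (rule summable_ratio_test[where c = "99 / 100" and N = 10])
  fix m :: nat assume m: "m \<ge> 10"
  have "(real (Suc m) + 1) ^ 3 \<le> (11 / 10 * (real m + 1)) ^ 3"
    using m by (intro power_mono) auto
  also have "\<dots> \<le> 1375 / 1000 * (real m + 1) ^ 3"
    unfolding power_mult_distrib by (rule mult_right_mono) (auto simp: power_divide)
  finally have "(real (Suc m) + 1) ^ 3 * z \<le> (1375 / 1000 * (real m + 1) ^ 3) * (18 / 25)"
    using assms by (intro mult_mono) auto
  then have "(real (Suc m) + 1) ^ 3 * z * z ^ m \<le> (99 / 100 * (real m + 1) ^ 3) * z ^ m"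
    using assms by (intro mult_right_mono) auto
  then show "norm ((real (Suc m) + 1) ^ 3 * z ^ Suc m) \<le> 99 / 100 * norm ((real m + 1) ^ 3 * z ^ m)"
    using assms by (simp add: mult_ac abs_mult)
qed simp

text \<open>What is kept of polynomials is the count alone: the free commutative monoid on
  \<open>P\<close> has q^n elements of degree n. At n = 0 it forces every element of
  \<open>P\<close> to have positive degree.\<close>

locale arithmetic_monoid =
  fixes P :: "'p set" and deg :: "'p \<Rightarrow> nat" and q :: nat
  assumes card_eq_power: "card {M. set_mset M \<subseteq> P \<and> (\<Sum>p\<in>#M. deg p) = n} = q ^ n"
    and q_ge: "q \<ge> 2"
begin

definition wdeg :: "'p multiset \<Rightarrow> nat" where
  "wdeg M = (\<Sum>p\<in>#M. deg p)"

definition elems :: "nat \<Rightarrow> 'p multiset set" where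
  "elems n = {M. set_mset M \<subseteq> P \<and> wdeg M = n}"

definition squarefull :: "nat \<Rightarrow> 'p multiset set" where
  "squarefull n = {M \<in> elems n. \<forall>p. count M p \<noteq> 1}"

lemma wdeg_add [simp]: "wdeg (A + B) = wdeg A + wdeg B"
  by (simp add: wdeg_def)

lemma card_elems: "card (elems n) = q ^ n"
  using card_eq_power[of n] by (simp add: elems_def wdeg_def)

lemma finite_elems [simp, intro]: "finite (elems n)"
  \<comment> \<open>An infinite set has cardinality 0, so a positive count already gives
    finiteness.\<close>
  using card_elems[of n] q_ge by (intro card_ge_0_finite) simp

lemma finite_squarefull [simp, intro]: "finite (squarefull n)"
  by (simp add: squarefull_def)

lemma wdeg_sum: "finite J \<Longrightarrow> wdeg (\<Sum>i\<in>J. D i) = (\<Sum>i\<in>J. wdeg (D i))"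
  by (simp add: wdeg_def mset_weight_sum)

lemma elems_0: "elems 0 = {{#}}"
proof -
  have "{#} \<in> elems 0" by (simp add: elems_def wdeg_def)
  moreover obtain M where "elems 0 = {M}"
    using card_elems[of 0] by (auto simp: card_1_singleton_iff)
  ultimately show ?thesis by auto
qed

section \<open>Sums over all elements of a given degree\<close>

text \<open>Summing over M removes the constraint on the product: every tuple of total degree N
  factors exactly one M. As \<open>G\<close> sees only degrees, the tuples with a given degree
  vector contribute a product of one-coordinate sums.\<close>

lemma sum_elems_decomps:
  fixes f :: "'p multiset \<Rightarrow> real"
  assumes J: "finite J"
  shows "(\<Sum>M\<in>elems N. \<Sum>D\<in>decomps J M. (\<Prod>i\<in>J. f (D i)) * G (\<lambda>i\<in>J. wdeg (D i))) =
    (\<Sum>d\<in>decomps J N. (\<Prod>i\<in>J. \<Sum>M\<in>elems (d i). f M) * G d)"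
proof -
  have "(\<Sum>d\<in>decomps J N. (\<Prod>i\<in>J. \<Sum>M\<in>elems (d i). f M) * G d) =
      (\<Sum>d\<in>decomps J N. \<Sum>D\<in>(\<Pi>\<^sub>E i\<in>J. elems (d i)). (\<Prod>i\<in>J. f (D i)) * G d)"
    using J by (simp add: prod_sum_PiE sum_distrib_right)
  also have "\<dots> = (\<Sum>(d, D)\<in>(SIGMA d:decomps J N. \<Pi>\<^sub>E i\<in>J. elems (d i)). (\<Prod>i\<in>J. f (D i)) * G d)"
    using J by (subst sum.Sigma) (auto intro!: finite_PiE)
  also have "\<dots> = (\<Sum>(M, D)\<in>(SIGMA M:elems N. decomps J M). (\<Prod>i\<in>J. f (D i)) * G (\<lambda>i\<in>J. wdeg (D i)))"
  proof (rule sum.reindex_bij_witness[where i = "\<lambda>(M, D). (\<lambda>i\<in>J. wdeg (D i), D)"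
        and j = "\<lambda>(d, D). (\<Sum>i\<in>J. D i, D)"])
    fix x assume x: "x \<in> (SIGMA d:decomps J N. \<Pi>\<^sub>E i\<in>J. elems (d i))"
    obtain d D where xd: "x = (d, D)" by (cases x)
    have d: "d \<in> decomps J N" and D: "D \<in> (\<Pi>\<^sub>E i\<in>J. elems (d i))" using x xd by auto
    have wd: "(\<lambda>i\<in>J. wdeg (D i)) = d"
      using d D by (auto simp: fun_eq_iff restrict_def decomps_def PiE_iff elems_def extensional_def)
    then show "(\<lambda>(M, D). (\<lambda>i\<in>J. wdeg (D i), D)) ((\<lambda>(d, D). (\<Sum>i\<in>J. D i, D)) x) = x"
      by (simp add: xd)
    have "wdeg (\<Sum>i\<in>J. D i) = (\<Sum>i\<in>J. d i)"
      unfolding wdeg_sum[OF J] using D by (intro sum.cong) (auto simp: elems_def)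
    then show "(\<lambda>(d, D). (\<Sum>i\<in>J. D i, D)) x \<in> (SIGMA M:elems N. decomps J M)"
      using d D J by (fastforce simp: xd decomps_def elems_def set_mset_sum PiE_iff)
    show "(\<lambda>(M, D). (\<Prod>i\<in>J. f (D i)) * G (\<lambda>i\<in>J. wdeg (D i))) ((\<lambda>(d, D). (\<Sum>i\<in>J. D i, D)) x) =
        (\<lambda>(d, D). (\<Prod>i\<in>J. f (D i)) * G d) x"
      using wd by (simp add: xd)
  next
    fix x assume x: "x \<in> (SIGMA M:elems N. decomps J M)"
    obtain M D where xM: "x = (M, D)" by (cases x)
    have M: "M \<in> elems N" and D: "D \<in> decomps J M" using x xM by auto
    show "(\<lambda>(d, D). (\<Sum>i\<in>J. D i, D)) ((\<lambda>(M, D). (\<lambda>i\<in>J. wdeg (D i), D)) x) = x"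
      using D by (simp add: xM decomps_def)
    have "(\<Sum>i\<in>J. wdeg (D i)) = N"
      using M D J by (auto simp: elems_def decomps_def simp flip: wdeg_sum)
    moreover have "set_mset (D i) \<subseteq> P" if "i \<in> J" for i
      using M D J that by (fastforce simp: elems_def decomps_def set_mset_sum)
    ultimately show "(\<lambda>(M, D). (\<lambda>i\<in>J. wdeg (D i), D)) x \<in> (SIGMA d:decomps J N. \<Pi>\<^sub>E i\<in>J. elems (d i))"
      using D by (auto simp: xM decomps_def elems_def PiE_iff extensional_def)
  qed
  also have "\<dots> = (\<Sum>M\<in>elems N. \<Sum>D\<in>decomps J M. (\<Prod>i\<in>J. f (D i)) * G (\<lambda>i\<in>J. wdeg (D i)))"
    using J by (subst sum.Sigma) auto
  finally show ?thesis ..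
qed

text \<open>Both sides are coefficients of series with constant term 1 and the same k-th power, the
  series of q^n, so \<open>fps_power_inject\<close> identifies them.\<close>

lemma sum_elems_gen_tau:
  assumes "k > 0"
  shows "(\<Sum>M\<in>elems n. gen_tau (1 / real k) M) = real q ^ n * nb_coeff (1 / real k) n"
proof -
  let ?T = "\<lambda>n. \<Sum>M\<in>elems n. gen_tau (1 / real k) M"
  let ?B = "\<lambda>n. real q ^ n * nb_coeff (1 / real k) n"
  have "Abs_fps ?T ^ k = Abs_fps ?B ^ k"
  proof (rule fps_ext)
    fix n
    have "fps_nth (Abs_fps ?T ^ k) n = (\<Sum>d\<in>decomps {..<k} n. \<Prod>i\<in>{..<k}. ?T (d i))"
      using sum_decomps_fps[of "{..<k}" ?T n] by simp
    also have "\<dots> = (\<Sum>M\<in>elems n. \<Sum>D\<in>decomps {..<k} M. \<Prod>i\<in>{..<k}. gen_tau (1 / real k) (D i))"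
      using sum_elems_decomps[of "{..<k}" "gen_tau (1 / real k)" "\<lambda>_. 1" n] by simp
    \<comment> \<open>For each M the weights of its factorisations add up to
      \<open>gen_tau 1 M\<close>, which is 1, so the double sum counts the elements of degree
      n.\<close>
    also have "\<dots> = real q ^ n"
      using assms by (simp add: sum_decomps_gen_tau card_elems)
    also have "\<dots> = (\<Sum>d\<in>decomps {..<k} n. real q ^ n * (\<Prod>i\<in>{..<k}. nb_coeff (1 / real k) (d i)))"
      using assms by (simp add: sum_decomps_nb_coeff flip: sum_distrib_left)
    also have "\<dots> = (\<Sum>d\<in>decomps {..<k} n. \<Prod>i\<in>{..<k}. ?B (d i))"
      by (intro sum.cong refl) (auto simp: decomps_def prod.distrib power_sum)
    also have "\<dots> = fps_nth (Abs_fps ?B ^ k) n"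
      using sum_decomps_fps[of "{..<k}" ?B n] by simp
    finally show "fps_nth (Abs_fps ?T ^ k) n = fps_nth (Abs_fps ?B ^ k) n" .
  qed
  then have "Abs_fps ?T = Abs_fps ?B"
    by (rule fps_power_inject) (use assms in \<open>auto simp: elems_0 gen_tau_def\<close>)
  then have "fps_nth (Abs_fps ?T) n = fps_nth (Abs_fps ?B) n" by (simp only:)
  then show ?thesis by simp
qed

text \<open>The powers of q combine to q^N because the degrees of the entries add up to N; the
  remaining Dirichlet-multinomial weight is free of q.\<close>

lemma sum_elems_decomps_gen_tau:
  assumes J: "finite J" "J \<noteq> {}"
  shows "(\<Sum>M\<in>elems N. \<Sum>D\<in>decomps J M. (\<Prod>i\<in>J. gen_tau (1 / real (card J)) (D i)) * G (\<lambda>i\<in>J. wdeg (D i))) =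
    real q ^ N * (\<Sum>d\<in>decomps J N. (\<Prod>i\<in>J. nb_coeff (1 / real (card J)) (d i)) * G d)"
proof -
  have "card J > 0" using J by (simp add: card_gt_0_iff)
  then show ?thesis
    unfolding sum_elems_decomps[OF J(1)] sum_distrib_left
    by (intro sum.cong refl) (auto simp: sum_elems_gen_tau prod.distrib decomps_def power_sum)
qed

text \<open>Every squarefull element is \<open>A\<^sup>2B\<^sup>3\<close>, here written additively.\<close>

lemma card_squarefull_le: "real (card (squarefull m)) \<le> (real m + 1) * sqrt (real q) ^ m"
proof -
  let ?I = "{j. 3 * j \<le> m}"
  let ?X = "SIGMA j:?I. elems ((m - 3 * j) div 2) \<times> elems j"
  have fin: "finite ?I" by (rule finite_subset[of _ "{..m}"]) auto
  have "squarefull m \<subseteq> (\<lambda>(j, A, B). A + A + (B + B + B)) ` ?X"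
  proof
    fix M assume M: "M \<in> squarefull m"
    \<comment> \<open>An odd multiplicity other than 1 is at least 3, so 3 can be split off and an
      even number remains. \<open>B\<close> takes one copy of each prime of odd
      multiplicity.\<close>
    define odd_part where "odd_part p = (of_bool (odd (count M p)) :: nat)" for p
    define rest where "rest p = (count M p - 3 * odd_part p) div 2" for p
    define A where "A = Abs_multiset rest"
    define B where "B = Abs_multiset odd_part"
    have "rest p = 0" "odd_part p = 0" if "p \<notin># M" for p
      using that by (auto simp: rest_def odd_part_def not_in_iff)
    then have "{p. rest p > 0} \<subseteq> set_mset M" "{p. odd_part p > 0} \<subseteq> set_mset M"
      by (force+)
    then have A: "count A = rest" and B: "count B = odd_part"
      unfolding A_def B_def by (auto intro!: count_Abs_multiset intro: finite_subset)
    have "M = A + A + (B + B + B)"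
    proof (rule multiset_eqI)
      fix p
      have "count M p \<noteq> 1" using M by (simp add: squarefull_def)
      then show "count M p = count (A + A + (B + B + B)) p"
        by (auto simp: A B rest_def odd_part_def elim!: oddE evenE) presburger
    qed
    moreover have "M \<in> elems m" using M by (simp add: squarefull_def)
    ultimately have "set_mset A \<subseteq> P" "set_mset B \<subseteq> P" "2 * wdeg A + 3 * wdeg B = m"
      by (auto simp: elems_def)
    then have "(wdeg B, A, B) \<in> ?X"
      by (auto simp: elems_def)
    then show "M \<in> (\<lambda>(j, A, B). A + A + (B + B + B)) ` ?X"
      using \<open>M = _\<close> by force
  qed
  then have "card (squarefull m) \<le> card ((\<lambda>(j, A, B). A + A + (B + B + B)) ` ?X)"
    using fin by (intro card_mono finite_imageI finite_SigmaI) auto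
  also have "\<dots> \<le> card ?X"
    using fin by (intro card_image_le finite_SigmaI) auto
  also have "\<dots> = (\<Sum>j\<in>?I. q ^ ((m - 3 * j) div 2) * q ^ j)"
    using fin by (subst card_SigmaI) (auto simp: card_cartesian_product card_elems)
  finally have "real (card (squarefull m)) \<le> real (\<Sum>j\<in>?I. q ^ ((m - 3 * j) div 2) * q ^ j)"
    by (simp only: of_nat_le_iff)
  also have "\<dots> = (\<Sum>j\<in>?I. real q ^ ((m - 3 * j) div 2) * real q ^ j)"
    by simp
  also have "\<dots> \<le> (\<Sum>j\<in>?I. sqrt (real q) ^ m)"
  proof (rule sum_mono)
    fix j assume j: "j \<in> ?I"
    have "real q ^ ((m - 3 * j) div 2) * real q ^ j = (sqrt (real q) ^ 2) ^ ((m - 3 * j) div 2 + j)"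
      by (simp add: power_add)
    also have "\<dots> = sqrt (real q) ^ (2 * ((m - 3 * j) div 2 + j))"
      by (simp only: power_mult)
    \<comment> \<open>The exponent is at most (m - 3j) + 2j = m - j.\<close>
    also have "\<dots> \<le> sqrt (real q) ^ m"
      using j q_ge by (intro power_increasing) auto
    finally show "real q ^ ((m - 3 * j) div 2) * real q ^ j \<le> sqrt (real q) ^ m" .
  qed
  also have "\<dots> = real (card ?I) * sqrt (real q) ^ m" by simp
  also have "\<dots> \<le> (real m + 1) * sqrt (real q) ^ m"
  proof -
    have "card ?I \<le> card {..m}" by (intro card_mono) auto
    then show ?thesis by (intro mult_right_mono) auto
  qed
  finally show ?thesis .
qed

section \<open>The two laws on average over all elements\<close>

text \<open>\<open>M1\<close> collects the primes of multiplicity 1 and \<open>M2\<close> the rest.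
  On the right \<open>M1\<close> also runs over elements that are not squarefree or not coprime to
  \<open>M2\<close>: as \<open>g\<close> is nonnegative this only enlarges the sum, and a full sum
  over \<open>elems (n - m)\<close> is what \<open>sum_elems_decomps_gen_tau\<close>
  evaluates.\<close>

lemma sum_elems_le_split:
  fixes f :: "'p multiset \<Rightarrow> real" and g :: "'p multiset \<Rightarrow> 'p multiset \<Rightarrow> real"
  assumes le: "\<And>M1 M2. set_mset M1 \<inter> set_mset M2 = {} \<Longrightarrow> (\<And>p. count M1 p \<le> 1) \<Longrightarrow> f (M1 + M2) \<le> g M1 M2"
    and nonneg: "\<And>M1 M2. g M1 M2 \<ge> 0"
  shows "sum f (elems n) \<le> (\<Sum>m\<le>n. \<Sum>M2\<in>squarefull m. \<Sum>M1\<in>elems (n - m). g M1 M2)"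
proof -
  let ?X = "SIGMA m:{..n}. squarefull m \<times> elems (n - m)"
  have "sum f (elems n) \<le> (\<Sum>(m, M2, M1)\<in>?X. g M1 M2)"
  proof (rule sum_le_included[where i = "\<lambda>(m, M2, M1). M1 + M2"])
    show "\<forall>M\<in>elems n. \<exists>y\<in>?X. (\<lambda>(m, M2, M1). M1 + M2) y = M \<and> f M \<le> (\<lambda>(m, M2, M1). g M1 M2) y"
    proof
      fix M assume M: "M \<in> elems n"
      define M1 where "M1 = filter_mset (\<lambda>p. count M p = 1) M"
      define M2 where "M2 = filter_mset (\<lambda>p. \<not> count M p = 1) M"
      have eq: "M = M1 + M2" unfolding M1_def M2_def by (rule multiset_partition)
      have "M2 \<in> squarefull (wdeg M2)" "M1 \<in> elems (n - wdeg M2)" "wdeg M2 \<le> n"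
        using M wdeg_add[of M1 M2, folded eq]
        by (auto simp: squarefull_def elems_def M1_def M2_def)
      then have "(wdeg M2, M2, M1) \<in> ?X" by simp
      moreover have "f M \<le> g M1 M2"
        unfolding eq by (rule le) (auto simp: M1_def M2_def)
      ultimately show "\<exists>y\<in>?X. (\<lambda>(m, M2, M1). M1 + M2) y = M \<and> f M \<le> (\<lambda>(m, M2, M1). g M1 M2) y"
        using eq by (intro bexI[of _ "(wdeg M2, M2, M1)"]) auto
    qed
  qed (auto intro!: finite_SigmaI nonneg)
  also have "\<dots> = (\<Sum>m\<le>n. \<Sum>M2\<in>squarefull m. \<Sum>M1\<in>elems (n - m). g M1 M2)"
    by (subst sum.Sigma[symmetric]) (auto simp: sum.cartesian_product intro!: sum.cong)
  finally show ?thesis .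
qed

text \<open>A squarefull part of degree m gives windows of length m, hence an error O(m
  (n-m+1)^(-a)) q^(n-m). There are at most (m+1) q^(m/2) such parts, and the resulting series in m
  is bounded uniformly in n and in the thresholds.\<close>

lemma uniform_factorization_distribution:
  fixes J I :: "'i set"
  assumes J: "finite J" "card J \<ge> 2" "I \<subseteq> J"
  obtains C where "C \<ge> 0"
    "\<And>n v. n \<ge> 1 \<Longrightarrow>
      \<bar>(\<Sum>M\<in>elems n. real (card {D \<in> decomps J M. \<forall>i\<in>I. real (wdeg (D i)) \<le> v i}) / real (card (decomps J M)))
       - real q ^ n * (\<Sum>d\<in>decomps J n. (\<Prod>i\<in>J. nb_coeff (1 / real (card J)) (d i)) * of_bool (\<forall>i\<in>I. real (d i) \<le> v i))\<bar>
      \<le> C * real q ^ n * real n powr - (1 / real (card J))"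
proof -
  let ?a = "1 / real (card J)"
  let ?w = "\<lambda>D. \<Prod>i\<in>J. gen_tau ?a (D i)"
  let ?b = "\<lambda>d. \<Prod>i\<in>J. nb_coeff ?a (d i)"
  have ne: "J \<noteq> {}" using J by auto
  have finI: "finite I" using J finite_subset by blast
  have a: "0 < ?a" "?a \<le> 1" using J by auto
  obtain C where C: "C > 0"
    "\<And>N j (S :: nat set). j \<in> J \<Longrightarrow> finite S \<Longrightarrow>
       (\<Sum>d\<in>decomps J N. ?b d * of_bool (d j \<in> S)) \<le> C * real (card S) * (real N + 1) powr - ?a"
    using nb_coeff_window_le[OF J(1,2)] by blast
  \<comment> \<open>Each degree of the squarefull part costs a factor q and regains sqrt q by the
    count of such parts: q^(n-m) sqrt(q)^m = q^n z^m.\<close>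
  define z where "z = 1 / sqrt (real q)"
  have z: "0 \<le> z" "z \<le> 18 / 25"
  proof -
    have "25 / 18 = sqrt ((25 / 18)\<^sup>2)" by simp
    also have "\<dots> \<le> sqrt (real q)"
      using q_ge by (intro real_sqrt_le_mono) (auto simp: power2_eq_square)
    finally show "z \<le> 18 / 25" using q_ge by (simp add: z_def divide_simps)
  qed (simp add: z_def)
  \<comment> \<open>The three factors m + 1 come from the count of squarefull elements, from the
    length of the window, and from the passage from (n-m+1)^(-a) to n^(-a).\<close>
  define Z where "Z = (\<Sum>m. (real m + 1) ^ 3 * z ^ m)"
  have Z: "(\<Sum>m\<le>n. (real m + 1) ^ 3 * z ^ m) \<le> Z" for n
    unfolding Z_def using z by (intro sum_le_suminf summable_cubic_geometric) auto
  have "Z \<ge> 0" using Z[of 0] by simp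
  show ?thesis
  proof
    show "C * real (card I) * Z \<ge> 0" using C \<open>Z \<ge> 0\<close> by simp
    fix n :: nat and v :: "'i \<Rightarrow> real" assume n: "n \<ge> 1"
    let ?Q = "\<lambda>D. \<forall>i\<in>I. real (wdeg (D i)) \<le> v i"
    let ?win = "\<lambda>m x i. v i - real m < real x \<and> real x \<le> v i"
    let ?g = "\<lambda>M1 M2. \<Sum>D\<in>decomps J M1. ?w D * (\<Sum>i\<in>I. of_bool (?win (wdeg M2) (wdeg (D i)) i))"
    let ?f = "\<lambda>M. \<bar>real (card {D \<in> decomps J M. ?Q D}) / real (card (decomps J M)) - (\<Sum>D\<in>decomps J M. ?w D * of_bool (?Q D))\<bar>"
    have "(\<Sum>M\<in>elems n. \<Sum>D\<in>decomps J M. ?w D * of_bool (?Q D)) =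
        (\<Sum>M\<in>elems n. \<Sum>D\<in>decomps J M. ?w D * of_bool (\<forall>i\<in>I. real ((\<lambda>i\<in>J. wdeg (D i)) i) \<le> v i))"
      using J(3) by (intro sum.cong refl) (auto simp: subset_iff)
    also have "\<dots> = real q ^ n * (\<Sum>d\<in>decomps J n. ?b d * of_bool (\<forall>i\<in>I. real (d i) \<le> v i))"
      by (rule sum_elems_decomps_gen_tau[OF J(1) ne])
    finally have eq: "(\<Sum>M\<in>elems n. \<Sum>D\<in>decomps J M. ?w D * of_bool (?Q D)) =
        real q ^ n * (\<Sum>d\<in>decomps J n. ?b d * of_bool (\<forall>i\<in>I. real (d i) \<le> v i))" .
    have "\<bar>(\<Sum>M\<in>elems n. real (card {D \<in> decomps J M. ?Q D}) / real (card (decomps J M)))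
        - real q ^ n * (\<Sum>d\<in>decomps J n. ?b d * of_bool (\<forall>i\<in>I. real (d i) \<le> v i))\<bar> \<le> sum ?f (elems n)"
      unfolding eq[symmetric] sum_subtractf[symmetric] by (rule sum_abs)
    also have "\<dots> \<le> (\<Sum>m\<le>n. \<Sum>M2\<in>squarefull m. \<Sum>M1\<in>elems (n - m). ?g M1 M2)"
    proof (rule sum_elems_le_split)
      fix M1 M2 :: "'p multiset"
      assume "set_mset M1 \<inter> set_mset M2 = {}" "\<And>p. count M1 p \<le> 1"
      then show "?f (M1 + M2) \<le> ?g M1 M2"
        using uniform_vs_gen_tau[OF J(1) ne J(3), of M1 M2 deg v] by (simp add: wdeg_def)
    next
      fix M1 M2 show "?g M1 M2 \<ge> 0"
        by (intro sum_nonneg mult_nonneg_nonneg prod_nonneg gen_tau_nonneg) auto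
    qed
    also have "\<dots> \<le> (\<Sum>m\<le>n. C * real (card I) * real q ^ n * real n powr - ?a * ((real m + 1) ^ 3 * z ^ m))"
    proof (rule sum_mono)
      fix m assume m: "m \<in> {..n}"
      let ?N = "n - m"
      have inner: "(\<Sum>M1\<in>elems ?N. ?g M1 M2) \<le> real q ^ ?N * (real (card I) * (C * real m * (real ?N + 1) powr - ?a))"
        if M2: "M2 \<in> squarefull m" for M2
      proof -
        have wM2: "wdeg M2 = m" using M2 by (simp add: squarefull_def elems_def)
        have "(\<Sum>M1\<in>elems ?N. ?g M1 M2) = (\<Sum>M1\<in>elems ?N. \<Sum>D\<in>decomps J M1. ?w D * (\<Sum>i\<in>I. of_bool (?win m ((\<lambda>i\<in>J. wdeg (D i)) i) i)))"
          unfolding wM2 using J(3) by (intro sum.cong refl arg_cong2[of _ _ _ _ "(*)"]) (auto simp: subset_iff)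
        also have "\<dots> = real q ^ ?N * (\<Sum>d\<in>decomps J ?N. ?b d * (\<Sum>i\<in>I. of_bool (?win m (d i) i)))"
          by (rule sum_elems_decomps_gen_tau[OF J(1) ne])
        also have "(\<Sum>d\<in>decomps J ?N. ?b d * (\<Sum>i\<in>I. of_bool (?win m (d i) i))) =
            (\<Sum>i\<in>I. \<Sum>d\<in>decomps J ?N. ?b d * of_bool (d i \<in> {j. ?win m j i}))"
          unfolding sum_distrib_left by (subst sum.swap) simp
        also have "\<dots> \<le> (\<Sum>i\<in>I. C * real m * (real ?N + 1) powr - ?a)"
        proof (rule sum_mono)
          fix i assume i: "i \<in> I"
          have "(\<Sum>d\<in>decomps J ?N. ?b d * of_bool (d i \<in> {j. ?win m j i})) \<le>
              C * real (card {j. ?win m j i}) * (real ?N + 1) powr - ?a"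
            using i J by (intro C) auto
          also have "\<dots> \<le> C * real m * (real ?N + 1) powr - ?a"
            using C card_nat_window[of "v i" m] by (intro mult_right_mono mult_left_mono) auto
          finally show "(\<Sum>d\<in>decomps J ?N. ?b d * of_bool (d i \<in> {j. ?win m j i})) \<le> C * real m * (real ?N + 1) powr - ?a" .
        qed
        finally show ?thesis by (simp add: mult_left_mono)
      qed
      have "(\<Sum>M2\<in>squarefull m. \<Sum>M1\<in>elems ?N. ?g M1 M2) \<le>
          (\<Sum>M2\<in>squarefull m. real q ^ ?N * (real (card I) * (C * real m * (real ?N + 1) powr - ?a)))"
        by (intro sum_mono inner)
      also have "\<dots> = real (card (squarefull m)) * (real q ^ ?N * (real (card I) * (C * real m * (real ?N + 1) powr - ?a)))"
        by simp
      also have "\<dots> \<le> ((real m + 1) * sqrt (real q) ^ m) * (real q ^ ?N * (real (card I) * (C * (real m + 1) * ((real m + 1) * real n powr - ?a))))"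
      proof (intro mult_mono card_squarefull_le mult_left_mono order_refl)
        have nN: "real n = real m + real ?N" using m by simp
        \<comment> \<open>This holds for all m \<le> n, also when n - m is small, and bounds the
          loss by (m+1)^a \<le> m + 1.\<close>
        have "real n \<le> (real m + 1) * (real ?N + 1)"
          unfolding nN by (simp add: algebra_simps)
        then have "((real m + 1) * (real ?N + 1)) powr - ?a \<le> real n powr - ?a"
          using n a by (intro powr_mono2') auto
        then have "(real m + 1) powr ?a * ((real m + 1) * (real ?N + 1)) powr - ?a \<le> (real m + 1) powr ?a * real n powr - ?a"
          by (intro mult_left_mono) auto
        also have "\<dots> \<le> (real m + 1) powr 1 * real n powr - ?a"
          using a by (intro mult_right_mono powr_mono) auto
        finally have "(real m + 1) powr ?a * ((real m + 1) * (real ?N + 1)) powr - ?a \<le> (real m + 1) * real n powr - ?a"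
          by simp
        moreover have "(real m + 1) powr ?a * ((real m + 1) * (real ?N + 1)) powr - ?a = (real ?N + 1) powr - ?a"
          by (simp add: powr_mult powr_minus mult.assoc[symmetric])
        ultimately show "(real ?N + 1) powr - ?a \<le> (real m + 1) * real n powr - ?a"
          by simp
      qed (use C in auto)
      also have "\<dots> = C * real (card I) * real n powr - ?a * (real m + 1) ^ 3 * (sqrt (real q) ^ m * real q ^ ?N)"
        by (simp add: power3_eq_cube mult_ac)
      also have "sqrt (real q) ^ m * real q ^ ?N = real q ^ n * z ^ m"
      proof -
        have eq: "real q ^ n = real q ^ ?N * (sqrt (real q) ^ m * sqrt (real q) ^ m)"
          unfolding power_mult_distrib[symmetric] using m by (simp flip: power_add)
        have "sqrt (real q) ^ m * z ^ m = 1"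
          using q_ge by (simp add: z_def flip: power_mult_distrib)
        moreover have "real q ^ n * z ^ m = sqrt (real q) ^ m * real q ^ ?N * (sqrt (real q) ^ m * z ^ m)"
          unfolding eq by (simp add: mult_ac)
        ultimately show ?thesis by simp
      qed
      finally show "(\<Sum>M2\<in>squarefull m. \<Sum>M1\<in>elems ?N. ?g M1 M2) \<le>
          C * real (card I) * real q ^ n * real n powr - ?a * ((real m + 1) ^ 3 * z ^ m)"
        by (simp add: mult_ac)
    qed
    also have "\<dots> = C * real (card I) * real q ^ n * real n powr - ?a * (\<Sum>m\<le>n. (real m + 1) ^ 3 * z ^ m)"
      by (simp add: sum_distrib_left)
    also have "\<dots> \<le> C * real (card I) * real q ^ n * real n powr - ?a * Z"
      using C by (intro mult_left_mono Z) auto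
    finally show "\<bar>(\<Sum>M\<in>elems n. real (card {D \<in> decomps J M. ?Q D}) / real (card (decomps J M)))
        - real q ^ n * (\<Sum>d\<in>decomps J n. ?b d * of_bool (\<forall>i\<in>I. real (d i) \<le> v i))\<bar>
        \<le> C * real (card I) * Z * real q ^ n * real n powr - ?a"
      by (simp add: mult_ac)
  qed
qed

end

section \<open>Monic polynomials as multisets of irreducibles\<close>

text \<open>Monic representatives remove the units, so multisets over this set correspond to monic
  polynomials exactly and not only up to associates.\<close>

definition monic_irreds :: "'a::field poly set" where
  "monic_irreds = {p. irreducible p \<and> lead_coeff p = 1}"

text \<open>For monic F the chosen multiset is the only candidate, by
  \<open>monic_factorization_unique\<close>.\<close>

definition factor_mset :: "'a::field poly \<Rightarrow> 'a poly multiset" where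
  "factor_mset F = (SOME M. set_mset M \<subseteq> monic_irreds \<and> prod_mset M = F)"

lemma monic_prod_mset:
  fixes M :: "'a::field poly multiset"
  assumes "set_mset M \<subseteq> monic_irreds"
  shows "prod_mset M \<in> monic_polys" and "degree (prod_mset M) = (\<Sum>p\<in>#M. degree p)"
proof -
  have "lead_coeff (prod_mset M) = 1 \<and> degree (prod_mset M) = (\<Sum>p\<in>#M. degree p)"
    using assms
  proof (induction M)
    case (add p M)
    then have "lead_coeff p = 1" "lead_coeff (prod_mset M) = 1" "degree (prod_mset M) = (\<Sum>p\<in>#M. degree p)"
      by (auto simp: monic_irreds_def)
    moreover from this have "p \<noteq> 0" "prod_mset M \<noteq> 0"
      by (metis leading_coeff_0_iff zero_neq_one)+
    moreover have "lead_coeff (p * prod_mset M) = lead_coeff p * lead_coeff (prod_mset M)"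
      by (rule lead_coeff_mult)
    ultimately show ?case by (simp add: degree_mult_eq)
  qed simp
  then show "prod_mset M \<in> monic_polys" "degree (prod_mset M) = (\<Sum>p\<in>#M. degree p)"
    by (auto simp: monic_polys_def)
qed

lemma monic_factorization_exists:
  fixes F :: "'a::field poly"
  assumes "F \<in> monic_polys"
  shows "\<exists>M. set_mset M \<subseteq> monic_irreds \<and> prod_mset M = F"
  using assms
proof (induction "degree F" arbitrary: F rule: less_induct)
  case less
  have lc: "lead_coeff F = 1" using less.prems by (simp add: monic_polys_def)
  consider "degree F = 0" | "irreducible F" | "degree F > 0" "\<not> irreducible F" by auto
  then show ?case
  proof cases
    case 1
    then have "F = 1" using lc by (auto elim!: degree_eq_zeroE)
    then show ?thesis by (intro exI[of _ "{#}"]) auto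
  next
    case 2
    then show ?thesis using lc by (intro exI[of _ "{#F#}"]) (auto simp: monic_irreds_def)
  next
    case 3
    have F0: "F \<noteq> 0" using lc by auto
    have "\<not> is_unit F" using 3(1) F0 by (auto simp: is_unit_iff_degree)
    then obtain a b where ab: "F = a * b" "\<not> is_unit a" "\<not> is_unit b"
      using 3(2) F0 by (auto simp: irreducible_def)
    have nz: "a \<noteq> 0" "b \<noteq> 0" using ab F0 by auto
    have deg: "degree a > 0" "degree b > 0" using ab nz by (auto simp: is_unit_iff_degree)
    let ?a = "smult (inverse (lead_coeff a)) a" and ?b = "smult (inverse (lead_coeff b)) b"
    \<comment> \<open>The two scalars multiply to 1, so making both factors monic leaves the product
      unchanged.\<close>
    have "lead_coeff a * lead_coeff b = 1" using lc ab by (simp add: lead_coeff_mult)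
    then have "inverse (lead_coeff a) * inverse (lead_coeff b) = 1"
      by (metis inverse_1 inverse_mult_distrib)
    then have F: "F = ?a * ?b" using ab by (simp add: mult.commute)
    have m: "?a \<in> monic_polys" "?b \<in> monic_polys" using nz by (auto simp: monic_polys_def)
    have "degree ?a < degree F" "degree ?b < degree F"
      using deg nz ab by (auto simp: degree_mult_eq)
    from less.hyps[OF this(1) m(1)] less.hyps[OF this(2) m(2)]
    obtain A B where "set_mset A \<subseteq> monic_irreds" "prod_mset A = ?a"
      "set_mset B \<subseteq> monic_irreds" "prod_mset B = ?b" by blast
    then show ?thesis using F by (intro exI[of _ "A + B"]) auto
  qed
qed

lemma monic_dvd_antisym:
  fixes p r :: "'a::field poly"
  assumes "p dvd r" "r dvd p" "lead_coeff p = 1" "lead_coeff r = 1"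
  shows "p = r"
proof -
  obtain c where c: "r = p * c" using assms(1) by auto
  have nz: "p \<noteq> 0" "r \<noteq> 0" using assms by auto
  then have "degree p = degree r" using assms(1,2) by (intro antisym dvd_imp_degree_le) auto
  then have "degree c = 0" using c nz by (auto simp: degree_mult_eq)
  moreover have "lead_coeff c = 1" using c assms by (simp add: lead_coeff_mult)
  ultimately have "c = 1" by (auto elim!: degree_eq_zeroE)
  then show ?thesis using c by simp
qed

lemma monic_factorization_unique:
  fixes M N :: "'a::field poly multiset"
  assumes "set_mset M \<subseteq> monic_irreds" "set_mset N \<subseteq> monic_irreds"
    and "prod_mset M = prod_mset N"
  shows "M = N"
  using assms
proof (induction M arbitrary: N)
  case empty
  have "\<not> p \<in># N" for p
  proof
    assume p: "p \<in># N"
    then have "p dvd 1" using empty dvd_prod_mset[of p N] by simp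
    then show False using p empty by (auto simp: monic_irreds_def irreducible_not_unit)
  qed
  then show ?case by auto
next
  case (add p M)
  have p: "irreducible p" "lead_coeff p = 1" using add.prems by (auto simp: monic_irreds_def)
  have "p dvd prod_mset N" using add.prems(3)[symmetric] by simp
  then obtain r where r: "r \<in># N" "p dvd r"
    using prime_elem_dvd_prod_msetE[OF field_poly_irreducible_imp_prime[OF p(1)]] by blast
  have r': "irreducible r" "lead_coeff r = 1" using r add.prems by (auto simp: monic_irreds_def)
  have "r dvd p" using irreducibleD'[OF r'(1) r(2)] irreducible_not_unit[OF p(1)] by blast
  then have "p = r" using monic_dvd_antisym[of p r] p r r' by simp
  then obtain N' where N: "N = add_mset p N'" using r by (auto dest: mset_add)
  have "p \<noteq> 0" using p by auto
  then have "prod_mset M = prod_mset N'" using add.prems(3) N by simp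
  then show ?case using add N by auto
qed

lemma factor_mset:
  assumes "F \<in> monic_polys"
  shows "set_mset (factor_mset F) \<subseteq> monic_irreds" "prod_mset (factor_mset F) = F"
  using someI_ex[OF monic_factorization_exists[OF assms]] by (auto simp: factor_mset_def)

lemma factor_mset_prod_mset:
  assumes "set_mset M \<subseteq> monic_irreds"
  shows "factor_mset (prod_mset M) = M"
  using factor_mset[OF monic_prod_mset(1)[OF assms]] assms by (intro monic_factorization_unique) auto

lemma degree_factor_mset:
  assumes "F \<in> monic_polys"
  shows "(\<Sum>p\<in>#factor_mset F. degree p) = degree F"
  using monic_prod_mset(2)[OF factor_mset(1)[OF assms]] factor_mset(2)[OF assms] by simp

lemma prod_mset_sum:
  "finite J \<Longrightarrow> prod_mset (\<Sum>i\<in>J. D i) = (\<Prod>i\<in>J. prod_mset (D i))"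
  by (induction J rule: finite_induct) auto

lemma monic_polys_1 [simp]: "1 \<in> monic_polys"
  by (simp add: monic_polys_def)

lemma monic_polys_nonzero: "F \<in> monic_polys \<Longrightarrow> F \<noteq> 0"
  by (auto simp: monic_polys_def)

lemma monic_polys_mult_iff:
  fixes F G :: "'a::field poly"
  assumes "F \<in> monic_polys"
  shows "F * G \<in> monic_polys \<longleftrightarrow> G \<in> monic_polys"
  using assms by (simp add: monic_polys_def lead_coeff_mult)

lemma monic_polys_prod:
  fixes D :: "'i \<Rightarrow> 'a::field poly"
  shows "(\<And>i. i \<in> J \<Longrightarrow> D i \<in> monic_polys) \<Longrightarrow> (\<Prod>i\<in>J. D i) \<in> monic_polys"
  by (induction J rule: infinite_finite_induct) (auto simp: monic_polys_mult_iff)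

lemma factor_mset_prod:
  assumes "finite J" "\<And>i. i \<in> J \<Longrightarrow> D i \<in> monic_polys"
  shows "factor_mset (\<Prod>i\<in>J. D i) = (\<Sum>i\<in>J. factor_mset (D i))"
proof -
  have "prod_mset (\<Sum>i\<in>J. factor_mset (D i)) = (\<Prod>i\<in>J. D i)"
    using assms by (simp add: prod_mset_sum factor_mset(2))
  moreover have "set_mset (\<Sum>i\<in>J. factor_mset (D i)) \<subseteq> monic_irreds"
    using assms by (fastforce simp: set_mset_sum dest: factor_mset(1)[THEN subsetD, rotated])
  ultimately show ?thesis by (metis factor_mset_prod_mset)
qed

lemma decomps_subset:
  assumes "finite J" "set_mset M \<subseteq> S" "D \<in> decomps J M" "i \<in> J"
  shows "set_mset (D i) \<subseteq> S"
  using assms by (fastforce simp: decomps_def set_mset_sum)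

lemma card_monic_polys_deg: "card (monic_polys_deg n :: 'a::{field,finite} poly set) = CARD('a) ^ n"
proof -
  define mk :: "(nat \<Rightarrow> 'a) \<Rightarrow> 'a poly" where "mk f = monom 1 n + (\<Sum>i<n. monom (f i) i)" for f
  have coeff_mk: "coeff (mk f) j = (if j = n then 1 else if j < n then f j else 0)" for f j
    by (simp add: mk_def coeff_sum)
  have deg: "degree (mk f) = n" for f
  proof (rule antisym)
    show "degree (mk f) \<le> n" by (rule degree_le) (simp add: coeff_mk)
    show "n \<le> degree (mk f)" by (rule le_degree) (simp add: coeff_mk)
  qed
  have "bij_betw (\<lambda>F. \<lambda>i\<in>{..<n}. coeff F i) (monic_polys_deg n) ({..<n} \<rightarrow>\<^sub>E (UNIV :: 'a set))"
  proof (rule bij_betw_byWitness[where f' = mk])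
    show "\<forall>F\<in>monic_polys_deg n. mk (\<lambda>i\<in>{..<n}. coeff F i) = F"
      by (auto simp: poly_eq_iff coeff_mk monic_polys_deg_def monic_polys_def coeff_eq_0)
    show "\<forall>f\<in>{..<n} \<rightarrow>\<^sub>E (UNIV :: 'a set). (\<lambda>i\<in>{..<n}. coeff (mk f) i) = f"
      by (auto simp: coeff_mk fun_eq_iff restrict_def PiE_iff extensional_def)
    show "mk ` ({..<n} \<rightarrow>\<^sub>E (UNIV :: 'a set)) \<subseteq> monic_polys_deg n"
      unfolding monic_polys_deg_def monic_polys_def by (rule image_subsetI) (simp add: deg coeff_mk)
    show "(\<lambda>F. \<lambda>i\<in>{..<n}. coeff F i) ` monic_polys_deg n \<subseteq> {..<n} \<rightarrow>\<^sub>E (UNIV :: 'a set)"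
      by (rule image_subsetI) simp
  qed
  from bij_betw_same_card[OF this] show ?thesis by (simp add: card_funcsetE)
qed

section \<open>Translation of \<open>tau\<close> and of divisor tuples into multisets\<close>

lemma bij_betw_factor_mset:
  "bij_betw factor_mset (monic_polys_deg n :: 'a::field poly set)
     {M. set_mset M \<subseteq> monic_irreds \<and> (\<Sum>p\<in>#M. degree p) = n}"
proof (rule bij_betw_byWitness[where f' = prod_mset])
  let ?N = "{M :: 'a poly multiset. set_mset M \<subseteq> monic_irreds \<and> (\<Sum>p\<in>#M. degree p) = n}"
  show "\<forall>F\<in>monic_polys_deg n. prod_mset (factor_mset F) = (F :: 'a poly)"
    using factor_mset(2) by (auto simp: monic_polys_deg_def)
  show "\<forall>M\<in>?N. factor_mset (prod_mset M) = (M :: 'a poly multiset)"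
    using factor_mset_prod_mset by blast
  show "factor_mset ` (monic_polys_deg n :: 'a poly set) \<subseteq> ?N"
  proof (rule image_subsetI)
    fix F :: "'a poly" assume "F \<in> monic_polys_deg n"
    then show "factor_mset F \<in> ?N"
      using factor_mset(1)[of F] degree_factor_mset[of F] by (simp add: monic_polys_deg_def)
  qed
  show "prod_mset ` ?N \<subseteq> (monic_polys_deg n :: 'a poly set)"
  proof (rule image_subsetI)
    fix M :: "'a poly multiset" assume "M \<in> ?N"
    then show "prod_mset M \<in> monic_polys_deg n"
      using monic_prod_mset[of M] by (simp add: monic_polys_deg_def)
  qed
qed

lemma arithmetic_monoid_monic_polys:
  "arithmetic_monoid (monic_irreds :: 'a::{field,finite} poly set) degree CARD('a)"
proof
  show "card {M. set_mset M \<subseteq> (monic_irreds :: 'a poly set) \<and> (\<Sum>p\<in>#M. degree p) = n} = CARD('a) ^ n" for n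
    using bij_betw_same_card[OF bij_betw_factor_mset[where ?'a = 'a and n = n]] by (simp add: card_monic_polys_deg)
  have "card {0, 1 :: 'a} \<le> CARD('a)" by (intro card_mono) auto
  then show "CARD('a) \<ge> 2" by simp
qed

lemma tau_eq_card_decomps:
  fixes F :: "'a::field poly"
  assumes F: "F \<in> monic_polys"
  shows "tau k F = card (decomps {1..k} (factor_mset F))"
  unfolding tau_def
proof (rule bij_betw_same_card[of "\<lambda>D. \<lambda>i\<in>{1..k}. factor_mset (D i)"], rule bij_betw_byWitness[where f' = "\<lambda>D. \<lambda>i\<in>{1..k}. prod_mset (D i)"])
  let ?X = "{D \<in> {1..k} \<rightarrow>\<^sub>E monic_polys. F = (\<Prod>i\<in>{1..k}. D i)}"
  have sub: "set_mset (D i) \<subseteq> monic_irreds" if "D \<in> decomps {1..k} (factor_mset F)" "i \<in> {1..k}" for D i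
    using decomps_subset[OF _ factor_mset(1)[OF F] that] by simp
  show "\<forall>D\<in>?X. (\<lambda>i\<in>{1..k}. prod_mset ((\<lambda>i\<in>{1..k}. factor_mset (D i)) i)) = D"
    by (auto simp: factor_mset(2) fun_eq_iff restrict_def PiE_iff extensional_def)
  show "\<forall>D\<in>decomps {1..k} (factor_mset F). (\<lambda>i\<in>{1..k}. factor_mset ((\<lambda>i\<in>{1..k}. prod_mset (D i)) i)) = D"
    using factor_mset_prod_mset[OF sub] by (auto simp: fun_eq_iff restrict_def decomps_def PiE_iff extensional_def)
  show "(\<lambda>D. \<lambda>i\<in>{1..k}. factor_mset (D i)) ` ?X \<subseteq> decomps {1..k} (factor_mset F)"
  proof (rule image_subsetI)
    fix D assume D: "D \<in> ?X"
    then have "(\<Sum>i\<in>{1..k}. factor_mset (D i)) = factor_mset F"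
      by (auto intro!: factor_mset_prod[symmetric])
    then show "(\<lambda>i\<in>{1..k}. factor_mset (D i)) \<in> decomps {1..k} (factor_mset F)"
      by (simp add: decomps_def)
  qed
  show "(\<lambda>D. \<lambda>i\<in>{1..k}. prod_mset (D i)) ` decomps {1..k} (factor_mset F) \<subseteq> ?X"
  proof (rule image_subsetI)
    fix D assume D: "D \<in> decomps {1..k} (factor_mset F)"
    have "(\<Prod>i\<in>{1..k}. prod_mset (D i)) = F"
      using D factor_mset(2)[OF F] prod_mset_sum[of "{1..k}" D] by (simp add: decomps_def)
    then show "(\<lambda>i\<in>{1..k}. prod_mset (D i)) \<in> ?X"
      using monic_prod_mset(1)[OF sub[OF D]] by auto
  qed
qed

text \<open>A tuple of k - 1 monic polynomials whose product divides F extends uniquely to a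
  factorisation of F into k factors: the cofactor goes into position k, which carries no degree
  condition.\<close>

lemma card_divisor_tuples:
  fixes F :: "'a::field poly" and v :: "nat \<Rightarrow> real"
  assumes F: "F \<in> monic_polys" and k: "k \<ge> 1"
  shows "card {D. D \<in> {1..k-1} \<rightarrow>\<^sub>E monic_polys \<and> (\<forall>i\<in>{1..k-1}. real (degree (D i)) \<le> v i) \<and> (\<Prod>i\<in>{1..k-1}. D i) dvd F} =
    card {D \<in> decomps {1..k} (factor_mset F). \<forall>i\<in>{1..k-1}. real (\<Sum>p\<in>#D i. degree p) \<le> v i}"
proof -
  let ?X = "{D. D \<in> {1..k-1} \<rightarrow>\<^sub>E monic_polys \<and> (\<forall>i\<in>{1..k-1}. real (degree (D i)) \<le> v i) \<and> (\<Prod>i\<in>{1..k-1}. D i) dvd F}"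
  let ?Y = "{D \<in> decomps {1..k} (factor_mset F). \<forall>i\<in>{1..k-1}. real (\<Sum>p\<in>#D i. degree p) \<le> v i}"
  let ?f = "\<lambda>D. (\<lambda>i\<in>{1..k-1}. factor_mset (D i))(k := factor_mset (F div (\<Prod>i\<in>{1..k-1}. D i)))"
  let ?g = "\<lambda>E. \<lambda>i\<in>{1..k-1}. prod_mset (E i)"
  have ins: "{1..k} = insert k {1..k-1}" "k \<notin> {1..k-1}" using k by auto
  have sub: "set_mset (E i) \<subseteq> monic_irreds" if "E \<in> decomps {1..k} (factor_mset F)" "i \<in> {1..k}" for E i
    using decomps_subset[OF _ factor_mset(1)[OF F] that] by simp
  have X: "D i \<in> monic_polys" if "D \<in> ?X" "i \<in> {1..k-1}" for D i using that by auto
  have Xprod: "(\<Prod>i\<in>{1..k-1}. D i) \<in> monic_polys" if "D \<in> ?X" for D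
    using X[OF that] by (intro monic_polys_prod) auto
  have Xdiv: "(\<Prod>i\<in>{1..k-1}. D i) * (F div (\<Prod>i\<in>{1..k-1}. D i)) = F" if "D \<in> ?X" for D
    using that by (intro dvd_mult_div_cancel) auto
  have Xquot: "F div (\<Prod>i\<in>{1..k-1}. D i) \<in> monic_polys" if "D \<in> ?X" for D
    using Xdiv[OF that] F monic_polys_mult_iff[OF Xprod[OF that]] by metis
  have Yprod: "(\<Prod>i\<in>{1..k-1}. ?g E i) * prod_mset (E k) = F" if "E \<in> ?Y" for E
  proof -
    have "(\<Prod>i\<in>{1..k}. prod_mset (E i)) = F"
      using that factor_mset(2)[OF F] prod_mset_sum[of "{1..k}" E] by (simp add: decomps_def)
    then show ?thesis unfolding ins(1) using ins(2) by (simp add: mult.commute)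
  qed
  have "bij_betw ?f ?X ?Y"
  proof (rule bij_betw_byWitness[where f' = ?g])
    show "\<forall>D\<in>?X. ?g (?f D) = D"
    proof
      fix D assume D: "D \<in> ?X"
      have "?g (?f D) i = D i" for i
        using factor_mset(2)[OF X[OF D]] D ins(2) by (cases "i \<in> {1..k-1}") (auto simp: PiE_iff extensional_def)
      then show "?g (?f D) = D" by (rule ext)
    qed
    show "\<forall>E\<in>?Y. ?f (?g E) = E"
    proof
      fix E assume E: "E \<in> ?Y"
      then have E': "E \<in> decomps {1..k} (factor_mset F)" by simp
      have "(\<Prod>i\<in>{1..k-1}. ?g E i) \<in> monic_polys"
        using monic_prod_mset(1)[OF sub[OF E']] by (intro monic_polys_prod) auto
      then have "(\<Prod>i\<in>{1..k-1}. ?g E i) \<noteq> 0"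
        by (rule monic_polys_nonzero)
      then have "F div (\<Prod>i\<in>{1..k-1}. ?g E i) = prod_mset (E k)"
        using Yprod[OF E] by (metis nonzero_mult_div_cancel_left)
      then have k: "?f (?g E) k = E k"
        using factor_mset_prod_mset[OF sub[OF E']] k by simp
      have "?f (?g E) i = E i" for i
      proof (cases "i = k")
        case False
        then show ?thesis using factor_mset_prod_mset[OF sub[OF E']] E' k
          by (cases "i \<in> {1..k-1}") (auto simp: decomps_def PiE_iff extensional_def)
      qed (use k in simp)
      then show "?f (?g E) = E" by (rule ext)
    qed
    show "?f ` ?X \<subseteq> ?Y"
    proof (rule image_subsetI)
      fix D assume D: "D \<in> ?X"
      have "(\<Sum>i\<in>{1..k}. ?f D i) = ?f D k + (\<Sum>i\<in>{1..k-1}. ?f D i)"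
        unfolding ins(1) using ins(2) by simp
      also have "(\<Sum>i\<in>{1..k-1}. ?f D i) = (\<Sum>i\<in>{1..k-1}. factor_mset (D i))"
        using ins(2) by (intro sum.cong) auto
      also have "\<dots> = factor_mset (\<Prod>i\<in>{1..k-1}. D i)"
        by (rule factor_mset_prod[symmetric]) (use X[OF D] in auto)
      also have "?f D k + \<dots> = factor_mset (F div (\<Prod>i\<in>{1..k-1}. D i) * (\<Prod>i\<in>{1..k-1}. D i))"
        using factor_mset_prod[of "{0,1::nat}" "\<lambda>i. if i = 0 then F div (\<Prod>i\<in>{1..k-1}. D i) else (\<Prod>i\<in>{1..k-1}. D i)"]
          Xquot[OF D] Xprod[OF D] by simp
      also have "\<dots> = factor_mset F" using Xdiv[OF D] by (simp add: mult.commute)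
      finally have "(\<Sum>i\<in>{1..k}. ?f D i) = factor_mset F" .
      moreover have "?f D \<in> {1..k} \<rightarrow>\<^sub>E UNIV"
        using k by (auto simp: PiE_iff extensional_def)
      ultimately have "?f D \<in> decomps {1..k} (factor_mset F)"
        unfolding decomps_def by blast
      moreover have "real (\<Sum>p\<in>#?f D i. degree p) \<le> v i" if "i \<in> {1..k-1}" for i
      proof -
        have "(\<Sum>p\<in>#?f D i. degree p) = degree (D i)"
          using that degree_factor_mset[OF X[OF D that]] ins(2) by auto
        moreover have "real (degree (D i)) \<le> v i" using D that by blast
        ultimately show ?thesis by (simp only:)
      qed
      ultimately show "?f D \<in> ?Y" by blast
    qed
    show "?g ` ?Y \<subseteq> ?X"
    proof (rule image_subsetI)
      fix E assume E: "E \<in> ?Y"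
      then have E': "E \<in> decomps {1..k} (factor_mset F)" by simp
      have "(\<Prod>i\<in>{1..k-1}. ?g E i) dvd F" using Yprod[OF E] by (metis dvd_triv_left)
      moreover have "real (degree (?g E i)) \<le> v i" if "i \<in> {1..k-1}" for i
      proof -
        have "degree (?g E i) = (\<Sum>p\<in>#E i. degree p)"
          using that monic_prod_mset(2)[OF sub[OF E', of i]] by auto
        moreover have "real (\<Sum>p\<in>#E i. degree p) \<le> v i" using E that by blast
        ultimately show ?thesis by (simp only:)
      qed
      moreover have "?g E \<in> {1..k-1} \<rightarrow>\<^sub>E monic_polys"
        using monic_prod_mset(1)[OF sub[OF E']] by auto
      ultimately show "?g E \<in> ?X" by blast
    qed
  qed
  then show ?thesis by (rule bij_betw_same_card)
qed

section \<open>Dirichlet integrals\<close>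

text \<open>Vanishing off the positive axis puts the domain of integration into the integrand, so
  integrals over simplices become convolutions on the whole line.\<close>

definition pow_dens :: "real \<Rightarrow> real \<Rightarrow> real" where
  "pow_dens a x = (if x > 0 then x powr (a - 1) else 0)"

lemma pow_dens_nonneg [simp]: "pow_dens a x \<ge> 0"
  by (simp add: pow_dens_def)

lemma borel_measurable_pow_dens [measurable]: "pow_dens a \<in> borel_measurable borel"
  unfolding pow_dens_def by measurable

lemma pow_dens_mult:
  "c > 0 \<Longrightarrow> pow_dens a (c * x) = c powr (a - 1) * pow_dens a x"
  by (simp add: pow_dens_def powr_mult zero_less_mult_iff)

text \<open>The substitution x = s y turns this into Euler's Beta integral times s^(a+c-1).\<close>

lemma nn_integral_pow_dens_convolution:
  assumes a: "a > 0" "c > 0"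
  shows "(\<integral>\<^sup>+ x. ennreal (pow_dens a x * pow_dens c (s - x)) \<partial>lborel) = ennreal (Beta a c * pow_dens (a + c) s)"
proof (cases "s > 0")
  case False
  then have zero: "pow_dens a x * pow_dens c (s - x) = 0" "pow_dens (a + c) s = 0" for x
    by (auto simp: pow_dens_def)
  show ?thesis unfolding zero by simp
next
  case True
  have "((\<lambda>t. if t \<in> {0..1} then t powr (a - 1) * (1 - t) powr (c - 1) else 0) has_integral Beta a c) UNIV"
    using has_integral_Beta_real[OF a] by (simp only: has_integral_restrict_UNIV)
  also have "(\<lambda>t. if t \<in> {0..1} then t powr (a - 1) * (1 - t) powr (c - 1) else 0) = (\<lambda>t. pow_dens a t * pow_dens c (1 - t))"
    by (auto simp: pow_dens_def fun_eq_iff)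
  finally have unit: "(\<integral>\<^sup>+ x. ennreal (pow_dens a x * pow_dens c (1 - x)) \<partial>lborel) = ennreal (Beta a c)"
    by (intro nn_integral_has_integral_lborel) auto
  have "(\<integral>\<^sup>+ x. ennreal (pow_dens a x * pow_dens c (s - x)) \<partial>lborel) =
      ennreal \<bar>s\<bar> * (\<integral>\<^sup>+ x. ennreal (pow_dens a (0 + s * x) * pow_dens c (s - (0 + s * x))) \<partial>lborel)"
    using True by (intro nn_integral_real_affine) auto
  also have "(\<lambda>x. ennreal (pow_dens a (0 + s * x) * pow_dens c (s - (0 + s * x)))) =
      (\<lambda>x. ennreal (s powr (a + c - 2)) * ennreal (pow_dens a x * pow_dens c (1 - x)))"
  proof
    fix x
    have "pow_dens c (s - (0 + s * x)) = s powr (c - 1) * pow_dens c (1 - x)"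
      using pow_dens_mult[OF True, of c "1 - x"] by (simp add: algebra_simps)
    moreover have "s powr (a - 1) * s powr (c - 1) = s powr (a + c - 2)"
      by (simp flip: powr_add)
    ultimately show "ennreal (pow_dens a (0 + s * x) * pow_dens c (s - (0 + s * x))) =
        ennreal (s powr (a + c - 2)) * ennreal (pow_dens a x * pow_dens c (1 - x))"
      using True by (simp add: pow_dens_mult mult_ac flip: ennreal_mult')
  qed
  also have "ennreal \<bar>s\<bar> * (\<integral>\<^sup>+ x. ennreal (s powr (a + c - 2)) * ennreal (pow_dens a x * pow_dens c (1 - x)) \<partial>lborel)
      = ennreal (s * s powr (a + c - 2) * Beta a c)"
  proof -
    have "(\<integral>\<^sup>+ x. ennreal (s powr (a + c - 2)) * ennreal (pow_dens a x * pow_dens c (1 - x)) \<partial>lborel) =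
        ennreal (s powr (a + c - 2)) * ennreal (Beta a c)"
      unfolding unit[symmetric] by (intro nn_integral_cmult) measurable
    then show ?thesis using True by (simp add: ennreal_mult' mult.assoc)
  qed
  also have "s * s powr (a + c - 2) * Beta a c = Beta a c * pow_dens (a + c) s"
    using True powr_add[of s 1 "a + c - 2"] by (simp add: pow_dens_def)
  finally show ?thesis .
qed

interpretation lborel_PiM: product_sigma_finite "\<lambda>_. lborel :: real measure"
  by standard

abbreviation lborel_on :: "'i set \<Rightarrow> ('i \<Rightarrow> real) measure" where
  "lborel_on J \<equiv> Pi\<^sub>M J (\<lambda>_. lborel)"

text \<open>By repeated convolution the sum of the coordinates has a density proportional to y^(card
  J * a - 1). The shift \<open>s\<close> and the arbitrary \<open>g\<close> make the induction work,
  since a new coordinate x turns s into s - x. Values in \<open>ennreal\<close> allow the exchange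
  of integrals without integrability conditions.\<close>

lemma nn_integral_PiM_pow_dens:
  assumes "finite J" "J \<noteq> {}" and a: "a > 0"
  shows "\<exists>K\<ge>0. \<forall>s. \<forall>g \<in> borel_measurable borel.
    (\<integral>\<^sup>+ t. ennreal (\<Prod>i\<in>J. pow_dens a (t i)) * g (s - (\<Sum>i\<in>J. t i)) \<partial>lborel_on J) =
    ennreal K * (\<integral>\<^sup>+ y. ennreal (pow_dens (real (card J) * a) y) * g (s - y) \<partial>lborel)"
  using assms(1,2)
proof (induction J rule: finite_ne_induct)
  case (singleton i)
  show ?case
  proof (intro exI[of _ 1] conjI allI ballI)
    fix s and g :: "real \<Rightarrow> ennreal" assume [measurable]: "g \<in> borel_measurable borel"
    have "(\<integral>\<^sup>+ t. ennreal (pow_dens a (t i)) * g (s - t i) \<partial>lborel_on {i}) =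
      (\<integral>\<^sup>+ y. ennreal (pow_dens a y) * g (s - y) \<partial>lborel)"
      by (rule lborel_PiM.product_nn_integral_singleton[where f = "\<lambda>y. ennreal (pow_dens a y) * g (s - y)"]) measurable
    then show "(\<integral>\<^sup>+ t. ennreal (\<Prod>i\<in>{i}. pow_dens a (t i)) * g (s - (\<Sum>i\<in>{i}. t i)) \<partial>lborel_on {i}) =
      ennreal 1 * (\<integral>\<^sup>+ y. ennreal (pow_dens (real (card {i}) * a) y) * g (s - y) \<partial>lborel)"
      by simp
  qed simp
next
  case (insert i J)
  then obtain K where K: "K \<ge> 0" and IH: "\<And>s g. g \<in> borel_measurable borel \<Longrightarrow>
    (\<integral>\<^sup>+ t. ennreal (\<Prod>i\<in>J. pow_dens a (t i)) * g (s - (\<Sum>i\<in>J. t i)) \<partial>lborel_on J) =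
    ennreal K * (\<integral>\<^sup>+ y. ennreal (pow_dens (real (card J) * a) y) * g (s - y) \<partial>lborel)" by blast
  let ?c = "real (card J) * a"
  have c: "?c > 0" using insert a by (simp add: card_gt_0_iff)
  show ?case
  proof (intro exI[of _ "K * Beta a ?c"] conjI allI ballI)
    have Beta: "Beta a ?c \<ge> 0"
      unfolding Beta_def using a c by (intro divide_nonneg_nonneg mult_nonneg_nonneg Gamma_real_nonneg) auto
    then show "K * Beta a ?c \<ge> 0" using K by simp
    fix s and g :: "real \<Rightarrow> ennreal" assume [measurable]: "g \<in> borel_measurable borel"
    have [measurable]: "finite J" by fact
    have "(\<integral>\<^sup>+ t. ennreal (\<Prod>i\<in>insert i J. pow_dens a (t i)) * g (s - (\<Sum>i\<in>insert i J. t i)) \<partial>lborel_on (insert i J)) =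
      (\<integral>\<^sup>+ x. \<integral>\<^sup>+ t. ennreal (\<Prod>j\<in>insert i J. pow_dens a ((t(i := x)) j)) * g (s - (\<Sum>j\<in>insert i J. (t(i := x)) j)) \<partial>lborel_on J \<partial>lborel)"
      using insert by (intro lborel_PiM.product_nn_integral_insert_rev) auto
    also have "\<dots> = (\<integral>\<^sup>+ x. \<integral>\<^sup>+ t. ennreal (pow_dens a x) * (ennreal (\<Prod>j\<in>J. pow_dens a (t j)) * g ((s - x) - (\<Sum>j\<in>J. t j))) \<partial>lborel_on J \<partial>lborel)"
    proof (intro nn_integral_cong)
      fix x :: real and t :: "'a \<Rightarrow> real"
      have upd: "(\<Prod>j\<in>J. pow_dens a ((t(i := x)) j)) = (\<Prod>j\<in>J. pow_dens a (t j))" "(\<Sum>j\<in>J. (t(i := x)) j) = (\<Sum>j\<in>J. t j)"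
        using \<open>i \<notin> J\<close> by (intro prod.cong sum.cong refl; auto)+
      have p: "(\<Prod>j\<in>insert i J. pow_dens a ((t(i := x)) j)) = pow_dens a x * (\<Prod>j\<in>J. pow_dens a (t j))"
        unfolding upd(1)[symmetric] using \<open>finite J\<close> \<open>i \<notin> J\<close> by simp
      have q: "s - (\<Sum>j\<in>insert i J. (t(i := x)) j) = (s - x) - (\<Sum>j\<in>J. t j)"
        unfolding upd(2)[symmetric] using \<open>finite J\<close> \<open>i \<notin> J\<close> by simp
      show "ennreal (\<Prod>j\<in>insert i J. pow_dens a ((t(i := x)) j)) * g (s - (\<Sum>j\<in>insert i J. (t(i := x)) j)) =
         ennreal (pow_dens a x) * (ennreal (\<Prod>j\<in>J. pow_dens a (t j)) * g ((s - x) - (\<Sum>j\<in>J. t j)))"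
        unfolding p q by (simp add: ennreal_mult' mult.assoc)
    qed
    also have "\<dots> = (\<integral>\<^sup>+ x. ennreal (pow_dens a x) * (ennreal K * (\<integral>\<^sup>+ y. ennreal (pow_dens ?c y) * g ((s - x) - y) \<partial>lborel)) \<partial>lborel)"
      using insert by (intro nn_integral_cong) (subst nn_integral_cmult; simp add: IH)
    \<comment> \<open>With z = x + y the argument of \<open>g\<close> is free of x; after the
      exchange of integrals the inner one is a Beta convolution.\<close>
    also have "\<dots> = (\<integral>\<^sup>+ x. ennreal K * (\<integral>\<^sup>+ z. ennreal (pow_dens a x * pow_dens ?c (z - x)) * g (s - z) \<partial>lborel) \<partial>lborel)"
    proof (intro nn_integral_cong)
      fix x :: real
      have "(\<integral>\<^sup>+ y. ennreal (pow_dens ?c y) * g ((s - x) - y) \<partial>lborel) =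
          ennreal \<bar>1\<bar> * (\<integral>\<^sup>+ z. ennreal (pow_dens ?c (- x + 1 * z)) * g ((s - x) - (- x + 1 * z)) \<partial>lborel)"
        by (intro nn_integral_real_affine) auto
      then have "(\<integral>\<^sup>+ y. ennreal (pow_dens ?c y) * g ((s - x) - y) \<partial>lborel) =
          (\<integral>\<^sup>+ z. ennreal (pow_dens ?c (z - x)) * g (s - z) \<partial>lborel)"
        by (simp add: algebra_simps)
      then show "ennreal (pow_dens a x) * (ennreal K * (\<integral>\<^sup>+ y. ennreal (pow_dens ?c y) * g ((s - x) - y) \<partial>lborel)) =
        ennreal K * (\<integral>\<^sup>+ z. ennreal (pow_dens a x * pow_dens ?c (z - x)) * g (s - z) \<partial>lborel)"
        by (simp add: ennreal_mult' mult.assoc nn_integral_cmult mult.left_commute)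
    qed
    also have "\<dots> = ennreal K * (\<integral>\<^sup>+ x. \<integral>\<^sup>+ z. ennreal (pow_dens a x * pow_dens ?c (z - x)) * g (s - z) \<partial>lborel \<partial>lborel)"
      by (intro nn_integral_cmult) measurable
    also have "(\<integral>\<^sup>+ x. \<integral>\<^sup>+ z. ennreal (pow_dens a x * pow_dens ?c (z - x)) * g (s - z) \<partial>lborel \<partial>lborel) =
        (\<integral>\<^sup>+ z. \<integral>\<^sup>+ x. ennreal (pow_dens a x * pow_dens ?c (z - x)) * g (s - z) \<partial>lborel \<partial>lborel)"
      by (rule lborel_pair.Fubini'[symmetric]) measurable
    also have "\<dots> = (\<integral>\<^sup>+ z. ennreal (Beta a ?c) * (ennreal (pow_dens (a + ?c) z) * g (s - z)) \<partial>lborel)"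
    proof (intro nn_integral_cong)
      fix z :: real
      have eq: "(\<integral>\<^sup>+ x. ennreal (pow_dens a x * pow_dens ?c (z - x)) * g (s - z) \<partial>lborel) =
          (\<integral>\<^sup>+ x. ennreal (pow_dens a x * pow_dens ?c (z - x)) \<partial>lborel) * g (s - z)"
        by (intro nn_integral_multc) measurable
      show "(\<integral>\<^sup>+ x. ennreal (pow_dens a x * pow_dens ?c (z - x)) * g (s - z) \<partial>lborel) =
          ennreal (Beta a ?c) * (ennreal (pow_dens (a + ?c) z) * g (s - z))"
        unfolding eq nn_integral_pow_dens_convolution[OF a c] using Beta by (simp add: ennreal_mult' mult.assoc)
    qed
    also have "\<dots> = ennreal (Beta a ?c) * (\<integral>\<^sup>+ z. ennreal (pow_dens (a + ?c) z) * g (s - z) \<partial>lborel)"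
      by (intro nn_integral_cmult) measurable
    finally show "(\<integral>\<^sup>+ t. ennreal (\<Prod>i\<in>insert i J. pow_dens a (t i)) * g (s - (\<Sum>i\<in>insert i J. t i)) \<partial>lborel_on (insert i J)) =
      ennreal (K * Beta a ?c) * (\<integral>\<^sup>+ y. ennreal (pow_dens (real (card (insert i J)) * a) y) * g (s - y) \<partial>lborel)"
      using insert K by (simp add: ennreal_mult' mult.assoc algebra_simps)
  qed
qed

lemma nn_integral_PiM_pow_dens_simplex:
  assumes "finite J" and a: "a > 0"
  shows "\<exists>K\<ge>0. \<forall>s. (\<integral>\<^sup>+ t. ennreal ((\<Prod>i\<in>J. pow_dens a (t i)) * pow_dens a (s - (\<Sum>i\<in>J. t i))) \<partial>lborel_on J) =
    ennreal (K * pow_dens ((real (card J) + 1) * a) s)"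
proof (cases "J = {}")
  case True
  then show ?thesis
    by (intro exI[of _ 1]) (simp add: PiM_empty)
next
  case False
  let ?c = "real (card J) * a"
  have c: "?c > 0" using assms False by (simp add: card_gt_0_iff)
  obtain K where K: "K \<ge> 0" "\<And>s g. g \<in> borel_measurable borel \<Longrightarrow>
    (\<integral>\<^sup>+ t. ennreal (\<Prod>i\<in>J. pow_dens a (t i)) * g (s - (\<Sum>i\<in>J. t i)) \<partial>lborel_on J) =
    ennreal K * (\<integral>\<^sup>+ y. ennreal (pow_dens ?c y) * g (s - y) \<partial>lborel)"
    using nn_integral_PiM_pow_dens[OF assms(1) False a] by blast
  have Beta: "Beta ?c a \<ge> 0"
    unfolding Beta_def using a c by (intro divide_nonneg_nonneg mult_nonneg_nonneg Gamma_real_nonneg) auto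
  have "(\<integral>\<^sup>+ t. ennreal ((\<Prod>i\<in>J. pow_dens a (t i)) * pow_dens a (s - (\<Sum>i\<in>J. t i))) \<partial>lborel_on J) =
      ennreal (K * Beta ?c a * pow_dens (?c + a) s)" for s
    using K(2)[of "\<lambda>x. ennreal (pow_dens a x)" s] K(1) nn_integral_pow_dens_convolution[OF c a, of s]
    by (simp add: ennreal_mult' prod_nonneg mult.assoc)
  then show ?thesis
    using K(1) Beta by (intro exI[of _ "K * Beta ?c a"]) (simp add: algebra_simps)
qed

text \<open>Bounds the error in replacing \<open>nb_coeff a\<close> at an integer near \<open>x\<close> by its asymptotic value at \<open>x\<close>;
  unlike \<open>pow_dens a\<close> it is integrable at infinity, which is what makes the total error small.\<close>

definition err_dens :: "real \<Rightarrow> real \<Rightarrow> real" where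
  "err_dens a x = (if x > 0 then min (x powr (a - 1)) (x powr (a - 2)) else 0)"

lemma err_dens_nonneg [simp]: "err_dens a x \<ge> 0"
  by (simp add: err_dens_def)

lemma borel_measurable_err_dens [measurable]: "err_dens a \<in> borel_measurable borel"
  unfolding err_dens_def by measurable

section \<open>One-dimensional estimates at the singularities\<close>

lemma nn_integral_pow_dens_le:
  assumes a: "a > 0" and c: "c \<ge> 0"
  shows "(\<integral>\<^sup>+ x. ennreal (pow_dens a x * indicator {0..c} x) \<partial>lborel) = ennreal (c powr a / a)"
proof -
  have "((\<lambda>x. if x \<in> {0..c} then x powr (a - 1) else 0) has_integral (c powr a / a)) UNIV"
    unfolding has_integral_restrict_UNIV using has_integral_powr_from_0[of "a - 1" c] a c by simp
  also have "(\<lambda>x. if x \<in> {0..c} then x powr (a - 1) else 0) = (\<lambda>x. pow_dens a x * indicator {0..c} x)"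
    by (auto simp: fun_eq_iff pow_dens_def)
  finally show ?thesis by (intro nn_integral_has_integral_lborel) auto
qed

text \<open>x^(a-1) is integrable at 0 because a > 0, and x^(a-2) at infinity because a < 1.\<close>

lemma nn_integral_err_dens:
  assumes a: "0 < a" "a < 1"
  shows "(\<integral>\<^sup>+ x. ennreal (err_dens a x) \<partial>lborel) \<le> ennreal (1 / a + 1 / (1 - a))"
proof -
  have "- (1 / (a - 1)) = 1 / (1 - a)" using a by (simp add: field_simps)
  then have tail: "((\<lambda>x. if x \<in> {1..} then x powr (a - 2) else 0) has_integral (1 / (1 - a))) UNIV"
    unfolding has_integral_restrict_UNIV using has_integral_powr_to_inf[of "a - 2" 1] a by simp
  have "(\<integral>\<^sup>+ x. ennreal (err_dens a x) \<partial>lborel) \<le>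
      (\<integral>\<^sup>+ x. ennreal (pow_dens a x * indicator {0..1} x) + ennreal (if x \<in> {1..} then x powr (a - 2) else 0) \<partial>lborel)"
    by (intro nn_integral_mono) (auto simp: err_dens_def pow_dens_def indicator_def simp flip: ennreal_plus intro!: ennreal_leI)
  also have "\<dots> = (\<integral>\<^sup>+ x. ennreal (pow_dens a x * indicator {0..1} x) \<partial>lborel) + (\<integral>\<^sup>+ x. ennreal (if x \<in> {1..} then x powr (a - 2) else 0) \<partial>lborel)"
    by (intro nn_integral_add) auto
  also have "(\<integral>\<^sup>+ x. ennreal (if x \<in> {1..} then x powr (a - 2) else 0) \<partial>lborel) = ennreal (1 / (1 - a))"
    using tail by (intro nn_integral_has_integral_lborel) auto
  also have "(\<integral>\<^sup>+ x. ennreal (pow_dens a x * indicator {0..1} x) \<partial>lborel) = ennreal (1 / a)"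
    using nn_integral_pow_dens_le[of a 1] a by simp
  also have "ennreal (1 / a) + ennreal (1 / (1 - a)) = ennreal (1 / a + 1 / (1 - a))"
    using a by (intro ennreal_plus[symmetric]) auto
  finally show ?thesis .
qed

lemma powr_half_le: "y \<ge> 1 / 2 \<Longrightarrow> 0 \<le> b \<Longrightarrow> b \<le> 1 \<Longrightarrow> y powr - b \<le> 2" for y b :: real
proof -
  assume y: "y \<ge> 1 / 2" "0 \<le> b" "b \<le> 1"
  have "y powr - b \<le> (1 / 2) powr - b" using y by (intro powr_mono2') auto
  also have "\<dots> = 2 powr b" by (simp add: powr_minus powr_divide)
  also have "\<dots> \<le> 2 powr 1" using y by (intro powr_mono) auto
  finally show ?thesis by simp
qed

lemma nn_integral_le_lincomb:
  fixes f g h :: "real \<Rightarrow> real"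
  assumes [measurable]: "g \<in> borel_measurable borel" "h \<in> borel_measurable borel"
    and nonneg: "\<And>x. g x \<ge> 0" "\<And>x. h x \<ge> 0" "c \<ge> 0" "d \<ge> 0" "A \<ge> 0" "B \<ge> 0"
    and le: "\<And>x. f x \<le> c * g x + d * h x"
    and A: "(\<integral>\<^sup>+ x. ennreal (g x) \<partial>lborel) \<le> ennreal A"
    and B: "(\<integral>\<^sup>+ x. ennreal (h x) \<partial>lborel) \<le> ennreal B"
  shows "(\<integral>\<^sup>+ x. ennreal (f x) \<partial>lborel) \<le> ennreal (c * A + d * B)"
proof -
  have "(\<integral>\<^sup>+ x. ennreal (f x) \<partial>lborel) \<le>
      (\<integral>\<^sup>+ x. ennreal c * ennreal (g x) + ennreal d * ennreal (h x) \<partial>lborel)"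
    using nonneg le by (intro nn_integral_mono) (simp flip: ennreal_mult' ennreal_plus add: ennreal_leI)
  also have "\<dots> = ennreal c * (\<integral>\<^sup>+ x. ennreal (g x) \<partial>lborel) + ennreal d * (\<integral>\<^sup>+ x. ennreal (h x) \<partial>lborel)"
    by (simp add: nn_integral_add nn_integral_cmult)
  also have "\<dots> \<le> ennreal c * ennreal A + ennreal d * ennreal B"
    by (intro add_mono mult_left_mono A B) auto
  also have "\<dots> = ennreal (c * A + d * B)"
    using nonneg by (simp add: ennreal_mult' ennreal_plus)
  finally show ?thesis .
qed

text \<open>For y \<le> 1/2 the second factor is at most 2, and rescaling the first gives 1/n. For y
  > 1/2 the first factor is already at most 4/n, and the singularity at 1 is integrable.\<close>

lemma nn_integral_err_dens_pow_dens:
  assumes a: "0 < a" "a < 1"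
  obtains C where "C \<ge> 0" "\<And>n :: nat. n \<ge> 1 \<Longrightarrow>
    (\<integral>\<^sup>+ y. ennreal (err_dens a (real n * y) * pow_dens (1 - a) (1 - y)) \<partial>lborel) \<le> ennreal (C / real n)"
proof
  let ?E = "1 / a + 1 / (1 - a)"
  have Beta: "Beta 1 (1 - a) \<ge> 0"
    unfolding Beta_def using a by (intro divide_nonneg_nonneg mult_nonneg_nonneg Gamma_real_nonneg) auto
  show "2 * ?E + 4 * Beta 1 (1 - a) \<ge> 0" using a Beta by auto
  fix n :: nat assume n: "n \<ge> 1"
  \<comment> \<open>\<open>pow_dens 1 y\<close> is the indicator of y > 0; it brings the second
    integral into the form of a Beta convolution.\<close>
  have pw: "err_dens a (real n * y) * pow_dens (1 - a) (1 - y) \<le>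
      2 * err_dens a (real n * y) + 4 / real n * (pow_dens 1 y * pow_dens (1 - a) (1 - y))" for y
  proof (cases "0 < y \<and> y < 1")
    case False
    then have zero: "err_dens a (real n * y) * pow_dens (1 - a) (1 - y) = 0"
      using n by (auto simp: err_dens_def pow_dens_def zero_less_mult_iff)
    show ?thesis unfolding zero by (intro add_nonneg_nonneg mult_nonneg_nonneg) auto
  next
    case True
    show ?thesis
    proof (cases "y \<le> 1 / 2")
      case le: True
      have "pow_dens (1 - a) (1 - y) \<le> 2"
        using powr_half_le[of "1 - y" a] True le a by (simp add: pow_dens_def)
      then have "err_dens a (real n * y) * pow_dens (1 - a) (1 - y) \<le> err_dens a (real n * y) * 2"
        by (intro mult_left_mono) auto
      then show ?thesis by (simp add: add_increasing2)
    next
      case False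
      have "err_dens a (real n * y) \<le> (real n * y) powr (a - 2)"
        by (simp add: err_dens_def)
      also have "\<dots> \<le> (real n / 2) powr (a - 2)"
        using False n a by (intro powr_mono2') auto
      also have "\<dots> = real n powr (a - 2) * 2 powr (2 - a)"
        using n by (simp add: powr_divide powr_diff)
      also have "\<dots> \<le> real n powr - 1 * 2 powr 2"
        using n a by (intro mult_mono powr_mono) auto
      finally have "err_dens a (real n * y) \<le> 4 / real n"
        using n by (simp add: powr_minus divide_simps)
      then have "err_dens a (real n * y) * pow_dens (1 - a) (1 - y) \<le> 4 / real n * pow_dens (1 - a) (1 - y)"
        by (intro mult_right_mono) auto
      moreover have "pow_dens 1 y = 1" using True by (simp add: pow_dens_def)
      ultimately show ?thesis by (simp add: add_increasing)
    qed
  qed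
  have scale: "(\<integral>\<^sup>+ y. ennreal (err_dens a (real n * y)) \<partial>lborel) \<le> ennreal (?E / real n)"
  proof -
    have "(\<integral>\<^sup>+ y. ennreal (err_dens a (real n * y)) \<partial>lborel) =
        ennreal \<bar>1 / real n\<bar> * (\<integral>\<^sup>+ x. ennreal (err_dens a (real n * (0 + 1 / real n * x))) \<partial>lborel)"
      using n by (intro nn_integral_real_affine) auto
    also have "\<dots> = ennreal (1 / real n) * (\<integral>\<^sup>+ x. ennreal (err_dens a x) \<partial>lborel)"
      using n by simp
    also have "\<dots> \<le> ennreal (1 / real n) * ennreal ?E"
      using nn_integral_err_dens[OF a] by (intro mult_left_mono) auto
    also have "\<dots> = ennreal (?E / real n)"
      using a n by (subst ennreal_mult'[symmetric]) auto
    finally show ?thesis .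
  qed
  have "(\<integral>\<^sup>+ y. ennreal (pow_dens 1 y * pow_dens (1 - a) (1 - y)) \<partial>lborel) \<le> ennreal (Beta 1 (1 - a))"
    using a by (subst nn_integral_pow_dens_convolution) (auto simp: pow_dens_def)
  then have "(\<integral>\<^sup>+ y. ennreal (err_dens a (real n * y) * pow_dens (1 - a) (1 - y)) \<partial>lborel) \<le>
      ennreal (2 * (?E / real n) + 4 / real n * Beta 1 (1 - a))"
    using a Beta by (intro nn_integral_le_lincomb[OF _ _ _ _ _ _ _ _ pw scale]) auto
  also have "2 * (?E / real n) + 4 / real n * Beta 1 (1 - a) = (2 * ?E + 4 * Beta 1 (1 - a)) / real n"
    by (simp add: add_divide_distrib)
  finally show "(\<integral>\<^sup>+ y. ennreal (err_dens a (real n * y) * pow_dens (1 - a) (1 - y)) \<partial>lborel) \<le>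
      ennreal ((2 * ?E + 4 * Beta 1 (1 - a)) / real n)" .
qed

text \<open>The density decreases, so among the intervals of length at most \<delta> the one
  starting at 0 has the largest mass.\<close>

lemma nn_integral_pow_dens_interval_le:
  assumes a: "0 < a" "a \<le> 1" and w: "0 \<le> \<alpha>" "\<beta> - \<alpha> \<le> \<delta>" "0 \<le> \<delta>"
  shows "(\<integral>\<^sup>+ y. ennreal (pow_dens a y * indicator {\<alpha>..\<beta>} y) \<partial>lborel) \<le> ennreal (\<delta> powr a / a)"
proof -
  \<comment> \<open>The left end is removed because the comparison after the shift fails there:
    \<open>pow_dens a\<close> vanishes at 0 but not at a positive \<alpha>.\<close>
  have "(\<integral>\<^sup>+ y. ennreal (pow_dens a y * indicator {\<alpha>..\<beta>} y) \<partial>lborel) =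
      (\<integral>\<^sup>+ y. ennreal (pow_dens a y * indicator {\<alpha><..\<beta>} y) \<partial>lborel)"
    using AE_lborel_singleton[of \<alpha>] by (intro nn_integral_cong_AE) (auto elim!: eventually_mono simp: indicator_def)
  also have "\<dots> = ennreal \<bar>1\<bar> * (\<integral>\<^sup>+ y. ennreal (pow_dens a (\<alpha> + 1 * y) * indicator {\<alpha><..\<beta>} (\<alpha> + 1 * y)) \<partial>lborel)"
    by (intro nn_integral_real_affine) auto
  also have "\<dots> = (\<integral>\<^sup>+ y. ennreal (pow_dens a (\<alpha> + y) * indicator {\<alpha><..\<beta>} (\<alpha> + y)) \<partial>lborel)"
    by simp
  also have "\<dots> \<le> (\<integral>\<^sup>+ y. ennreal (pow_dens a y * indicator {0..\<delta>} y) \<partial>lborel)"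
    using w a by (intro nn_integral_mono ennreal_leI) (auto simp: indicator_def pow_dens_def intro!: powr_mono2')
  also have "\<dots> = ennreal (\<delta> powr a / a)" by (rule nn_integral_pow_dens_le) (use a w in auto)
  finally show ?thesis .
qed

text \<open>The singularity at 0 dominates: it costs n^(-a), the one at 1 costs n^(-(1-a)), and a
  \<le> 1/2. On either side of 1/2 only one of them is active.\<close>

lemma nn_integral_pow_dens_window:
  assumes a: "0 < a" "a \<le> 1 / 2" and n: "n \<ge> 1"
    and w: "0 \<le> \<alpha>" "\<beta> \<le> 1" "\<beta> - \<alpha> \<le> 1 / real n"
  shows "(\<integral>\<^sup>+ y. ennreal ((pow_dens a y * indicator {\<alpha>..\<beta>} y) * pow_dens (1 - a) (1 - y)) \<partial>lborel)
    \<le> ennreal ((2 / a + 2 / (1 - a)) * real n powr - a)"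
proof -
  have pw: "(pow_dens a y * indicator {\<alpha>..\<beta>} y) * pow_dens (1 - a) (1 - y) \<le>
      2 * (pow_dens a y * indicator {\<alpha>..\<beta>} y) + 2 * (pow_dens (1 - a) (1 - y) * indicator {\<alpha>..\<beta>} y)" for y
  proof (cases "0 < y \<and> y < 1 \<and> y \<in> {\<alpha>..\<beta>}")
    case False
    then have zero: "(pow_dens a y * indicator {\<alpha>..\<beta>} y) * pow_dens (1 - a) (1 - y) = 0"
      by (auto simp: pow_dens_def)
    show ?thesis unfolding zero by (intro add_nonneg_nonneg mult_nonneg_nonneg) auto
  next
    case True
    show ?thesis
    proof (cases "y \<le> 1 / 2")
      case le: True
      have "pow_dens (1 - a) (1 - y) \<le> 2"
        using powr_half_le[of "1 - y" a] True le a by (simp add: pow_dens_def)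
      then have "pow_dens a y * pow_dens (1 - a) (1 - y) \<le> pow_dens a y * 2"
        by (intro mult_left_mono) auto
      then show ?thesis using True by (simp add: add_increasing2)
    next
      case False
      have "pow_dens a y \<le> 2"
        using powr_half_le[of y "1 - a"] True False a by (simp add: pow_dens_def)
      then have "pow_dens a y * pow_dens (1 - a) (1 - y) \<le> 2 * pow_dens (1 - a) (1 - y)"
        by (intro mult_right_mono) auto
      then show ?thesis using True by (simp add: add_increasing)
    qed
  qed
  have n1: "(1 / real n) powr b = real n powr - b" for b
    by (simp add: powr_divide powr_minus divide_simps)
  have 1: "(\<integral>\<^sup>+ y. ennreal (pow_dens a y * indicator {\<alpha>..\<beta>} y) \<partial>lborel) \<le> ennreal (real n powr - a / a)"
    using nn_integral_pow_dens_interval_le[of a \<alpha> \<beta> "1 / real n"] a w n unfolding n1 by simp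
  have "(\<integral>\<^sup>+ y. ennreal (pow_dens (1 - a) (1 - y) * indicator {\<alpha>..\<beta>} y) \<partial>lborel) =
      ennreal \<bar>-1\<bar> * (\<integral>\<^sup>+ y. ennreal (pow_dens (1 - a) (1 - (1 + (-1) * y)) * indicator {\<alpha>..\<beta>} (1 + (-1) * y)) \<partial>lborel)"
    by (intro nn_integral_real_affine) auto
  also have "\<dots> = (\<integral>\<^sup>+ y. ennreal (pow_dens (1 - a) y * indicator {1 - \<beta>..1 - \<alpha>} y) \<partial>lborel)"
    by (auto intro!: nn_integral_cong simp: indicator_def)
  also have "\<dots> \<le> ennreal (real n powr - (1 - a) / (1 - a))"
    using nn_integral_pow_dens_interval_le[of "1 - a" "1 - \<beta>" "1 - \<alpha>" "1 / real n"] a w n unfolding n1 by simp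
  also have "\<dots> \<le> ennreal (real n powr - a / (1 - a))"
    using a n by (intro ennreal_leI divide_right_mono powr_mono) auto
  finally have 2: "(\<integral>\<^sup>+ y. ennreal (pow_dens (1 - a) (1 - y) * indicator {\<alpha>..\<beta>} y) \<partial>lborel) \<le> ennreal (real n powr - a / (1 - a))" .
  have "(\<integral>\<^sup>+ y. ennreal ((pow_dens a y * indicator {\<alpha>..\<beta>} y) * pow_dens (1 - a) (1 - y)) \<partial>lborel) \<le>
      ennreal (2 * (real n powr - a / a) + 2 * (real n powr - a / (1 - a)))"
    using a by (intro nn_integral_le_lincomb[OF _ _ _ _ _ _ _ _ pw 1 2]) auto
  also have "2 * (real n powr - a / a) + 2 * (real n powr - a / (1 - a)) = (2 / a + 2 / (1 - a)) * real n powr - a"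
    by (simp add: algebra_simps)
  finally show ?thesis .
qed

section \<open>Replacing coefficients by powers\<close>

text \<open>The index \<open>d\<close> is represented by a point \<open>x\<close> at distance at
  most \<open>k\<close> to the left of d + 1. On that side the decreasing power is larger at
  \<open>x\<close>, which gives the domination by \<open>pow_dens\<close>.\<close>

lemma nb_coeff_pow_dens:
  assumes a: "0 < a" "a \<le> 1" and k: "k \<ge> 1"
  obtains K where "K \<ge> 1"
    "\<And>x d. 0 < x \<Longrightarrow> x \<le> real d + 1 \<Longrightarrow> real d + 1 \<le> x + real k \<Longrightarrow>
       \<bar>nb_coeff a d - pow_dens a x / Gamma a\<bar> \<le> K * err_dens a x"
    "\<And>x d. 0 < x \<Longrightarrow> x \<le> real d + 1 \<Longrightarrow> nb_coeff a d \<le> K * pow_dens a x"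
    "1 / Gamma a \<le> K"
proof -
  have G: "Gamma a > 0" using a by (intro Gamma_real_pos)
  obtain C where C: "C > 0"
    "\<And>n. \<bar>nb_coeff a n - (real n + 1) powr (a - 1) / Gamma a\<bar> \<le> C * (real n + 1) powr (a - 2)"
    using nb_coeff_asymp[OF a] by blast
  obtain B where B: "B > 0" "\<And>n. nb_coeff a n \<le> B * (real n + 1) powr (a - 1)"
    using nb_coeff_le[OF a] by blast
  define K where "K = 1 + C + B + real k * (1 / Gamma a)"
  have kG: "1 / Gamma a \<le> real k * (1 / Gamma a)" "0 \<le> 1 / Gamma a"
    using G k by (auto intro!: divide_right_mono)
  show ?thesis
  proof
    show "K \<ge> 1" unfolding K_def using B C kG by linarith
    show "1 / Gamma a \<le> K" unfolding K_def using B C kG by linarith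
    fix x :: real and d :: nat assume x: "0 < x" "x \<le> real d + 1"
    let ?y = "real d + 1"
    have y1: "?y powr (a - 1) \<le> x powr (a - 1)" "?y powr (a - 2) \<le> x powr (a - 2)"
      using x a by (intro powr_mono2'; simp)+
    have "nb_coeff a d \<le> B * x powr (a - 1)"
      using B y1 by (meson mult_left_mono order_trans less_imp_le)
    also have "\<dots> \<le> K * x powr (a - 1)"
      unfolding K_def using B C kG by (intro mult_right_mono) auto
    finally show "nb_coeff a d \<le> K * pow_dens a x" using x by (simp add: pow_dens_def)
    assume xk: "real d + 1 \<le> x + real k"
    have "?y powr (a - 2) \<le> ?y powr (a - 1)" by (intro powr_mono) auto
    then have "?y powr (a - 2) \<le> err_dens a x" using y1 x by (simp add: err_dens_def)
    then have e1: "C * ?y powr (a - 2) \<le> C * err_dens a x" using C by (intro mult_left_mono) auto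
    have "x powr (a - 1) - ?y powr (a - 1) \<le> - (a - 1) * x powr (a - 1 - 1) * (?y - x)"
      using x a by (intro powr_neg_exp_diff) auto
    also have "\<dots> = ((1 - a) * (?y - x)) * x powr (a - 2)" by simp
    also have "\<dots> \<le> (1 * real k) * x powr (a - 2)"
      using x xk a by (intro mult_right_mono mult_mono) auto
    finally have d1: "x powr (a - 1) - ?y powr (a - 1) \<le> real k * x powr (a - 2)" by simp
    \<comment> \<open>For small \<open>x\<close> the mean value bound \<open>d1\<close> is too weak;
      there the difference is bounded by its first term. The minimum of the two bounds is
      \<open>err_dens\<close>.\<close>
    have "x powr (a - 1) - ?y powr (a - 1) \<le> 1 * x powr (a - 1)" by simp
    also have "\<dots> \<le> real k * x powr (a - 1)" using k by (intro mult_right_mono) auto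
    finally have d2: "x powr (a - 1) - ?y powr (a - 1) \<le> real k * x powr (a - 1)" .
    have "x powr (a - 1) - ?y powr (a - 1) \<le> real k * err_dens a x"
      using d1 d2 x by (simp add: err_dens_def min_def)
    then have "(x powr (a - 1) - ?y powr (a - 1)) / Gamma a \<le> real k * err_dens a x / Gamma a"
      using G by (intro divide_right_mono) auto
    then have e2: "\<bar>?y powr (a - 1) / Gamma a - x powr (a - 1) / Gamma a\<bar> \<le> real k * (1 / Gamma a) * err_dens a x"
      using y1 G by (simp add: abs_le_iff divide_right_mono diff_divide_distrib add_increasing)
    have "\<bar>nb_coeff a d - pow_dens a x / Gamma a\<bar> \<le>
       \<bar>nb_coeff a d - ?y powr (a - 1) / Gamma a\<bar> + \<bar>?y powr (a - 1) / Gamma a - x powr (a - 1) / Gamma a\<bar>"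
      using x by (simp add: pow_dens_def)
    also have "\<dots> \<le> C * err_dens a x + real k * (1 / Gamma a) * err_dens a x"
      using C(2)[of d] e1 e2 by linarith
    also have "\<dots> = (C + real k * (1 / Gamma a)) * err_dens a x" by (simp add: algebra_simps)
    also have "\<dots> \<le> K * err_dens a x"
      unfolding K_def using B by (intro mult_right_mono) auto
    finally show "\<bar>nb_coeff a d - pow_dens a x / Gamma a\<bar> \<le> K * err_dens a x" .
  qed
qed

text \<open>Telescoping: the factors are exchanged one at a time, and in each term one factor is an
  error while the others are dominated by K f.\<close>

lemma abs_prod_diff_le:
  fixes b c e f :: "'i \<Rightarrow> real"
  assumes "finite J" and K: "K \<ge> 0"
    and "\<And>i. i \<in> J \<Longrightarrow> \<bar>b i - c i\<bar> \<le> K * e i"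
    and "\<And>i. i \<in> J \<Longrightarrow> 0 \<le> b i" "\<And>i. i \<in> J \<Longrightarrow> b i \<le> K * f i"
    and "\<And>i. i \<in> J \<Longrightarrow> 0 \<le> c i" "\<And>i. i \<in> J \<Longrightarrow> c i \<le> K * f i"
    and "\<And>i. i \<in> J \<Longrightarrow> 0 \<le> e i" "\<And>i. i \<in> J \<Longrightarrow> 0 \<le> f i"
  shows "\<bar>(\<Prod>i\<in>J. b i) - (\<Prod>i\<in>J. c i)\<bar> \<le> K ^ card J * (\<Sum>j\<in>J. e j * (\<Prod>i\<in>J - {j}. f i))"
  using assms(1,3-)
proof (induction J rule: finite_induct)
  case (insert x J)
  let ?S = "\<Sum>j\<in>J. e j * (\<Prod>i\<in>J - {j}. f i)"
  have IH: "\<bar>(\<Prod>i\<in>J. b i) - (\<Prod>i\<in>J. c i)\<bar> \<le> K ^ card J * ?S"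
    using insert by auto
  have "(\<Prod>i\<in>J. b i) \<le> (\<Prod>i\<in>J. K * f i)"
    using insert by (intro prod_mono) auto
  then have bf: "(\<Prod>i\<in>J. b i) \<le> K ^ card J * (\<Prod>i\<in>J. f i)"
    by (simp add: prod.distrib)
  have b0: "(\<Prod>i\<in>J. b i) \<ge> 0" using insert by (intro prod_nonneg) auto
  have "(\<Prod>i\<in>insert x J. b i) - (\<Prod>i\<in>insert x J. c i) =
      (b x - c x) * (\<Prod>i\<in>J. b i) + c x * ((\<Prod>i\<in>J. b i) - (\<Prod>i\<in>J. c i))"
    using insert by (simp add: algebra_simps)
  then have "\<bar>(\<Prod>i\<in>insert x J. b i) - (\<Prod>i\<in>insert x J. c i)\<bar> \<le>
      \<bar>b x - c x\<bar> * (\<Prod>i\<in>J. b i) + c x * \<bar>(\<Prod>i\<in>J. b i) - (\<Prod>i\<in>J. c i)\<bar>"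
    using b0 insert.prems(4)[of x] by (simp add: abs_mult order_trans[OF abs_triangle_ineq])
  also have "\<dots> \<le> (K * e x) * (K ^ card J * (\<Prod>i\<in>J. f i)) + (K * f x) * (K ^ card J * ?S)"
    using insert b0 bf IH K by (intro add_mono mult_mono) (auto intro!: mult_nonneg_nonneg)
  also have "\<dots> = K ^ card (insert x J) * (e x * (\<Prod>i\<in>J. f i) + f x * ?S)"
    using insert by (simp add: algebra_simps)
  also have "f x * ?S = (\<Sum>j\<in>J. e j * (\<Prod>i\<in>insert x J - {j}. f i))"
    unfolding sum_distrib_left
  proof (intro sum.cong refl)
    fix j assume "j \<in> J"
    then have "insert x J - {j} = insert x (J - {j})" using insert by auto
    then show "f x * (e j * (\<Prod>i\<in>J - {j}. f i)) = e j * (\<Prod>i\<in>insert x J - {j}. f i)"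
      using insert by simp
  qed
  also have "e x * (\<Prod>i\<in>J. f i) + (\<Sum>j\<in>J. e j * (\<Prod>i\<in>insert x J - {j}. f i)) =
      (\<Sum>j\<in>insert x J. e j * (\<Prod>i\<in>insert x J - {j}. f i))"
    using insert by simp
  finally show ?case .
qed simp

section \<open>Marginals and grid cells in several variables\<close>

lemma borel_measurable_PiM_coordinate:
  fixes h :: "real \<Rightarrow> real"
  assumes I: "finite I" "i \<in> I" and h: "h \<in> borel_measurable borel"
  shows "(\<lambda>t. h (t i) * ((\<Prod>j\<in>I - {i}. pow_dens a (t j)) * pow_dens a (1 - (\<Sum>j\<in>I. t j)))) \<in> borel_measurable (lborel_on I)"
proof -
  have comp: "(\<lambda>t. t j) \<in> borel_measurable (lborel_on I)" if "j \<in> I" for j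
    using measurable_component_singleton[OF that, of "\<lambda>_. lborel"] by simp
  have "(\<lambda>t. 1 - (\<Sum>j\<in>I. t j)) \<in> borel_measurable (lborel_on I)"
    by (intro borel_measurable_diff borel_measurable_const borel_measurable_sum comp)
  moreover have "(\<lambda>t. \<Prod>j\<in>I - {i}. pow_dens a (t j)) \<in> borel_measurable (lborel_on I)"
    by (intro borel_measurable_prod measurable_compose[OF comp borel_measurable_pow_dens]) auto
  ultimately show ?thesis
    using I by (intro borel_measurable_times measurable_compose[OF comp h] measurable_compose[OF _ borel_measurable_pow_dens])
qed

text \<open>Fixing t i = y leaves a simplex integral of size 1 - y in the other coordinates. The
  factor of coordinate \<open>i\<close> is an arbitrary \<open>h\<close>, later an error density or
  a density cut to a window.\<close>

lemma nn_integral_PiM_coordinate: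
  assumes I: "finite I" "i \<in> I" and a: "a > 0"
  shows "\<exists>K\<ge>0. \<forall>h \<in> borel_measurable borel. (\<forall>y. h y \<ge> 0) \<longrightarrow>
    (\<integral>\<^sup>+ t. ennreal (h (t i) * ((\<Prod>j\<in>I - {i}. pow_dens a (t j)) * pow_dens a (1 - (\<Sum>j\<in>I. t j)))) \<partial>lborel_on I) =
    ennreal K * (\<integral>\<^sup>+ y. ennreal (h y * pow_dens (real (card I) * a) (1 - y)) \<partial>lborel)"
proof -
  let ?J = "I - {i}"
  have J: "finite ?J" "i \<notin> ?J" "I = insert i ?J" using I by auto
  have card: "real (card ?J) + 1 = real (card I)"
    using I by (metis J(1,2,3) card_insert_disjoint of_nat_Suc add.commute)
  obtain K where K: "K \<ge> 0" "\<And>s. (\<integral>\<^sup>+ t. ennreal ((\<Prod>j\<in>?J. pow_dens a (t j)) * pow_dens a (s - (\<Sum>j\<in>?J. t j))) \<partial>lborel_on ?J) =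
    ennreal (K * pow_dens (real (card I) * a) s)"
    using nn_integral_PiM_pow_dens_simplex[OF J(1) a] unfolding card by blast
  show ?thesis
  proof (intro exI[of _ K] conjI ballI impI)
    show "K \<ge> 0" by fact
    fix h :: "real \<Rightarrow> real" assume [measurable]: "h \<in> borel_measurable borel" and h: "\<forall>y. h y \<ge> 0"
    let ?F = "\<lambda>t. ennreal (h (t i) * ((\<Prod>j\<in>?J. pow_dens a (t j)) * pow_dens a (1 - (\<Sum>j\<in>I. t j))))"
    have meas: "?F \<in> borel_measurable (lborel_on I)"
      by (intro measurable_compose[OF borel_measurable_PiM_coordinate measurable_ennreal] I) measurable
    have "(\<integral>\<^sup>+ t. ?F t \<partial>lborel_on I) = (\<integral>\<^sup>+ t. ?F t \<partial>lborel_on (insert i ?J))"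
      using J(3) by simp
    also have "\<dots> = (\<integral>\<^sup>+ y. \<integral>\<^sup>+ t. ?F (t(i := y)) \<partial>lborel_on ?J \<partial>lborel)"
      using J meas by (intro lborel_PiM.product_nn_integral_insert_rev) auto
    also have "\<dots> = (\<integral>\<^sup>+ y. ennreal K * ennreal (h y * pow_dens (real (card I) * a) (1 - y)) \<partial>lborel)"
    proof (intro nn_integral_cong)
      fix y :: real
      have "?F (t(i := y)) = ennreal (h y) * ennreal ((\<Prod>j\<in>?J. pow_dens a (t j)) * pow_dens a ((1 - y) - (\<Sum>j\<in>?J. t j)))" for t
      proof -
        have "(\<Prod>j\<in>?J. pow_dens a ((t(i := y)) j)) = (\<Prod>j\<in>?J. pow_dens a (t j))"
          by (intro prod.cong) auto
        moreover have "(\<Sum>j\<in>I. (t(i := y)) j) = y + (\<Sum>j\<in>?J. t j)"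
          using I by (simp add: sum.remove)
        ultimately show ?thesis using h by (simp add: ennreal_mult' algebra_simps)
      qed
      then have "(\<integral>\<^sup>+ t. ?F (t(i := y)) \<partial>lborel_on ?J) =
          (\<integral>\<^sup>+ t. ennreal (h y) * ennreal ((\<Prod>j\<in>?J. pow_dens a (t j)) * pow_dens a ((1 - y) - (\<Sum>j\<in>?J. t j))) \<partial>lborel_on ?J)"
        by simp
      also have "\<dots> = ennreal (h y) * ennreal (K * pow_dens (real (card I) * a) (1 - y))"
        unfolding K(2)[symmetric]
      proof (rule nn_integral_cmult)
        have [measurable]: "finite ?J" using J by simp
        show "(\<lambda>t. ennreal ((\<Prod>j\<in>?J. pow_dens a (t j)) * pow_dens a ((1 - y) - (\<Sum>j\<in>?J. t j)))) \<in> borel_measurable (lborel_on ?J)"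
          by measurable
      qed
      also have "\<dots> = ennreal K * ennreal (h y * pow_dens (real (card I) * a) (1 - y))"
        using h K(1) by (simp add: mult_ac flip: ennreal_mult')
      finally show "(\<integral>\<^sup>+ t. ?F (t(i := y)) \<partial>lborel_on ?J) =
         ennreal K * ennreal (h y * pow_dens (real (card I) * a) (1 - y))" .
    qed
    also have "\<dots> = ennreal K * (\<integral>\<^sup>+ y. ennreal (h y * pow_dens (real (card I) * a) (1 - y)) \<partial>lborel)"
      by (intro nn_integral_cmult) measurable
    finally show "(\<integral>\<^sup>+ t. ?F t \<partial>lborel_on I) = ennreal K * (\<integral>\<^sup>+ y. ennreal (h y * pow_dens (real (card I) * a) (1 - y)) \<partial>lborel)" .
  qed
qed

text \<open>The cell lies between the open and the closed interval with ends l/n and (l+1)/n; l < m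
  keeps the cut at m/n from shortening it.\<close>

lemma emeasure_floor_cell:
  fixes n l m :: nat
  assumes n: "n \<ge> 1" and l: "l < m"
  shows "emeasure lborel {x. 0 < x \<and> x < real m / real n \<and> nat \<lfloor>real n * x\<rfloor> = l} = ennreal (1 / real n)"
proof (rule antisym)
  let ?A = "{x. 0 < x \<and> x < real m / real n \<and> nat \<lfloor>real n * x\<rfloor> = l}"
  have [measurable]: "?A \<in> sets borel" by measurable
  have len: "(real l + 1) / real n - real l / real n = 1 / real n" by (simp add: diff_divide_distrib[symmetric])
  have "?A \<subseteq> {real l / real n .. (real l + 1) / real n}"
  proof
    fix x assume x: "x \<in> ?A"
    then have "\<lfloor>real n * x\<rfloor> = int l" using n by auto
    then have "real l \<le> real n * x" "real n * x \<le> real l + 1" by linarith+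
    then show "x \<in> {real l / real n .. (real l + 1) / real n}"
      using n by (simp add: field_simps)
  qed
  then have "emeasure lborel ?A \<le> emeasure lborel {real l / real n .. (real l + 1) / real n}"
    by (intro emeasure_mono) auto
  also have "\<dots> = ennreal (1 / real n)"
    using len by (subst emeasure_lborel_Icc) (auto simp: divide_right_mono)
  finally show "emeasure lborel ?A \<le> ennreal (1 / real n)" .
  have "{real l / real n <..< (real l + 1) / real n} \<subseteq> ?A"
  proof
    fix x assume x: "x \<in> {real l / real n <..< (real l + 1) / real n}"
    then have 1: "real l < real n * x" "real n * x < real l + 1" using n by (auto simp: field_simps)
    then have "\<lfloor>real n * x\<rfloor> = int l" by linarith
    moreover have "0 < x" using x by (auto intro: order.strict_trans1[of 0 "real l / real n"])
    moreover have "x < real m / real n"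
    proof -
      have "real n * x < real m" using 1 l by linarith
      then show ?thesis using n by (simp add: field_simps)
    qed
    ultimately show "x \<in> ?A" by simp
  qed
  then have "emeasure lborel {real l / real n <..< (real l + 1) / real n} \<le> emeasure lborel ?A"
    by (intro emeasure_mono) auto
  moreover have "emeasure lborel {real l / real n <..< (real l + 1) / real n} = ennreal (1 / real n)"
    using len by (subst emeasure_lborel_Ioo) (auto simp: divide_right_mono)
  ultimately show "ennreal (1 / real n) \<le> emeasure lborel ?A" by simp
qed

text \<open>Writing a sum over lattice points as the integral of a step function turns its
  comparison with an integral into a pointwise comparison of integrands.\<close>

lemma nn_integral_step_function:
  fixes \<phi> :: "('i \<Rightarrow> nat) \<Rightarrow> real" and m :: "'i \<Rightarrow> nat"
  assumes I: "finite I" and n: "n \<ge> 1"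
  shows "(\<integral>\<^sup>+ t. ennreal (\<phi> (\<lambda>i\<in>I. nat \<lfloor>real n * t i\<rfloor>)) * indicator (\<Pi>\<^sub>E i\<in>I. {0<..<real (m i) / real n}) t \<partial>lborel_on I) =
    (\<Sum>e\<in>(\<Pi>\<^sub>E i\<in>I. {..<m i}). ennreal (\<phi> e) * ennreal ((1 / real n) ^ card I))"
proof -
  let ?R = "\<Pi>\<^sub>E i\<in>I. {0<..<real (m i) / real n}"
  let ?e = "\<lambda>t. \<lambda>i\<in>I. nat \<lfloor>real n * t i\<rfloor>"
  let ?E = "\<Pi>\<^sub>E i\<in>I. {..<m i}"
  let ?cell = "\<lambda>e. \<Pi>\<^sub>E i\<in>I. {x. 0 < x \<and> x < real (m i) / real n \<and> nat \<lfloor>real n * x\<rfloor> = e i}"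
  have finE: "finite ?E" using I by (intro finite_PiE) auto
  have cell_sets: "?cell e \<in> sets (lborel_on I)" for e
    using I by (intro sets_PiM_I_finite) auto
  have "(\<integral>\<^sup>+ t. ennreal (\<phi> (?e t)) * indicator ?R t \<partial>lborel_on I) =
      (\<integral>\<^sup>+ t. (\<Sum>e\<in>?E. ennreal (\<phi> e) * indicator (?cell e) t) \<partial>lborel_on I)"
  proof (intro nn_integral_cong)
    fix t assume "t \<in> space (Pi\<^sub>M I (\<lambda>_. lborel :: real measure))"
    then have t: "t \<in> extensional I" by (simp add: space_PiM PiE_iff)
    show "ennreal (\<phi> (?e t)) * indicator ?R t = (\<Sum>e\<in>?E. ennreal (\<phi> e) * indicator (?cell e) t)"
    proof (cases "t \<in> ?R")
      case True
      define et where "et = ?e t"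
      have e: "et \<in> ?E"
        unfolding et_def
      proof (rule PiE_I)
        fix i assume i: "i \<in> I"
        then have "0 < t i" "t i < real (m i) / real n" using True by auto
        then have "0 < real n * t i" "real n * t i < real (m i)" using n by (auto simp: field_simps)
        then have "nat \<lfloor>real n * t i\<rfloor> < m i" by linarith
        then show "?e t i \<in> {..<m i}" using i by simp
      qed auto
      have ind: "indicator (?cell e) t = (if e = et then 1 else 0 :: ennreal)" if e: "e \<in> ?E" for e
      proof -
        have "t \<in> ?cell e \<longleftrightarrow> (\<forall>i\<in>I. nat \<lfloor>real n * t i\<rfloor> = e i)"
          using True t by (auto simp: PiE_iff)
        also have "\<dots> \<longleftrightarrow> e = et"
          using e by (auto simp: et_def fun_eq_iff PiE_iff extensional_def)
        finally show ?thesis by (simp add: indicator_def)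
      qed
      have "(\<Sum>e\<in>?E. ennreal (\<phi> e) * indicator (?cell e) t) = (\<Sum>e\<in>?E. if e = et then ennreal (\<phi> e) else 0)"
        by (intro sum.cong refl) (simp add: ind)
      also have "\<dots> = ennreal (\<phi> et)" using e finE by (subst sum.delta) auto
      finally show ?thesis using True by (simp add: et_def)
    next
      case False
      then have "t \<notin> ?cell e" for e using t by (auto simp: PiE_iff)
      then show ?thesis using False by simp
    qed
  qed
  also have "\<dots> = (\<Sum>e\<in>?E. \<integral>\<^sup>+ t. ennreal (\<phi> e) * indicator (?cell e) t \<partial>lborel_on I)"
    by (rule nn_integral_sum) (use cell_sets in measurable)
  also have "\<dots> = (\<Sum>e\<in>?E. ennreal (\<phi> e) * ennreal ((1 / real n) ^ card I))"
  proof (intro sum.cong refl)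
    fix e assume e: "e \<in> ?E"
    have "(\<integral>\<^sup>+ t. ennreal (\<phi> e) * indicator (?cell e) t \<partial>lborel_on I) = ennreal (\<phi> e) * emeasure (lborel_on I) (?cell e)"
      by (rule nn_integral_cmult_indicator[OF cell_sets])
    also have "emeasure (lborel_on I) (?cell e) = (\<Prod>i\<in>I. emeasure lborel {x. 0 < x \<and> x < real (m i) / real n \<and> nat \<lfloor>real n * x\<rfloor> = e i})"
      using I by (intro lborel_PiM.emeasure_PiM) auto
    also have "\<dots> = (\<Prod>i\<in>I. ennreal (1 / real n))"
      using e n by (intro prod.cong refl emeasure_floor_cell) auto
    also have "\<dots> = ennreal ((1 / real n) ^ card I)"
      by (simp only: prod_constant) (simp add: ennreal_power)
    finally show "(\<integral>\<^sup>+ t. ennreal (\<phi> e) * indicator (?cell e) t \<partial>lborel_on I) = ennreal (\<phi> e) * ennreal ((1 / real n) ^ card I)" .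
  qed
  finally show ?thesis .
qed

lemma nn_integral_PiM_coordinate_le:
  fixes I :: "'i set"
  assumes I: "finite I" and a: "a > 0"
  obtains K where "K \<ge> 0"
    "\<And>i h B. i \<in> I \<Longrightarrow> h \<in> borel_measurable borel \<Longrightarrow> (\<And>y. h y \<ge> 0) \<Longrightarrow> B \<ge> 0 \<Longrightarrow>
      (\<integral>\<^sup>+ y. ennreal (h y * pow_dens (real (card I) * a) (1 - y)) \<partial>lborel) \<le> ennreal B \<Longrightarrow>
      (\<integral>\<^sup>+ t. ennreal (h (t i) * ((\<Prod>j\<in>I - {i}. pow_dens a (t j)) * pow_dens a (1 - (\<Sum>j\<in>I. t j)))) \<partial>lborel_on I) \<le> ennreal (K * B)"
proof -
  have "\<forall>i\<in>I. \<exists>K\<ge>0. \<forall>h \<in> borel_measurable borel. (\<forall>y. h y \<ge> 0) \<longrightarrow>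
    (\<integral>\<^sup>+ t. ennreal (h (t i) * ((\<Prod>j\<in>I - {i}. pow_dens a (t j)) * pow_dens a (1 - (\<Sum>j\<in>I. t j)))) \<partial>lborel_on I) =
    ennreal K * (\<integral>\<^sup>+ y. ennreal (h y * pow_dens (real (card I) * a) (1 - y)) \<partial>lborel)"
    using nn_integral_PiM_coordinate[OF I _ a] by blast
  then obtain K where K: "\<And>i. i \<in> I \<Longrightarrow> K i \<ge> 0" "\<And>i h. i \<in> I \<Longrightarrow> h \<in> borel_measurable borel \<Longrightarrow> (\<forall>y. h y \<ge> 0) \<Longrightarrow>
    (\<integral>\<^sup>+ t. ennreal (h (t i) * ((\<Prod>j\<in>I - {i}. pow_dens a (t j)) * pow_dens a (1 - (\<Sum>j\<in>I. t j)))) \<partial>lborel_on I) =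
    ennreal (K i) * (\<integral>\<^sup>+ y. ennreal (h y * pow_dens (real (card I) * a) (1 - y)) \<partial>lborel)"
    by (elim bchoice[elim_format]) blast
  show ?thesis
  proof
    show "sum K I \<ge> 0" using K(1) by (intro sum_nonneg)
    fix i h B
    assume i: "i \<in> I" and h: "h \<in> borel_measurable borel" "\<And>y. h y \<ge> 0" and B: "B \<ge> (0::real)"
      and le: "(\<integral>\<^sup>+ y. ennreal (h y * pow_dens (real (card I) * a) (1 - y)) \<partial>lborel) \<le> ennreal B"
    have "(\<integral>\<^sup>+ t. ennreal (h (t i) * ((\<Prod>j\<in>I - {i}. pow_dens a (t j)) * pow_dens a (1 - (\<Sum>j\<in>I. t j)))) \<partial>lborel_on I) \<le>
        ennreal (K i) * ennreal B"
      using h le by (subst K(2)[OF i]) (auto intro!: mult_left_mono)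
    also have "\<dots> = ennreal (K i * B)" using K(1)[OF i] by (rule ennreal_mult'[symmetric])
    also have "\<dots> \<le> ennreal (sum K I * B)"
      using K(1) I i B by (intro ennreal_leI mult_right_mono member_le_sum) auto
    finally show "(\<integral>\<^sup>+ t. ennreal (h (t i) * ((\<Prod>j\<in>I - {i}. pow_dens a (t j)) * pow_dens a (1 - (\<Sum>j\<in>I. t j)))) \<partial>lborel_on I) \<le>
        ennreal (sum K I * B)" .
  qed
qed

section \<open>The Dirichlet density and its discretisation error\<close>

text \<open>\<open>I\<close> indexes the free coordinates; the last one is 1 minus their sum. The
  Dirichlet constant Gamma((card I + 1) a) / Gamma(a)^(card I + 1) has numerator Gamma(1) = 1 for a
  = 1 / (card I + 1).\<close>

definition dirichlet_dens :: "'i set \<Rightarrow> real \<Rightarrow> ('i \<Rightarrow> real) \<Rightarrow> real" where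
  "dirichlet_dens I a t = (\<Prod>i\<in>I. pow_dens a (t i)) * pow_dens a (1 - (\<Sum>i\<in>I. t i)) / Gamma a ^ (card I + 1)"

text \<open>These are the telescoping terms of \<open>abs_prod_diff_le\<close>, with a separate one
  for the dependent last coordinate. Only the error factor carries the scale n.\<close>

definition dirichlet_err :: "'i set \<Rightarrow> real \<Rightarrow> nat \<Rightarrow> ('i \<Rightarrow> real) \<Rightarrow> real" where
  "dirichlet_err I a n t =
     (\<Sum>j\<in>I. err_dens a (real n * t j) * ((\<Prod>i\<in>I - {j}. pow_dens a (t i)) * pow_dens a (1 - (\<Sum>i\<in>I. t i)))) +
     (\<Prod>i\<in>I. pow_dens a (t i)) * err_dens a (real n * (1 - (\<Sum>i\<in>I. t i)))"

lemma borel_measurable_dirichlet_dens [measurable]: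
  assumes [measurable]: "finite I"
  shows "dirichlet_dens I a \<in> borel_measurable (lborel_on I)"
  unfolding dirichlet_dens_def by measurable

lemma dirichlet_dens_nonneg: "a > 0 \<Longrightarrow> dirichlet_dens I a t \<ge> 0"
  unfolding dirichlet_dens_def
  by (intro divide_nonneg_nonneg mult_nonneg_nonneg prod_nonneg zero_le_power Gamma_real_nonneg) auto

text \<open>Each term reduces to the error density at scale n against
  \<open>pow_dens (1 - a)\<close> on the line, which is O(1/n): through the marginal for a free
  coordinate, through the law of the sum for the last one.\<close>

lemma nn_integral_dirichlet_err:
  assumes I: "finite I" "I \<noteq> {}" and a: "a = 1 / (real (card I) + 1)"
  obtains C where "C \<ge> 0" "\<And>n. n \<ge> 1 \<Longrightarrow>
    (\<integral>\<^sup>+ t. ennreal (dirichlet_err I a n t) \<partial>lborel_on I) \<le> ennreal (C / real n)"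
proof -
  have cI: "card I > 0" using I by (simp add: card_gt_0_iff)
  have a01: "0 < a" "a < 1" using cI by (auto simp: a)
  have ca: "real (card I) * a = 1 - a" by (simp add: a field_simps)
  obtain C1 where C1: "C1 \<ge> 0" "\<And>n :: nat. n \<ge> 1 \<Longrightarrow>
    (\<integral>\<^sup>+ y. ennreal (err_dens a (real n * y) * pow_dens (1 - a) (1 - y)) \<partial>lborel) \<le> ennreal (C1 / real n)"
    using nn_integral_err_dens_pow_dens[OF a01] by blast
  obtain K where K: "K \<ge> 0"
    "\<And>i h B. i \<in> I \<Longrightarrow> h \<in> borel_measurable borel \<Longrightarrow> (\<And>y. h y \<ge> 0) \<Longrightarrow> B \<ge> 0 \<Longrightarrow>
      (\<integral>\<^sup>+ y. ennreal (h y * pow_dens (1 - a) (1 - y)) \<partial>lborel) \<le> ennreal B \<Longrightarrow>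
      (\<integral>\<^sup>+ t. ennreal (h (t i) * ((\<Prod>j\<in>I - {i}. pow_dens a (t j)) * pow_dens a (1 - (\<Sum>j\<in>I. t j)))) \<partial>lborel_on I) \<le> ennreal (K * B)"
    using nn_integral_PiM_coordinate_le[OF I(1) a01(1)] unfolding ca by blast
  obtain K0 where K0: "K0 \<ge> 0" "\<And>s g. g \<in> borel_measurable borel \<Longrightarrow>
    (\<integral>\<^sup>+ t. ennreal (\<Prod>i\<in>I. pow_dens a (t i)) * g (s - (\<Sum>i\<in>I. t i)) \<partial>lborel_on I) =
    ennreal K0 * (\<integral>\<^sup>+ y. ennreal (pow_dens (1 - a) y) * g (s - y) \<partial>lborel)"
    using nn_integral_PiM_pow_dens[OF I a01(1)] unfolding ca by blast
  show ?thesis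
  proof
    show "(real (card I) * K + K0) * C1 \<ge> 0" using K(1) K0 C1 by simp
    fix n :: nat assume n: "n \<ge> 1"
    let ?X = "\<lambda>j t. err_dens a (real n * t j) * ((\<Prod>i\<in>I - {j}. pow_dens a (t i)) * pow_dens a (1 - (\<Sum>i\<in>I. t i)))"
    let ?Y = "\<lambda>t. (\<Prod>i\<in>I. pow_dens a (t i)) * err_dens a (real n * (1 - (\<Sum>i\<in>I. t i)))"
    have [measurable]: "finite I" by fact
    have X_meas: "?X j \<in> borel_measurable (lborel_on I)" if j: "j \<in> I" for j
      by (rule borel_measurable_PiM_coordinate[where h = "\<lambda>y. err_dens a (real n * y)", OF I(1) j]) measurable
    have Y_meas: "?Y \<in> borel_measurable (lborel_on I)" by measurable
    have nonneg: "?X j t \<ge> 0" "?Y t \<ge> 0" for j t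
      by (intro mult_nonneg_nonneg prod_nonneg; simp)+
    have X_int: "(\<integral>\<^sup>+ t. ennreal (?X j t) \<partial>lborel_on I) \<le> ennreal (K * (C1 / real n))" if j: "j \<in> I" for j
      using C1 n by (intro K(2)[OF j, where h = "\<lambda>y. err_dens a (real n * y)"]) auto
    have Y_int: "(\<integral>\<^sup>+ t. ennreal (?Y t) \<partial>lborel_on I) \<le> ennreal (K0 * (C1 / real n))"
    proof -
      have "(\<integral>\<^sup>+ t. ennreal (?Y t) \<partial>lborel_on I) =
          (\<integral>\<^sup>+ t. ennreal (\<Prod>i\<in>I. pow_dens a (t i)) * ennreal (err_dens a (real n * (1 - (\<Sum>i\<in>I. t i)))) \<partial>lborel_on I)"
        by (intro nn_integral_cong ennreal_mult' prod_nonneg) auto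
      also have "\<dots> = ennreal K0 * (\<integral>\<^sup>+ y. ennreal (pow_dens (1 - a) y) * ennreal (err_dens a (real n * (1 - y))) \<partial>lborel)"
        by (rule K0(2)[where g = "\<lambda>z. ennreal (err_dens a (real n * z))"]) measurable
      \<comment> \<open>The reflection y -> 1 - y brings the last coordinate into the same form as
        the free ones.\<close>
      also have "(\<integral>\<^sup>+ y. ennreal (pow_dens (1 - a) y) * ennreal (err_dens a (real n * (1 - y))) \<partial>lborel) =
          ennreal \<bar>-1\<bar> * (\<integral>\<^sup>+ y. ennreal (pow_dens (1 - a) (1 + (-1) * y)) * ennreal (err_dens a (real n * (1 - (1 + (-1) * y)))) \<partial>lborel)"
        by (intro nn_integral_real_affine) auto
      also have "\<dots> = (\<integral>\<^sup>+ y. ennreal (err_dens a (real n * y) * pow_dens (1 - a) (1 - y)) \<partial>lborel)"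
        by (auto intro!: nn_integral_cong simp: mult.commute simp flip: ennreal_mult')
      also have "ennreal K0 * \<dots> \<le> ennreal K0 * ennreal (C1 / real n)"
        by (intro mult_left_mono C1 n) auto
      also have "\<dots> = ennreal (K0 * (C1 / real n))"
        using K0(1) by (rule ennreal_mult'[symmetric])
      finally show ?thesis .
    qed
    have "(\<integral>\<^sup>+ t. ennreal (dirichlet_err I a n t) \<partial>lborel_on I) =
        (\<integral>\<^sup>+ t. (\<Sum>j\<in>I. ennreal (?X j t)) + ennreal (?Y t) \<partial>lborel_on I)"
    proof (intro nn_integral_cong)
      fix t
      show "ennreal (dirichlet_err I a n t) = (\<Sum>j\<in>I. ennreal (?X j t)) + ennreal (?Y t)"
        unfolding dirichlet_err_def using nonneg by (subst ennreal_plus) (auto intro!: sum_nonneg simp: sum_ennreal)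
    qed
    also have "\<dots> = (\<Sum>j\<in>I. \<integral>\<^sup>+ t. ennreal (?X j t) \<partial>lborel_on I) + (\<integral>\<^sup>+ t. ennreal (?Y t) \<partial>lborel_on I)"
      using X_meas Y_meas by (subst nn_integral_add) (auto intro!: borel_measurable_sum nn_integral_sum)
    also have "\<dots> \<le> (\<Sum>j\<in>I. ennreal (K * (C1 / real n))) + ennreal (K0 * (C1 / real n))"
      by (intro add_mono sum_mono X_int Y_int)
    also have "\<dots> = ennreal ((\<Sum>j\<in>I. K * (C1 / real n)) + K0 * (C1 / real n))"
      using K(1) K0(1) C1(1) by (subst sum_ennreal) (auto intro!: ennreal_plus[symmetric])
    also have "(\<Sum>j\<in>I. K * (C1 / real n)) + K0 * (C1 / real n) = (real (card I) * K + K0) * C1 / real n"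
      by (simp add: ring_distribs add_divide_distrib)
    finally show "(\<integral>\<^sup>+ t. ennreal (dirichlet_err I a n t) \<partial>lborel_on I) \<le> ennreal ((real (card I) * K + K0) * C1 / real n)" .
  qed
qed

section \<open>Dirichlet-multinomial sums as Riemann sums\<close>

lemma abs_mult_diff_le:
  fixes p q r s :: real
  assumes "r \<ge> 0" "q \<ge> 0"
  shows "\<bar>p * r - q * s\<bar> \<le> \<bar>p - q\<bar> * r + q * \<bar>r - s\<bar>"
proof -
  have "p * r - q * s = (p - q) * r + q * (r - s)" by (simp add: algebra_simps)
  then have "\<bar>p * r - q * s\<bar> \<le> \<bar>(p - q) * r\<bar> + \<bar>q * (r - s)\<bar>"
    by (simp only: abs_triangle_ineq)
  then show ?thesis using assms by (simp add: abs_mult)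
qed

text \<open>Counting powers of n: card I + 1 densities at scale n give n^((card I + 1)(a - 1)) =
  n^(-card I), which the factor n^(card I) cancels exactly. An error term has only card I such
  densities, and n^(1-a) is left over.\<close>

lemma dirichlet_step_pointwise:
  fixes I :: "'i set"
  assumes I: "finite I" "I \<noteq> {}" and a: "a = 1 / (real (card I) + 1)"
  obtains K where "K \<ge> 0"
    "\<And>n t. n \<ge> 1 \<Longrightarrow> (\<And>i. i \<in> I \<Longrightarrow> 0 < t i) \<Longrightarrow> (\<Sum>i\<in>I. t i) < 1 \<Longrightarrow>
      \<bar>real n ^ card I * ((\<Prod>i\<in>I. nb_coeff a (nat \<lfloor>real n * t i\<rfloor>)) * nb_coeff a (n - (\<Sum>i\<in>I. nat \<lfloor>real n * t i\<rfloor>)))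
        - dirichlet_dens I a t\<bar> \<le> K * real n powr (1 - a) * dirichlet_err I a n t"
proof -
  have cI: "card I > 0" using I by (simp add: card_gt_0_iff)
  have a01: "0 < a" "a \<le> 1" using cI by (auto simp: a)
  have ka: "(real (card I) + 1) * a = 1" using a by simp
  obtain K where K: "K \<ge> 1"
    "\<And>x d. 0 < x \<Longrightarrow> x \<le> real d + 1 \<Longrightarrow> real d + 1 \<le> x + real (card I + 1) \<Longrightarrow>
       \<bar>nb_coeff a d - pow_dens a x / Gamma a\<bar> \<le> K * err_dens a x"
    "\<And>x d. 0 < x \<Longrightarrow> x \<le> real d + 1 \<Longrightarrow> nb_coeff a d \<le> K * pow_dens a x"
    "1 / Gamma a \<le> K"
    using nb_coeff_pow_dens[OF a01, of "card I + 1"] by auto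
  have G: "Gamma a > 0" using a01 by (intro Gamma_real_pos)
  have cK: "pow_dens a x / Gamma a \<le> K * pow_dens a x" for x
    using mult_right_mono[OF K(4) pow_dens_nonneg[of a x]] by simp
  show ?thesis
  proof
    show "K ^ (card I + 1) \<ge> 0" using K by simp
    fix n :: nat and t :: "'i \<Rightarrow> real"
    assume n: "n \<ge> 1" and t: "\<And>i. i \<in> I \<Longrightarrow> 0 < t i" and sum: "(\<Sum>i\<in>I. t i) < 1"
    let ?s = "1 - (\<Sum>i\<in>I. t i)" and ?d = "\<lambda>i. nat \<lfloor>real n * t i\<rfloor>" and ?dz = "n - (\<Sum>i\<in>I. nat \<lfloor>real n * t i\<rfloor>)"
    let ?N = "real n powr (a - 1)"
    have npos: "real n > 0" using n by simp
    have x: "0 < real n * t i" "real n * t i \<le> real (?d i) + 1" "real (?d i) \<le> real n * t i" if "i \<in> I" for i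
    proof -
      show pos: "0 < real n * t i" using t[OF that] npos by simp
      have "real (nat \<lfloor>real n * t i\<rfloor>) = of_int \<lfloor>real n * t i\<rfloor>" using pos by (intro of_nat_nat) auto
      then show "real n * t i \<le> real (?d i) + 1" "real (?d i) \<le> real n * t i" by linarith+
    qed
    have sumd: "(\<Sum>i\<in>I. real (?d i)) \<le> real n * (\<Sum>i\<in>I. t i)"
      unfolding sum_distrib_left by (intro sum_mono x)
    have sumd': "real n * (\<Sum>i\<in>I. t i) \<le> (\<Sum>i\<in>I. real (?d i)) + real (card I)"
    proof -
      have "real n * (\<Sum>i\<in>I. t i) \<le> (\<Sum>i\<in>I. real (?d i) + 1)"
        unfolding sum_distrib_left by (intro sum_mono x)
      then show ?thesis by (simp add: sum.distrib)
    qed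
    have "real n * (\<Sum>i\<in>I. t i) \<le> real n * 1" using sum npos by (intro mult_left_mono) auto
    then have "(\<Sum>i\<in>I. ?d i) \<le> n" using sumd by (simp flip: of_nat_sum)
    then have d0: "real ?dz = real n - (\<Sum>i\<in>I. real (?d i))" by (simp add: of_nat_diff)
    \<comment> \<open>Each floor loses less than 1, so the last index lies between n s and n s +
      card I, where s is the last coordinate. Hence \<open>nb_coeff_pow_dens\<close> was taken with
      distance card I + 1.\<close>
    have x0: "0 < real n * ?s" "real n * ?s \<le> real ?dz + 1" "real ?dz + 1 \<le> real n * ?s + real (card I + 1)"
    proof -
      show "0 < real n * ?s" using npos sum by simp
      have "real n * ?s = real n - real n * (\<Sum>i\<in>I. t i)" by (simp add: algebra_simps)
      then show "real n * ?s \<le> real ?dz + 1" "real ?dz + 1 \<le> real n * ?s + real (card I + 1)"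
        using sumd sumd' unfolding d0 by simp_all
    qed
    let ?b = "\<lambda>i. nb_coeff a (?d i)" and ?c = "\<lambda>i. pow_dens a (real n * t i) / Gamma a"
    let ?e = "\<lambda>i. err_dens a (real n * t i)" and ?f = "\<lambda>i. pow_dens a (real n * t i)"
    let ?bz = "nb_coeff a ?dz" and ?cz = "pow_dens a (real n * ?s) / Gamma a"
    let ?S = "\<Sum>j\<in>I. ?e j * (\<Prod>i\<in>I - {j}. ?f i)"
    have D: "\<bar>(\<Prod>i\<in>I. ?b i) - (\<Prod>i\<in>I. ?c i)\<bar> \<le> K ^ card I * ?S"
    proof (rule abs_prod_diff_le)
      fix i assume i: "i \<in> I"
      show "\<bar>?b i - ?c i\<bar> \<le> K * ?e i"
        using x[OF i] by (intro K(2)) (auto simp: add_increasing2)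
      show "?b i \<le> K * ?f i" using x[OF i] by (intro K(3)) auto
    qed (use I K G a01 cK in \<open>auto intro!: nb_coeff_nonneg\<close>)
    have cprod: "(\<Prod>i\<in>I. ?c i) \<le> K ^ card I * (\<Prod>i\<in>I. ?f i)" "0 \<le> (\<Prod>i\<in>I. ?c i)"
    proof -
      have "(\<Prod>i\<in>I. ?c i) \<le> (\<Prod>i\<in>I. K * ?f i)"
        using G cK by (intro prod_mono) auto
      then show "(\<Prod>i\<in>I. ?c i) \<le> K ^ card I * (\<Prod>i\<in>I. ?f i)" by (simp add: prod.distrib)
      show "0 \<le> (\<Prod>i\<in>I. ?c i)" using G by (intro prod_nonneg) auto
    qed
    have b0: "0 \<le> ?bz" "?bz \<le> K * pow_dens a (real n * ?s)"
      using x0 a01 by (auto intro!: nb_coeff_nonneg K(3))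
    have S0: "?S \<ge> 0" by (intro sum_nonneg mult_nonneg_nonneg prod_nonneg) auto
    have F0: "(\<Prod>i\<in>I. ?f i) \<ge> 0" by (intro prod_nonneg) auto
    have "\<bar>(\<Prod>i\<in>I. ?b i) * ?bz - (\<Prod>i\<in>I. ?c i) * ?cz\<bar> \<le>
        \<bar>(\<Prod>i\<in>I. ?b i) - (\<Prod>i\<in>I. ?c i)\<bar> * ?bz + (\<Prod>i\<in>I. ?c i) * \<bar>?bz - ?cz\<bar>"
      by (rule abs_mult_diff_le[OF b0(1) cprod(2)])
    also have "\<dots> \<le> (K ^ card I * ?S) * (K * pow_dens a (real n * ?s)) +
        (K ^ card I * (\<Prod>i\<in>I. ?f i)) * (K * err_dens a (real n * ?s))"
      using K(1) b0 S0 F0 by (intro add_mono mult_mono D cprod K(2)[OF x0]) (auto intro!: mult_nonneg_nonneg zero_le_power)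
    also have "\<dots> = K ^ (card I + 1) * (?S * pow_dens a (real n * ?s) + (\<Prod>i\<in>I. ?f i) * err_dens a (real n * ?s))"
      by (simp add: algebra_simps)
    also have "?S * pow_dens a (real n * ?s) + (\<Prod>i\<in>I. ?f i) * err_dens a (real n * ?s) = ?N ^ card I * dirichlet_err I a n t"
    proof -
      have "?S * pow_dens a (real n * ?s) =
          (\<Sum>j\<in>I. ?N ^ card I * (?e j * ((\<Prod>i\<in>I - {j}. pow_dens a (t i)) * pow_dens a ?s)))"
        unfolding sum_distrib_right
      proof (intro sum.cong refl)
        fix j assume j: "j \<in> I"
        have "(\<Prod>i\<in>I - {j}. ?f i) = ?N ^ (card I - 1) * (\<Prod>i\<in>I - {j}. pow_dens a (t i))"
          using j I by (simp add: pow_dens_mult[OF npos] prod.distrib)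
        moreover have "?N ^ card I = ?N ^ (card I - 1) * ?N"
          using cI by (metis Suc_diff_1 power_Suc2)
        ultimately show "?e j * (\<Prod>i\<in>I - {j}. ?f i) * pow_dens a (real n * ?s) =
            ?N ^ card I * (?e j * ((\<Prod>i\<in>I - {j}. pow_dens a (t i)) * pow_dens a ?s))"
          unfolding pow_dens_mult[OF npos, of a ?s] by (simp only: mult_ac)
      qed
      moreover have "(\<Prod>i\<in>I. ?f i) = ?N ^ card I * (\<Prod>i\<in>I. pow_dens a (t i))"
        by (simp add: pow_dens_mult[OF npos] prod.distrib)
      ultimately show ?thesis
        unfolding dirichlet_err_def by (simp add: sum_distrib_left distrib_left mult.assoc)
    qed
    finally have main: "\<bar>(\<Prod>i\<in>I. ?b i) * ?bz - (\<Prod>i\<in>I. ?c i) * ?cz\<bar> \<le> K ^ (card I + 1) * (?N ^ card I * dirichlet_err I a n t)" .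
    have pow: "real n ^ card I * ?N ^ card I = real n powr (1 - a)"
    proof -
      have "real n * ?N = real n powr a" using npos by (simp add: powr_diff)
      then have "real n ^ card I * ?N ^ card I = (real n powr a) ^ card I" by (simp flip: power_mult_distrib)
      also have "\<dots> = real n powr (real (card I) * a)" using npos by (simp add: powr_power mult.commute)
      also have "real (card I) * a = 1 - a" using ka by (simp add: algebra_simps)
      finally show ?thesis .
    qed
    have dens: "real n ^ card I * ((\<Prod>i\<in>I. ?c i) * ?cz) = dirichlet_dens I a t"
    proof -
      have c: "(\<Prod>i\<in>I. ?c i) = ?N ^ card I * (\<Prod>i\<in>I. pow_dens a (t i)) / Gamma a ^ card I"
        by (simp add: pow_dens_mult[OF npos] prod.distrib prod_dividef)
      have cz: "?cz = ?N * pow_dens a ?s / Gamma a"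
        unfolding pow_dens_mult[OF npos, of a ?s] ..
      have "real n ^ card I * ((\<Prod>i\<in>I. ?c i) * ?cz) = (real n ^ card I * ?N ^ card I * ?N) * dirichlet_dens I a t"
        unfolding dirichlet_dens_def c cz by (simp add: mult_ac)
      also have "real n ^ card I * ?N ^ card I * ?N = 1"
        unfolding pow using npos by (simp flip: powr_add)
      finally show ?thesis by simp
    qed
    have "\<bar>real n ^ card I * ((\<Prod>i\<in>I. ?b i) * ?bz) - dirichlet_dens I a t\<bar> =
        real n ^ card I * \<bar>(\<Prod>i\<in>I. ?b i) * ?bz - (\<Prod>i\<in>I. ?c i) * ?cz\<bar>"
      unfolding dens[symmetric] right_diff_distrib[symmetric] by (simp add: abs_mult)
    also have "\<dots> \<le> real n ^ card I * (K ^ (card I + 1) * (?N ^ card I * dirichlet_err I a n t))"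
      using main by (intro mult_left_mono) auto
    also have "\<dots> = K ^ (card I + 1) * (real n ^ card I * ?N ^ card I) * dirichlet_err I a n t"
      by (simp add: mult_ac)
    also have "real n ^ card I * ?N ^ card I = real n powr (1 - a)" by (rule pow)
    finally show "\<bar>real n ^ card I * ((\<Prod>i\<in>I. ?b i) * ?bz) - dirichlet_dens I a t\<bar> \<le> K ^ (card I + 1) * real n powr (1 - a) * dirichlet_err I a n t" .
  qed
qed

lemma dirichlet_err_nonneg: "dirichlet_err I a n t \<ge> 0"
  unfolding dirichlet_err_def by (intro add_nonneg_nonneg sum_nonneg mult_nonneg_nonneg prod_nonneg) auto

lemma borel_measurable_dirichlet_err:
  assumes I: "finite I"
  shows "dirichlet_err I a n \<in> borel_measurable (lborel_on I)"
proof -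
  have [measurable]: "finite I" by fact
  have "(\<lambda>t. (\<Prod>i\<in>I. pow_dens a (t i)) * err_dens a (real n * (1 - (\<Sum>i\<in>I. t i)))) \<in> borel_measurable (lborel_on I)"
    by measurable
  then show ?thesis
    unfolding dirichlet_err_def
    by (intro borel_measurable_add borel_measurable_sum
        borel_measurable_PiM_coordinate[where h = "\<lambda>y. err_dens a (real n * y)", OF I]) auto
qed

text \<open>With strict bounds the cells of side 1/n fill the box with sides m i / n up to null
  sets. When the m i add up to at most n, this box lies in the simplex and the truncated subtraction
  is exact.\<close>

definition dirichlet_box_sum :: "'i set \<Rightarrow> real \<Rightarrow> nat \<Rightarrow> ('i \<Rightarrow> nat) \<Rightarrow> real" where
  "dirichlet_box_sum I a n m =
     (\<Sum>e\<in>(\<Pi>\<^sub>E i\<in>I. {..<m i}). (\<Prod>i\<in>I. nb_coeff a (e i)) * nb_coeff a (n - (\<Sum>i\<in>I. e i)))"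

definition dirichlet_box :: "'i set \<Rightarrow> real \<Rightarrow> nat \<Rightarrow> ('i \<Rightarrow> nat) \<Rightarrow> ennreal" where
  "dirichlet_box I a n m =
     (\<integral>\<^sup>+ t. ennreal (dirichlet_dens I a t) * indicator (\<Pi>\<^sub>E i\<in>I. {0<..<real (m i) / real n}) t \<partial>lborel_on I)"

text \<open>The pointwise factor n^(1-a) meets an error integral O(1/n), which gives n^(-a). Two
  one-sided bounds take the place of an absolute value because \<open>dirichlet_box\<close> is an
  \<open>ennreal\<close> whose finiteness is not yet established.\<close>

lemma dirichlet_riemann_sum:
  fixes I :: "'i set"
  assumes I: "finite I" "I \<noteq> {}" and a: "a = 1 / (real (card I) + 1)"
  obtains C where "C \<ge> 0"
    "\<And>n m. n \<ge> 1 \<Longrightarrow> (\<Sum>i\<in>I. m i) \<le> n \<Longrightarrow>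
      ennreal (dirichlet_box_sum I a n m) \<le> dirichlet_box I a n m + ennreal (C * real n powr - a) \<and>
      dirichlet_box I a n m \<le> ennreal (dirichlet_box_sum I a n m) + ennreal (C * real n powr - a)"
proof -
  have cI: "card I > 0" using I by (simp add: card_gt_0_iff)
  have a01: "0 < a" "a \<le> 1" using cI by (auto simp: a)
  obtain K where K: "K \<ge> 0"
    "\<And>n t. n \<ge> 1 \<Longrightarrow> (\<And>i. i \<in> I \<Longrightarrow> 0 < t i) \<Longrightarrow> (\<Sum>i\<in>I. t i) < 1 \<Longrightarrow>
      \<bar>real n ^ card I * ((\<Prod>i\<in>I. nb_coeff a (nat \<lfloor>real n * t i\<rfloor>)) * nb_coeff a (n - (\<Sum>i\<in>I. nat \<lfloor>real n * t i\<rfloor>)))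
        - dirichlet_dens I a t\<bar> \<le> K * real n powr (1 - a) * dirichlet_err I a n t"
    using dirichlet_step_pointwise[OF I a] by blast
  obtain B where B: "B \<ge> 0" "\<And>n. n \<ge> 1 \<Longrightarrow>
    (\<integral>\<^sup>+ t. ennreal (dirichlet_err I a n t) \<partial>lborel_on I) \<le> ennreal (B / real n)"
    using nn_integral_dirichlet_err[OF I a] by blast
  show ?thesis
  proof
    show "K * B \<ge> 0" using K B by simp
    fix n :: nat and m :: "'i \<Rightarrow> nat" assume n: "n \<ge> 1" and m: "(\<Sum>i\<in>I. m i) \<le> n"
    let ?M = "lborel_on I"
    let ?R = "\<Pi>\<^sub>E i\<in>I. {0<..<real (m i) / real n}"
    let ?e = "\<lambda>t. \<lambda>i\<in>I. nat \<lfloor>real n * t i\<rfloor>"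
    define w where "w e = (\<Prod>i\<in>I. nb_coeff a (e i)) * nb_coeff a (n - (\<Sum>i\<in>I. e i))" for e :: "'i \<Rightarrow> nat"
    define \<phi> where "\<phi> e = real n ^ card I * w e" for e
    let ?err = "\<lambda>t. K * real n powr (1 - a) * dirichlet_err I a n t"
    have w0: "w e \<ge> 0" for e
      unfolding w_def using a01 by (intro mult_nonneg_nonneg prod_nonneg nb_coeff_nonneg) auto
    have R_sets [measurable]: "?R \<in> sets ?M" using I by (intro sets_PiM_I_finite) auto
    have [measurable]: "dirichlet_dens I a \<in> borel_measurable ?M" using I by (intro borel_measurable_dirichlet_dens)
    have [measurable]: "dirichlet_err I a n \<in> borel_measurable ?M" using I by (intro borel_measurable_dirichlet_err)
    have pw: "\<bar>\<phi> (?e t) - dirichlet_dens I a t\<bar> \<le> ?err t" if t: "t \<in> ?R" for t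
    proof -
      have pos: "0 < t i" "t i < real (m i) / real n" if "i \<in> I" for i using t that by auto
      have "(\<Sum>i\<in>I. t i) < (\<Sum>i\<in>I. real (m i) / real n)"
        using I pos by (intro sum_strict_mono) auto
      also have "\<dots> = real (\<Sum>i\<in>I. m i) / real n" by (simp add: sum_divide_distrib)
      also have "\<dots> \<le> 1" using m n by (simp add: divide_le_eq_1 del: of_nat_sum)
      finally have lt: "(\<Sum>i\<in>I. t i) < 1" .
      have "\<phi> (?e t) = real n ^ card I * ((\<Prod>i\<in>I. nb_coeff a (nat \<lfloor>real n * t i\<rfloor>)) * nb_coeff a (n - (\<Sum>i\<in>I. nat \<lfloor>real n * t i\<rfloor>)))"
        unfolding \<phi>_def w_def by simp
      then show ?thesis using K(2)[OF n pos(1) lt] by simp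
    qed
    have step: "(\<integral>\<^sup>+ t. ennreal (\<phi> (?e t)) * indicator ?R t \<partial>?M) = ennreal (\<Sum>e\<in>(\<Pi>\<^sub>E i\<in>I. {..<m i}). w e)"
    proof -
      have "(\<integral>\<^sup>+ t. ennreal (\<phi> (?e t)) * indicator ?R t \<partial>?M) = (\<Sum>e\<in>(\<Pi>\<^sub>E i\<in>I. {..<m i}). ennreal (\<phi> e) * ennreal ((1 / real n) ^ card I))"
        by (rule nn_integral_step_function[OF I(1) n])
      also have "\<dots> = (\<Sum>e\<in>(\<Pi>\<^sub>E i\<in>I. {..<m i}). ennreal (w e))"
      proof (intro sum.cong refl)
        fix e
        have "ennreal (\<phi> e) * ennreal ((1 / real n) ^ card I) = ennreal (\<phi> e * (1 / real n) ^ card I)"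
          by (rule ennreal_mult''[symmetric]) simp
        also have "\<phi> e * (1 / real n) ^ card I = w e"
          using n by (simp add: \<phi>_def power_divide)
        finally show "ennreal (\<phi> e) * ennreal ((1 / real n) ^ card I) = ennreal (w e)" .
      qed
      also have "\<dots> = ennreal (\<Sum>e\<in>(\<Pi>\<^sub>E i\<in>I. {..<m i}). w e)" using w0 by (intro sum_ennreal) auto
      finally show ?thesis .
    qed
    have err: "(\<integral>\<^sup>+ t. ennreal (?err t) \<partial>?M) \<le> ennreal (K * B * real n powr - a)"
    proof -
      have "(\<integral>\<^sup>+ t. ennreal (?err t) \<partial>?M) = (\<integral>\<^sup>+ t. ennreal (K * real n powr (1 - a)) * ennreal (dirichlet_err I a n t) \<partial>?M)"
        using K by (intro nn_integral_cong ennreal_mult') auto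
      also have "\<dots> = ennreal (K * real n powr (1 - a)) * (\<integral>\<^sup>+ t. ennreal (dirichlet_err I a n t) \<partial>?M)"
        by (intro nn_integral_cmult) measurable
      also have "\<dots> \<le> ennreal (K * real n powr (1 - a)) * ennreal (B / real n)"
        by (intro mult_left_mono B n) auto
      also have "\<dots> = ennreal (K * real n powr (1 - a) * (B / real n))"
        using K by (intro ennreal_mult'[symmetric]) auto
      also have "K * real n powr (1 - a) * (B / real n) = K * B * real n powr - a"
        using n powr_diff[of "real n" "1 - a" 1] by simp
      finally show ?thesis .
    qed
    have \<phi>0: "\<phi> e \<ge> 0" for e using w0 by (simp add: \<phi>_def)
    have d0: "dirichlet_dens I a t \<ge> 0" for t using a01 by (intro dirichlet_dens_nonneg)
    have e0: "?err t \<ge> 0" for t using K by (intro mult_nonneg_nonneg dirichlet_err_nonneg) auto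
    have "(\<integral>\<^sup>+ t. ennreal (\<phi> (?e t)) * indicator ?R t \<partial>?M) \<le> (\<integral>\<^sup>+ t. ennreal (dirichlet_dens I a t) * indicator ?R t + ennreal (?err t) \<partial>?M)"
    proof (intro nn_integral_mono)
      fix t
      show "ennreal (\<phi> (?e t)) * indicator ?R t \<le> ennreal (dirichlet_dens I a t) * indicator ?R t + ennreal (?err t)"
      proof (cases "t \<in> ?R")
        case True
        have "ennreal (\<phi> (?e t)) \<le> ennreal (dirichlet_dens I a t + ?err t)"
          using pw[OF True] by (intro ennreal_leI) linarith
        then show ?thesis using True d0 e0 by (simp add: ennreal_plus)
      qed simp
    qed
    also have "\<dots> = (\<integral>\<^sup>+ t. ennreal (dirichlet_dens I a t) * indicator ?R t \<partial>?M) + (\<integral>\<^sup>+ t. ennreal (?err t) \<partial>?M)"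
      by (intro nn_integral_add) measurable
    also have "\<dots> \<le> (\<integral>\<^sup>+ t. ennreal (dirichlet_dens I a t) * indicator ?R t \<partial>?M) + ennreal (K * B * real n powr - a)"
      by (intro add_mono err order_refl)
    finally have 1: "ennreal (\<Sum>e\<in>(\<Pi>\<^sub>E i\<in>I. {..<m i}). w e) \<le> \<dots>" unfolding step .
    have \<phi>_meas: "(\<lambda>t. ennreal (\<phi> (?e t)) * indicator ?R t) \<in> borel_measurable ?M"
    proof -
      have [measurable]: "finite I" by fact
      have comp: "(\<lambda>t. nat \<lfloor>real n * t i\<rfloor>) \<in> measurable ?M (count_space UNIV)" if "i \<in> I" for i
      proof -
        have "(\<lambda>x. nat \<lfloor>real n * x\<rfloor>) \<in> measurable borel (count_space UNIV)" by measurable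
        moreover have "(\<lambda>t. t i) \<in> borel_measurable ?M"
          using measurable_component_singleton[OF that, of "\<lambda>_. lborel"] by simp
        ultimately show ?thesis by (rule measurable_compose[rotated])
      qed
      \<comment> \<open>Measurability of the sum of natural numbers is obtained by passing to a real
        sum and back through the floor.\<close>
      have "(\<lambda>t. \<Sum>i\<in>I. real (nat \<lfloor>real n * t i\<rfloor>)) \<in> borel_measurable ?M"
        by (intro borel_measurable_sum measurable_compose[OF comp]) auto
      then have "(\<lambda>t. nat \<lfloor>\<Sum>i\<in>I. real (nat \<lfloor>real n * t i\<rfloor>)\<rfloor>) \<in> measurable ?M (count_space UNIV)"
        by measurable
      also have "(\<lambda>t. nat \<lfloor>\<Sum>i\<in>I. real (nat \<lfloor>real n * t i\<rfloor>)\<rfloor>) = (\<lambda>t. \<Sum>i\<in>I. nat \<lfloor>real n * t i\<rfloor>)"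
        by (simp flip: of_nat_sum)
      finally have "(\<lambda>t. nb_coeff a (n - (\<Sum>i\<in>I. nat \<lfloor>real n * t i\<rfloor>))) \<in> borel_measurable ?M"
        by (rule measurable_compose[where g = "\<lambda>l. nb_coeff a (n - l)"]) simp
      moreover have "(\<lambda>t. \<Prod>i\<in>I. nb_coeff a (nat \<lfloor>real n * t i\<rfloor>)) \<in> borel_measurable ?M"
        by (intro borel_measurable_prod measurable_compose[OF comp]) auto
      ultimately have "(\<lambda>t. real n ^ card I * ((\<Prod>i\<in>I. nb_coeff a (nat \<lfloor>real n * t i\<rfloor>)) * nb_coeff a (n - (\<Sum>i\<in>I. nat \<lfloor>real n * t i\<rfloor>)))) \<in> borel_measurable ?M"
        by (intro borel_measurable_times borel_measurable_const)
      moreover have "(\<lambda>t. real n ^ card I * ((\<Prod>i\<in>I. nb_coeff a (nat \<lfloor>real n * t i\<rfloor>)) * nb_coeff a (n - (\<Sum>i\<in>I. nat \<lfloor>real n * t i\<rfloor>)))) = (\<lambda>t. \<phi> (?e t))"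
        unfolding \<phi>_def w_def by simp
      ultimately have [measurable]: "(\<lambda>t. \<phi> (?e t)) \<in> borel_measurable ?M" by (simp only:)
      show ?thesis by measurable
    qed
    have "(\<integral>\<^sup>+ t. ennreal (dirichlet_dens I a t) * indicator ?R t \<partial>?M) \<le> (\<integral>\<^sup>+ t. ennreal (\<phi> (?e t)) * indicator ?R t + ennreal (?err t) \<partial>?M)"
    proof (intro nn_integral_mono)
      fix t
      show "ennreal (dirichlet_dens I a t) * indicator ?R t \<le> ennreal (\<phi> (?e t)) * indicator ?R t + ennreal (?err t)"
      proof (cases "t \<in> ?R")
        case True
        have "ennreal (dirichlet_dens I a t) \<le> ennreal (\<phi> (?e t) + ?err t)"
          using pw[OF True] by (intro ennreal_leI) linarith
        then show ?thesis using True \<phi>0 e0 by (simp add: ennreal_plus)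
      qed simp
    qed
    also have "\<dots> = (\<integral>\<^sup>+ t. ennreal (\<phi> (?e t)) * indicator ?R t \<partial>?M) + (\<integral>\<^sup>+ t. ennreal (?err t) \<partial>?M)"
      by (intro nn_integral_add \<phi>_meas) measurable
    also have "\<dots> \<le> ennreal (\<Sum>e\<in>(\<Pi>\<^sub>E i\<in>I. {..<m i}). w e) + ennreal (K * B * real n powr - a)"
      unfolding step by (intro add_mono err order_refl)
    finally show "ennreal (dirichlet_box_sum I a n m) \<le> dirichlet_box I a n m + ennreal (K * B * real n powr - a) \<and>
        dirichlet_box I a n m \<le> ennreal (dirichlet_box_sum I a n m) + ennreal (K * B * real n powr - a)"
      using 1 by (simp only: w_def dirichlet_box_sum_def dirichlet_box_def simp_thms)
  qed
qed

text \<open>The coordinate \<open>j\<close> is determined by the others, and the bound on the sum of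
  the m i makes the natural number difference a genuine one.\<close>

lemma sum_decomps_box:
  fixes f :: "nat \<Rightarrow> real" and m :: "'i \<Rightarrow> nat"
  assumes I: "finite I" "j \<notin> I" and m: "(\<Sum>i\<in>I. m i) \<le> n"
  shows "(\<Sum>d\<in>decomps (insert j I) n. (\<Prod>i\<in>insert j I. f (d i)) * of_bool (\<forall>i\<in>I. d i < m i)) =
    (\<Sum>e\<in>(\<Pi>\<^sub>E i\<in>I. {..<m i}). (\<Prod>i\<in>I. f (e i)) * f (n - (\<Sum>i\<in>I. e i)))"
proof -
  let ?A = "{d \<in> decomps (insert j I) n. \<forall>i\<in>I. d i < m i}"
  have "(\<Sum>d\<in>decomps (insert j I) n. (\<Prod>i\<in>insert j I. f (d i)) * of_bool (\<forall>i\<in>I. d i < m i)) =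
      (\<Sum>d\<in>?A. \<Prod>i\<in>insert j I. f (d i))"
    using I by (subst sum.inter_filter) (auto intro!: sum.cong)
  also have "\<dots> = (\<Sum>e\<in>(\<Pi>\<^sub>E i\<in>I. {..<m i}). (\<Prod>i\<in>I. f (e i)) * f (n - (\<Sum>i\<in>I. e i)))"
  proof (rule sum.reindex_bij_witness[where i = "\<lambda>e. e(j := n - (\<Sum>i\<in>I. e i))" and j = "\<lambda>d. restrict d I"])
    fix d assume d: "d \<in> ?A"
    then have dext: "d \<in> extensional (insert j I)" and dsum: "d j + (\<Sum>i\<in>I. d i) = n"
      using I by (auto simp: decomps_def PiE_iff)
    then have dj: "n - (\<Sum>i\<in>I. d i) = d j" by simp
    show "(restrict d I)(j := n - (\<Sum>i\<in>I. restrict d I i)) = d"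
      using dext dj I by (auto simp: fun_eq_iff extensional_def)
    show "restrict d I \<in> (\<Pi>\<^sub>E i\<in>I. {..<m i})" using d by auto
    show "(\<Prod>i\<in>I. f (restrict d I i)) * f (n - (\<Sum>i\<in>I. restrict d I i)) = (\<Prod>i\<in>insert j I. f (d i))"
      using I dj by (simp add: mult.commute)
  next
    fix e assume e: "e \<in> (\<Pi>\<^sub>E i\<in>I. {..<m i})"
    have upd: "(e(j := x)) i = e i" if "i \<in> I" for i x using that I by auto
    have "(\<Sum>i\<in>I. e i) \<le> (\<Sum>i\<in>I. m i)" using e by (intro sum_mono) (auto simp: less_imp_le PiE_iff)
    then have le: "(\<Sum>i\<in>I. e i) \<le> n" using m by simp
    show "restrict (e(j := n - (\<Sum>i\<in>I. e i))) I = e"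
      using e I by (auto simp: fun_eq_iff PiE_iff extensional_def)
    have "(\<Sum>i\<in>insert j I. (e(j := n - (\<Sum>i\<in>I. e i))) i) = (n - (\<Sum>i\<in>I. e i)) + (\<Sum>i\<in>I. e i)"
      using I upd by simp
    then have "(\<Sum>i\<in>insert j I. (e(j := n - (\<Sum>i\<in>I. e i))) i) = n" using le by simp
    moreover have "e(j := n - (\<Sum>i\<in>I. e i)) \<in> insert j I \<rightarrow>\<^sub>E UNIV"
      using e by (auto simp: PiE_iff extensional_def)
    moreover have "\<forall>i\<in>I. (e(j := n - (\<Sum>i\<in>I. e i))) i < m i"
      using e I by (auto simp: PiE_iff)
    ultimately show "e(j := n - (\<Sum>i\<in>I. e i)) \<in> ?A"
      unfolding decomps_def by blast
  qed
  finally show ?thesis .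
qed

section \<open>Rounding the thresholds\<close>

text \<open>Integrating out the other coordinates leaves \<open>nn_integral_pow_dens_window\<close>;
  the function \<open>h\<close> is the factor of coordinate \<open>i\<close>, cut to the window and
  carrying the normalisation.\<close>

lemma dirichlet_window:
  fixes I :: "'i set"
  assumes I: "finite I" "I \<noteq> {}" and a: "a = 1 / (real (card I) + 1)"
  obtains C where "C \<ge> 0"
    "\<And>n i \<alpha> \<beta>. n \<ge> 1 \<Longrightarrow> i \<in> I \<Longrightarrow> 0 \<le> \<alpha> \<Longrightarrow> \<beta> \<le> 1 \<Longrightarrow> \<beta> - \<alpha> \<le> 1 / real n \<Longrightarrow>
      (\<integral>\<^sup>+ t. ennreal (dirichlet_dens I a t * indicator {\<alpha>..\<beta>} (t i)) \<partial>lborel_on I) \<le> ennreal (C * real n powr - a)"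
proof -
  have cI: "card I > 0" using I by (simp add: card_gt_0_iff)
  have a01: "0 < a" "a \<le> 1 / 2" using cI by (auto simp: a field_simps)
  have ca: "real (card I) * a = 1 - a" by (simp add: a field_simps)
  have G: "Gamma a > 0" using a01 by (intro Gamma_real_pos)
  obtain K where K: "K \<ge> 0"
    "\<And>i h B. i \<in> I \<Longrightarrow> h \<in> borel_measurable borel \<Longrightarrow> (\<And>y. h y \<ge> 0) \<Longrightarrow> B \<ge> 0 \<Longrightarrow>
      (\<integral>\<^sup>+ y. ennreal (h y * pow_dens (1 - a) (1 - y)) \<partial>lborel) \<le> ennreal B \<Longrightarrow>
      (\<integral>\<^sup>+ t. ennreal (h (t i) * ((\<Prod>j\<in>I - {i}. pow_dens a (t j)) * pow_dens a (1 - (\<Sum>j\<in>I. t j)))) \<partial>lborel_on I) \<le> ennreal (K * B)"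
    using nn_integral_PiM_coordinate_le[OF I(1) a01(1)] unfolding ca by blast
  let ?B = "2 / a + 2 / (1 - a)" and ?g = "1 / Gamma a ^ (card I + 1)"
  have B: "?B \<ge> 0" using a01 by simp
  have g: "?g \<ge> 0" using G by simp
  show ?thesis
  proof
    show "K * (?g * ?B) \<ge> 0" using K(1) B g by simp
    fix n :: nat and i and \<alpha> \<beta> :: real
    assume n: "n \<ge> 1" and i: "i \<in> I" and w: "0 \<le> \<alpha>" "\<beta> \<le> 1" "\<beta> - \<alpha> \<le> 1 / real n"
    let ?h = "\<lambda>y. ?g * (pow_dens a y * indicator {\<alpha>..\<beta>} y)"
    have "dirichlet_dens I a t * indicator {\<alpha>..\<beta>} (t i) =
        ?h (t i) * ((\<Prod>j\<in>I - {i}. pow_dens a (t j)) * pow_dens a (1 - (\<Sum>j\<in>I. t j)))" for t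
      unfolding dirichlet_dens_def using prod.remove[OF I(1) i, of "\<lambda>i. pow_dens a (t i)"] by simp
    then have "(\<integral>\<^sup>+ t. ennreal (dirichlet_dens I a t * indicator {\<alpha>..\<beta>} (t i)) \<partial>lborel_on I) =
        (\<integral>\<^sup>+ t. ennreal (?h (t i) * ((\<Prod>j\<in>I - {i}. pow_dens a (t j)) * pow_dens a (1 - (\<Sum>j\<in>I. t j)))) \<partial>lborel_on I)"
      by (simp only:)
    also have "\<dots> \<le> ennreal (K * (?g * (?B * real n powr - a)))"
    proof (rule K(2)[OF i])
      have "(\<integral>\<^sup>+ y. ennreal (?h y * pow_dens (1 - a) (1 - y)) \<partial>lborel) =
          (\<integral>\<^sup>+ y. ennreal ?g * ennreal ((pow_dens a y * indicator {\<alpha>..\<beta>} y) * pow_dens (1 - a) (1 - y)) \<partial>lborel)"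
        unfolding mult.assoc[of ?g] using g by (intro nn_integral_cong ennreal_mult') auto
      also have "\<dots> = ennreal ?g * (\<integral>\<^sup>+ y. ennreal ((pow_dens a y * indicator {\<alpha>..\<beta>} y) * pow_dens (1 - a) (1 - y)) \<partial>lborel)"
        by (intro nn_integral_cmult) measurable
      also have "\<dots> \<le> ennreal ?g * ennreal (?B * real n powr - a)"
        by (intro mult_left_mono nn_integral_pow_dens_window a01 n w) auto
      also have "\<dots> = ennreal (?g * (?B * real n powr - a))" using g by (rule ennreal_mult'[symmetric])
      finally show "(\<integral>\<^sup>+ y. ennreal (?h y * pow_dens (1 - a) (1 - y)) \<partial>lborel) \<le> ennreal (?g * (?B * real n powr - a))" .
    qed (use g B in auto)
    finally show "(\<integral>\<^sup>+ t. ennreal (dirichlet_dens I a t * indicator {\<alpha>..\<beta>} (t i)) \<partial>lborel_on I) \<le> ennreal (K * (?g * ?B) * real n powr - a)"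
      by (simp only: mult.assoc)
  qed
qed

text \<open>Rounding n u i down to an integer m i reduces the claim to boxes on the grid. The
  discrete side loses the points with some d i = m i, the continuous side a slab of thickness at
  most 1/n per coordinate, and each loss is O(n^(-a)).\<close>

lemma dirichlet_multinomial_cdf:
  fixes I :: "'i set" and j :: 'i
  assumes I: "finite I" "I \<noteq> {}" "j \<notin> I" and a: "a = 1 / (real (card I) + 1)"
  obtains C where "C \<ge> 0"
    "\<And>n u. n \<ge> 1 \<Longrightarrow> (\<And>i. i \<in> I \<Longrightarrow> u i \<ge> 0) \<Longrightarrow> (\<Sum>i\<in>I. u i) \<le> 1 \<Longrightarrow>
      \<bar>(\<Sum>d\<in>decomps (insert j I) n. (\<Prod>i\<in>insert j I. nb_coeff a (d i)) * of_bool (\<forall>i\<in>I. real (d i) \<le> real n * u i))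
        - (\<integral>t. dirichlet_dens I a t * indicator (\<Pi>\<^sub>E i\<in>I. {0..u i}) t \<partial>lborel_on I)\<bar> \<le> C * real n powr - a"
proof -
  let ?J = "insert j I"
  let ?M = "lborel_on I"
  have cI: "card I > 0" using I by (simp add: card_gt_0_iff)
  have a01: "0 < a" "a \<le> 1" using cI by (auto simp: a)
  have cJ: "card ?J = card I + 1" "finite ?J" using I by auto
  have aJ: "a = 1 / real (card ?J)" using a cJ by simp
  obtain C1 where C1: "C1 > 0"
    "\<And>N i (S :: nat set). i \<in> ?J \<Longrightarrow> finite S \<Longrightarrow>
       (\<Sum>d\<in>decomps ?J N. (\<Prod>i\<in>?J. nb_coeff a (d i)) * of_bool (d i \<in> S))
         \<le> C1 * real (card S) * (real N + 1) powr - a"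
    using nb_coeff_window_le[of ?J] cJ cI unfolding aJ[symmetric] by auto
  obtain C2 where C2: "C2 \<ge> 0"
    "\<And>n m. n \<ge> 1 \<Longrightarrow> (\<Sum>i\<in>I. m i) \<le> n \<Longrightarrow>
      ennreal (dirichlet_box_sum I a n m) \<le> dirichlet_box I a n m + ennreal (C2 * real n powr - a) \<and>
      dirichlet_box I a n m \<le> ennreal (dirichlet_box_sum I a n m) + ennreal (C2 * real n powr - a)"
    using dirichlet_riemann_sum[OF I(1,2) a] by blast
  obtain C3 where C3: "C3 \<ge> 0"
    "\<And>n i \<alpha> \<beta>. n \<ge> 1 \<Longrightarrow> i \<in> I \<Longrightarrow> 0 \<le> \<alpha> \<Longrightarrow> \<beta> \<le> 1 \<Longrightarrow> \<beta> - \<alpha> \<le> 1 / real n \<Longrightarrow>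
      (\<integral>\<^sup>+ t. ennreal (dirichlet_dens I a t * indicator {\<alpha>..\<beta>} (t i)) \<partial>?M) \<le> ennreal (C3 * real n powr - a)"
    using dirichlet_window[OF I(1,2) a] by blast
  show ?thesis
  proof
    show "real (card I) * C1 + C2 + real (card I) * C3 \<ge> 0" using C1 C2 C3 by simp
    fix n :: nat and u :: "'i \<Rightarrow> real"
    assume n: "n \<ge> 1" and u: "\<And>i. i \<in> I \<Longrightarrow> u i \<ge> 0" and usum: "(\<Sum>i\<in>I. u i) \<le> 1"
    have npos: "real n > 0" using n by simp
    define m where "m i = nat \<lfloor>real n * u i\<rfloor>" for i
    have m: "real (m i) \<le> real n * u i" "real n * u i < real (m i) + 1" if "i \<in> I" for i
    proof -
      have "real (nat \<lfloor>real n * u i\<rfloor>) = of_int \<lfloor>real n * u i\<rfloor>" using u[OF that] by (intro of_nat_nat) auto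
      then show "real (m i) \<le> real n * u i" "real n * u i < real (m i) + 1" unfolding m_def by linarith+
    qed
    have "(\<Sum>i\<in>I. real (m i)) \<le> (\<Sum>i\<in>I. real n * u i)" by (intro sum_mono m)
    also have "\<dots> = real n * (\<Sum>i\<in>I. u i)" by (simp add: sum_distrib_left)
    also have "\<dots> \<le> real n * 1" using usum by (intro mult_left_mono) auto
    finally have msum: "(\<Sum>i\<in>I. m i) \<le> n" by (simp flip: of_nat_sum)
    let ?w = "\<lambda>d. \<Prod>i\<in>?J. nb_coeff a (d i)"
    define H where "H = (\<Sum>d\<in>decomps ?J n. ?w d * of_bool (\<forall>i\<in>I. real (d i) \<le> real n * u i))"
    define P where "P = (\<Sum>d\<in>decomps ?J n. ?w d * of_bool (\<forall>i\<in>I. d i < m i))"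
    let ?R = "\<Pi>\<^sub>E i\<in>I. {0<..<real (m i) / real n}" and ?U = "\<Pi>\<^sub>E i\<in>I. {0..u i}"
    define G where "G = dirichlet_box I a n m"
    define F where "F = (\<integral>\<^sup>+ t. ennreal (dirichlet_dens I a t * indicator ?U t) \<partial>?M)"
    let ?E = "real n powr - a"
    have w0: "?w d \<ge> 0" for d using a01 by (intro prod_nonneg nb_coeff_nonneg) auto
    have HP: "P \<le> H" "H \<le> P + real (card I) * C1 * ?E"
    proof -
      show "P \<le> H" unfolding P_def H_def
      proof (intro sum_mono mult_left_mono w0)
        fix d :: "'i \<Rightarrow> nat"
        have "real (d i) \<le> real n * u i" if "i \<in> I" "d i < m i" for i
          using m(1)[OF that(1)] that(2) by linarith
        then show "of_bool (\<forall>i\<in>I. d i < m i) \<le> (of_bool (\<forall>i\<in>I. real (d i) \<le> real n * u i) :: real)"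
          by simp
      qed
      have "H \<le> (\<Sum>d\<in>decomps ?J n. ?w d * of_bool (\<forall>i\<in>I. d i < m i) + (\<Sum>i\<in>I. ?w d * of_bool (d i \<in> {m i})))"
        unfolding H_def
      proof (intro sum_mono)
        fix d :: "'i \<Rightarrow> nat"
        have eq: "d i < m i \<or> d i = m i" if "i \<in> I" "real (d i) \<le> real n * u i" for i
        proof -
          have "real (d i) < real (m i) + 1" using that m(2)[OF that(1)] by simp
          then show ?thesis by linarith
        qed
        have sum0: "(\<Sum>i\<in>I. ?w d * of_bool (d i \<in> {m i})) \<ge> 0" using w0 by (intro sum_nonneg mult_nonneg_nonneg) auto
        show "?w d * of_bool (\<forall>i\<in>I. real (d i) \<le> real n * u i) \<le> ?w d * of_bool (\<forall>i\<in>I. d i < m i) + (\<Sum>i\<in>I. ?w d * of_bool (d i \<in> {m i}))"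
        proof (cases "(\<forall>i\<in>I. real (d i) \<le> real n * u i) \<and> \<not> (\<forall>i\<in>I. d i < m i)")
          case True
          then obtain i where i: "i \<in> I" "d i = m i" using eq by blast
          have "?w d * of_bool (d i \<in> {m i}) \<le> (\<Sum>i\<in>I. ?w d * of_bool (d i \<in> {m i}))"
            using i(1) I w0 by (intro member_le_sum) (auto intro!: mult_nonneg_nonneg)
          moreover have "?w d * of_bool (d i \<in> {m i}) = ?w d" using i by simp
          moreover have "?w d * of_bool (\<forall>i\<in>I. real (d i) \<le> real n * u i) = ?w d" using True by simp
          moreover have "?w d * of_bool (\<forall>i\<in>I. d i < m i) \<ge> 0" using w0[of d] by simp
          ultimately show ?thesis by linarith
        next
          case False
          then have "?w d * of_bool (\<forall>i\<in>I. real (d i) \<le> real n * u i) \<le> ?w d * of_bool (\<forall>i\<in>I. d i < m i)"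
            using w0 by (intro mult_left_mono) auto
          then show ?thesis using sum0 by linarith
        qed
      qed
      also have "\<dots> = P + (\<Sum>i\<in>I. \<Sum>d\<in>decomps ?J n. ?w d * of_bool (d i \<in> {m i}))"
        unfolding P_def sum.distrib by (subst sum.swap) simp
      also have "(\<Sum>i\<in>I. \<Sum>d\<in>decomps ?J n. ?w d * of_bool (d i \<in> {m i})) \<le> (\<Sum>i\<in>I. C1 * ?E)"
      proof (intro sum_mono)
        fix i assume i: "i \<in> I"
        have "(\<Sum>d\<in>decomps ?J n. ?w d * of_bool (d i \<in> {m i})) \<le> C1 * real (card {m i}) * (real n + 1) powr - a"
          using i by (intro C1) auto
        also have "\<dots> \<le> C1 * ?E"
          using C1 a01 n by (auto intro!: mult_left_mono powr_mono2')
        finally show "(\<Sum>d\<in>decomps ?J n. ?w d * of_bool (d i \<in> {m i})) \<le> C1 * ?E" .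
      qed
      finally show "H \<le> P + real (card I) * C1 * ?E" by simp
    qed
    have P_box: "P = dirichlet_box_sum I a n m"
      unfolding P_def dirichlet_box_sum_def by (rule sum_decomps_box[OF I(1,3) msum])
    have P0: "P \<ge> 0" unfolding P_def using w0 by (intro sum_nonneg mult_nonneg_nonneg) auto
    have PG: "ennreal P \<le> G + ennreal (C2 * ?E)" "G \<le> ennreal P + ennreal (C2 * ?E)"
      unfolding P_box G_def using C2(2)[OF n msum] by blast+
    have d0: "dirichlet_dens I a t \<ge> 0" for t using a01 by (intro dirichlet_dens_nonneg)
    have sets: "?R \<in> sets ?M" "?U \<in> sets ?M" using I by (intro sets_PiM_I_finite; auto)+
    note [measurable] = sets
    have [measurable]: "dirichlet_dens I a \<in> borel_measurable ?M" using I by (intro borel_measurable_dirichlet_dens)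
    have GF: "G \<le> F" unfolding G_def dirichlet_box_def F_def
    proof (intro nn_integral_mono)
      fix t
      have "real (m i) / real n \<le> u i" if "i \<in> I" for i
        using m(1)[OF that] npos by (simp add: field_simps)
      then have "t \<in> ?R \<Longrightarrow> t \<in> ?U" by (force simp: PiE_iff)
      then show "ennreal (dirichlet_dens I a t) * indicator ?R t \<le> ennreal (dirichlet_dens I a t * indicator ?U t)"
        by (auto simp: indicator_def)
    qed
    have FG: "F \<le> G + ennreal (real (card I) * C3 * ?E)"
    proof -
      let ?W = "\<lambda>i t. ennreal (dirichlet_dens I a t * indicator {real (m i) / real n..u i} (t i))"
      have "F \<le> (\<integral>\<^sup>+ t. ennreal (dirichlet_dens I a t) * indicator ?R t + (\<Sum>i\<in>I. ?W i t) \<partial>?M)"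
        unfolding F_def
      proof (intro nn_integral_mono)
        fix t
        show "ennreal (dirichlet_dens I a t * indicator ?U t) \<le> ennreal (dirichlet_dens I a t) * indicator ?R t + (\<Sum>i\<in>I. ?W i t)"
        proof (cases "t \<in> ?U \<and> dirichlet_dens I a t \<noteq> 0 \<and> t \<notin> ?R")
          case False
          then show ?thesis by (cases "t \<in> ?U"; cases "dirichlet_dens I a t = 0") (auto simp: add_increasing2)
        next
          case True
          \<comment> \<open>The density vanishes where a coordinate is 0, so it costs nothing that
            \<open>?R\<close> is open at 0.\<close>
          then have "\<forall>i\<in>I. pow_dens a (t i) \<noteq> 0" using I by (auto simp: dirichlet_dens_def)
          then have "\<forall>i\<in>I. 0 < t i" by (auto simp: pow_dens_def split: if_splits)
          moreover have tU: "t \<in> ?U" and "t \<notin> ?R" using True by blast+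
          moreover from tU have "t \<in> extensional I" by (simp add: PiE_iff)
          ultimately obtain i where i: "i \<in> I" "\<not> t i < real (m i) / real n"
            unfolding PiE_iff by auto
          then have ti: "t i \<in> {real (m i) / real n..u i}" using tU by auto
          have "?W i t \<le> (\<Sum>i\<in>I. ?W i t)" using i I by (intro member_le_sum) auto
          then show ?thesis using True ti by simp
        qed
      qed
      also have "\<dots> = G + (\<Sum>i\<in>I. \<integral>\<^sup>+ t. ?W i t \<partial>?M)"
      proof -
        have W: "?W i \<in> borel_measurable ?M" if "i \<in> I" for i
        proof -
          have [measurable]: "(\<lambda>t. t i) \<in> borel_measurable ?M"
            using measurable_component_singleton[OF that, of "\<lambda>_. lborel"] by simp
          show ?thesis by measurable
        qed
        have "(\<lambda>t. ennreal (dirichlet_dens I a t) * indicator ?R t) \<in> borel_measurable ?M" by measurable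
        moreover have "(\<lambda>t. \<Sum>i\<in>I. ?W i t) \<in> borel_measurable ?M" by (intro borel_measurable_sum W)
        ultimately have "(\<integral>\<^sup>+ t. ennreal (dirichlet_dens I a t) * indicator ?R t + (\<Sum>i\<in>I. ?W i t) \<partial>?M) = G + (\<integral>\<^sup>+ t. (\<Sum>i\<in>I. ?W i t) \<partial>?M)"
          unfolding G_def dirichlet_box_def by (intro nn_integral_add)
        also have "(\<integral>\<^sup>+ t. (\<Sum>i\<in>I. ?W i t) \<partial>?M) = (\<Sum>i\<in>I. \<integral>\<^sup>+ t. ?W i t \<partial>?M)"
          by (intro nn_integral_sum W)
        finally show ?thesis .
      qed
      also have "(\<Sum>i\<in>I. \<integral>\<^sup>+ t. ?W i t \<partial>?M) \<le> (\<Sum>i\<in>I. ennreal (C3 * ?E))"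
      proof (intro sum_mono C3 n)
        fix i assume i: "i \<in> I"
        have "u i \<le> (\<Sum>i\<in>I. u i)" using i I u by (intro member_le_sum) auto
        then show "u i \<le> 1" using usum by simp
        have "u i \<le> (real (m i) + 1) / real n" using m(2)[OF i] npos by (simp add: field_simps)
        then show "u i - real (m i) / real n \<le> 1 / real n" by (simp add: add_divide_distrib)
      qed auto
      also have "(\<Sum>i\<in>I. ennreal (C3 * ?E)) = ennreal (\<Sum>i\<in>I. C3 * ?E)"
        using C3 by (intro sum_ennreal) auto
      also have "(\<Sum>i\<in>I. C3 * ?E) = real (card I) * C3 * ?E" by simp
      finally show ?thesis by (simp add: add_left_mono)
    qed
    define f where "f = (\<integral>t. dirichlet_dens I a t * indicator ?U t \<partial>?M)"
    have f_eq: "f = enn2real F"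
      unfolding f_def F_def using d0 by (intro integral_eq_nn_integral) auto
    have e0: "C2 * ?E \<ge> 0" "real (card I) * C3 * ?E \<ge> 0" using C2 C3 by auto
    have "F \<le> ennreal P + ennreal (C2 * ?E) + ennreal (real (card I) * C3 * ?E)"
      using FG PG(2) by (meson add_right_mono order_trans)
    also have "\<dots> = ennreal (P + C2 * ?E + real (card I) * C3 * ?E)"
      using P0 e0 by (simp add: ennreal_plus)
    \<comment> \<open>This bound is also what shows that the integral is finite, so from here on it
      can be handled as a real number.\<close>
    finally have F_le: "F \<le> ennreal (P + C2 * ?E + real (card I) * C3 * ?E)" .
    then have F_fin: "F = ennreal f"
      unfolding f_eq by (metis ennreal_enn2real ennreal_less_top le_less_trans)
    have f0: "f \<ge> 0" unfolding f_eq by simp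
    have 1: "f \<le> P + C2 * ?E + real (card I) * C3 * ?E"
      using F_le P0 e0 unfolding F_fin by (subst (asm) ennreal_le_iff) auto
    have "ennreal P \<le> ennreal f + ennreal (C2 * ?E)"
      using PG(1) GF unfolding F_fin by (meson add_right_mono order_trans)
    then have "ennreal P \<le> ennreal (f + C2 * ?E)" using f0 e0 by (simp add: ennreal_plus)
    then have 2: "P \<le> f + C2 * ?E" using f0 e0 by (subst (asm) ennreal_le_iff) auto
    have "0 \<le> real (card I) * C1 * ?E" using C1 by auto
    then have "\<bar>H - f\<bar> \<le> real (card I) * C1 * ?E + C2 * ?E + real (card I) * C3 * ?E"
      using 1 2 HP e0 by linarith
    then show "\<bar>(\<Sum>d\<in>decomps ?J n. ?w d * of_bool (\<forall>i\<in>I. real (d i) \<le> real n * u i)) - (\<integral>t. dirichlet_dens I a t * indicator ?U t \<partial>?M)\<bar>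
      \<le> (real (card I) * C1 + C2 + real (card I) * C3) * ?E"
      unfolding H_def f_def by (simp add: algebra_simps)
  qed
qed

section \<open>The distribution function and the statement for polynomials\<close>

text \<open>As 0 powr x = 0, \<open>powr\<close> and \<open>pow_dens\<close> agree on nonnegative
  arguments, and the condition on the sum of \<open>u\<close> keeps the last base nonnegative. The
  integrands agree up to the constant at every point of the closed box.\<close>

lemma dirichlet_cdf_eq:
  assumes k: "k \<ge> 2" and u: "\<And>i. i \<in> {1..k-1} \<Longrightarrow> u i \<ge> 0" and usum: "(\<Sum>i\<in>{1..k-1}. u i) \<le> 1"
  shows "dirichlet_cdf k u = (\<integral>t. dirichlet_dens {1..k-1} (1 / real k) t * indicator (\<Pi>\<^sub>E i\<in>{1..k-1}. {0..u i}) t \<partial>lborel_on {1..k-1})"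
proof -
  let ?I = "{1..k-1}" and ?a = "1 / real k"
  have k1: "card ?I + 1 = k" using k by simp
  have eq: "indicator (\<Pi>\<^sub>E i\<in>?I. {0..u i}) t *\<^sub>R ((\<Prod>i\<in>?I. t i powr (?a - 1)) * (1 - (\<Sum>i\<in>?I. t i)) powr (?a - 1)) =
      Gamma ?a ^ k * (dirichlet_dens ?I ?a t * indicator (\<Pi>\<^sub>E i\<in>?I. {0..u i}) t)" for t
  proof (cases "t \<in> (\<Pi>\<^sub>E i\<in>?I. {0..u i})")
    case True
    have "(\<Sum>i\<in>?I. t i) \<le> (\<Sum>i\<in>?I. u i)" using True by (intro sum_mono) (auto simp: PiE_iff)
    then have "1 - (\<Sum>i\<in>?I. t i) \<ge> 0" using usum by simp
    then have "(1 - (\<Sum>i\<in>?I. t i)) powr (?a - 1) = pow_dens ?a (1 - (\<Sum>i\<in>?I. t i))"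
      by (auto simp: pow_dens_def)
    moreover have "(\<Prod>i\<in>?I. t i powr (?a - 1)) = (\<Prod>i\<in>?I. pow_dens ?a (t i))"
      using True by (intro prod.cong refl) (auto simp: pow_dens_def PiE_iff less_le)
    moreover have "Gamma ?a \<noteq> 0" using k by (intro less_imp_neq[symmetric] Gamma_real_pos) auto
    ultimately show ?thesis using True unfolding dirichlet_dens_def k1 by simp
  qed simp
  have "Gamma ?a ^ k \<noteq> 0" using k by (intro power_not_zero less_imp_neq[symmetric] Gamma_real_pos) auto
  then show ?thesis
    unfolding dirichlet_cdf_def set_lebesgue_integral_def eq by simp
qed

theorem theorem2:
  fixes k q :: nat
  assumes "k \<ge> 2"
    and "CARD('a::{field,finite}) = q"
  shows "\<exists>C::real. \<forall>n::nat. \<forall>u::nat \<Rightarrow> real.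
    n \<ge> 1 \<longrightarrow> (\<forall>i\<in>{1..k-1}. u i \<ge> 0) \<longrightarrow> (\<Sum>i\<in>{1..k-1}. u i) \<le> 1 \<longrightarrow>
    \<bar>1 / real q ^ n *
        (\<Sum>F\<in>(monic_polys_deg n :: 'a poly set).
           1 / real (tau k F) *
           (\<Sum>D | D \<in> {1..k-1} \<rightarrow>\<^sub>E monic_polys \<and>
                  (\<forall>i\<in>{1..k-1}. real (degree (D i)) \<le> real n * u i) \<and>
                  (\<Prod>i\<in>{1..k-1}. D i) dvd F. 1))
      - dirichlet_cdf k u\<bar> \<le> C * real n powr (- 1 / real k)"
proof -
  interpret arithmetic_monoid "monic_irreds :: 'a poly set" degree q
    using arithmetic_monoid_monic_polys[where ?'a = 'a] assms(2) by simp
  let ?I = "{1..k-1}" and ?J = "{1..k}" and ?a = "1 / real k"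
  have J: "?J = insert k ?I" "k \<notin> ?I" "card ?J = k" "?I \<subseteq> ?J" "?I \<noteq> {}" using assms(1) by auto
  have aI: "?a = 1 / (real (card ?I) + 1)" using assms(1) by (simp add: of_nat_diff)
  let ?w = "\<lambda>d. \<Prod>i\<in>?J. nb_coeff ?a (d i)"
  obtain C1 where C1: "C1 \<ge> 0"
    "\<And>n v. n \<ge> 1 \<Longrightarrow>
      \<bar>(\<Sum>M\<in>elems n. real (card {D \<in> decomps ?J M. \<forall>i\<in>?I. real (wdeg (D i)) \<le> v i}) / real (card (decomps ?J M)))
       - real q ^ n * (\<Sum>d\<in>decomps ?J n. ?w d * of_bool (\<forall>i\<in>?I. real (d i) \<le> v i))\<bar>
      \<le> C1 * real q ^ n * real n powr - ?a"
    using uniform_factorization_distribution[of ?J ?I] J(3,4) assms(1) by auto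
  obtain C2 where C2: "C2 \<ge> 0"
    "\<And>n u. n \<ge> 1 \<Longrightarrow> (\<And>i. i \<in> ?I \<Longrightarrow> u i \<ge> 0) \<Longrightarrow> (\<Sum>i\<in>?I. u i) \<le> 1 \<Longrightarrow>
      \<bar>(\<Sum>d\<in>decomps ?J n. ?w d * of_bool (\<forall>i\<in>?I. real (d i) \<le> real n * u i))
        - (\<integral>t. dirichlet_dens ?I ?a t * indicator (\<Pi>\<^sub>E i\<in>?I. {0..u i}) t \<partial>lborel_on ?I)\<bar> \<le> C2 * real n powr - ?a"
    using dirichlet_multinomial_cdf[OF _ J(5,2) aI] unfolding J(1)[symmetric] by blast
  show ?thesis
  proof (intro exI[of _ "C1 + C2"] allI impI)
    fix n :: nat and u :: "nat \<Rightarrow> real"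
    assume n: "n \<ge> 1" and u: "\<forall>i\<in>?I. u i \<ge> 0" and usum: "(\<Sum>i\<in>?I. u i) \<le> 1"
    let ?S = "\<Sum>F\<in>(monic_polys_deg n :: 'a poly set). 1 / real (tau k F) *
           (\<Sum>D | D \<in> ?I \<rightarrow>\<^sub>E monic_polys \<and> (\<forall>i\<in>?I. real (degree (D i)) \<le> real n * u i) \<and> (\<Prod>i\<in>?I. D i) dvd F. 1)"
    let ?A = "\<lambda>M. real (card {D \<in> decomps ?J M. \<forall>i\<in>?I. real (wdeg (D i)) \<le> real n * u i}) / real (card (decomps ?J M))"
    let ?H = "\<Sum>d\<in>decomps ?J n. ?w d * of_bool (\<forall>i\<in>?I. real (d i) \<le> real n * u i)"
    have qn: "real q ^ n > 0" using q_ge by simp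
    have "?S = (\<Sum>F\<in>monic_polys_deg n. ?A (factor_mset F))"
    proof (intro sum.cong refl)
      fix F :: "'a poly" assume "F \<in> monic_polys_deg n"
      then have F: "F \<in> monic_polys" by (simp add: monic_polys_deg_def)
      have "card {D. D \<in> ?I \<rightarrow>\<^sub>E monic_polys \<and> (\<forall>i\<in>?I. real (degree (D i)) \<le> real n * u i) \<and> (\<Prod>i\<in>?I. D i) dvd F} =
          card {D \<in> decomps ?J (factor_mset F). \<forall>i\<in>?I. real (wdeg (D i)) \<le> real n * u i}"
        unfolding wdeg_def by (rule card_divisor_tuples[OF F]) (use assms(1) in simp)
      then show "1 / real (tau k F) * (\<Sum>D | D \<in> ?I \<rightarrow>\<^sub>E monic_polys \<and> (\<forall>i\<in>?I. real (degree (D i)) \<le> real n * u i) \<and> (\<Prod>i\<in>?I. D i) dvd F. 1) = ?A (factor_mset F)"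
        unfolding tau_eq_card_decomps[OF F] sum_constant by (simp only: mult_1_left mult_1_right times_divide_eq_left)
    qed
    also have "\<dots> = (\<Sum>M\<in>elems n. ?A M)"
      unfolding elems_def wdeg_def by (rule sum.reindex_bij_betw[OF bij_betw_factor_mset])
    finally have S: "?S = (\<Sum>M\<in>elems n. ?A M)" .
    \<comment> \<open>The thresholds n u i enter as an arbitrary \<open>v\<close>, of which
      \<open>C1\<close> is independent; this gives uniformity in u.\<close>
    have "\<bar>?S - real q ^ n * ?H\<bar> \<le> C1 * real q ^ n * real n powr - ?a"
      unfolding S using C1(2)[OF n, of "\<lambda>i. real n * u i"] .
    moreover have "\<bar>1 / r * x - y\<bar> \<le> c * e" if "\<bar>x - r * y\<bar> \<le> c * r * e" "r > 0" for x y r c e :: real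
    proof -
      have "1 / r * x - y = (x - r * y) / r" using that(2) by (simp add: diff_divide_distrib)
      then have "\<bar>1 / r * x - y\<bar> = \<bar>x - r * y\<bar> / r" using that(2) by simp
      also have "\<dots> \<le> c * r * e / r" using that by (intro divide_right_mono) auto
      finally show ?thesis using that(2) by simp
    qed
    ultimately have "\<bar>1 / real q ^ n * ?S - ?H\<bar> \<le> C1 * real n powr - ?a" using qn by blast
    moreover have "\<bar>?H - dirichlet_cdf k u\<bar> \<le> C2 * real n powr - ?a"
    proof -
      have eq: "dirichlet_cdf k u = (\<integral>t. dirichlet_dens ?I ?a t * indicator (\<Pi>\<^sub>E i\<in>?I. {0..u i}) t \<partial>lborel_on ?I)"
        by (rule dirichlet_cdf_eq) (use assms(1) u usum in auto)
      show ?thesis unfolding eq by (rule C2(2)) (use n u usum in auto)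
    qed
    ultimately have "\<bar>1 / real q ^ n * ?S - dirichlet_cdf k u\<bar> \<le> (C1 + C2) * real n powr - ?a"
      by (simp only: distrib_right) linarith
    then show "\<bar>1 / real q ^ n * ?S - dirichlet_cdf k u\<bar> \<le> (C1 + C2) * real n powr (- 1 / real k)"
      by simp
  qed
qed

end
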